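(* Let $t\ge6$ and $r\ge0$ be integers, and let $h_j(t,t,r)$ denote the principal multiplicities of the Frobenius parabolic $$\mathfrak p_{t,t,r}=\mathfrak q\bigl((2t^2+4r)\mid(t(t-1),\,t-1,\,2^{[r]},\,1,\,2^{[r]},\,t^2)\bigr)\subseteq\mathfrak{sl}_{2t^2+4r}.$$ Then for every integer $j$ with $3\le j\le t-3$, $$h_j(t,t,r)-h_{j+1}(t,t,r)=6jt-\frac{9j^2+j}{2}+1-4r.$$
   Context: All Lie algebras are finite-dimensional over $\mathbb C$. A Lie algebra $\mathfrak g$ is Frobenius if there is $F\in\mathfrak g^*$ whose Kirillov form $B_F(x,y)=F([x,y])$ is nondegenerate; the principal element $H=\widehat F$ is the unique element with $F([H,x])=F(x)$ for all $x\in\mathfrak g$. For the algebras considered here $\operatorname{ad}H$ is semisimple with integral eigenvalues, $\mathfrak g_j=\{x:[H,x]=jx\}$, and the principal multiplicities $h_j=\dim\mathfrak g_j$ are independent of the choice of $F$. For compositions $A,B$ of $n$ (cutting $1,\ldots,n$ into consecutive blocks), with $\alpha(i),\beta(i)$ the $A$-block and $B$-block containing $i$, the seaweed is $$\mathfrak q(A\mid B)=\mathfrak h\oplus\bigoplus_{i>j,\ \alpha(i)=\alpha(j)}\mathbb C E_{ij}\oplus\bigoplus_{i<j,\ \beta(i)=\beta(j)}\mathbb C E_{ij}\subseteq\mathfrak{sl}_n,$$ where $\mathfrak h$ is the trace-zero diagonal subalgebra. It is a parabolic when $A=(n)$. The notation $2^{[r]}$ means a list of $r$ parts equal to $2$.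 The algebras $\mathfrak p_{t,t,r}$ are all Frobenius. *)

theory Defs
  imports Complex_Main "Jordan_Normal_Form.VS_Connect"
begin

section \<open>Frobenius matrix Lie algebras and their principal multiplicities\<close>

text \<open>
  A Lie subalgebra of \<open>gl\<^sub>n\<close> over the complex numbers is represented by the set \<open>L\<close> of its
  elements, a subset of \<^term>\<open>carrier_mat n n\<close>. The parameter \<open>n\<close> is passed explicitly where the
  zero matrix or the ambient vector space is needed.
\<close>

definition lie_bracket :: "complex mat \<Rightarrow> complex mat \<Rightarrow> complex mat" where
  "lie_bracket x y = x * y - y * x"

text \<open>The values of a functional outside \<open>L\<close> are irrelevant.\<close>

definition linear_functional_on :: "complex mat set \<Rightarrow> (complex mat \<Rightarrow> complex) \<Rightarrow> bool" where
  "linear_functional_on L F \<longleftrightarrow>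
     (\<forall>x\<in>L. \<forall>y\<in>L. F (x + y) = F x + F y) \<and>
     (\<forall>c. \<forall>x\<in>L. F (c \<cdot>\<^sub>m x) = c * F x)"

definition kirillov_form :: "(complex mat \<Rightarrow> complex) \<Rightarrow> complex mat \<Rightarrow> complex mat \<Rightarrow> complex" where
  "kirillov_form F x y = F (lie_bracket x y)"

text \<open>
  \<open>L\<close> is a Frobenius Lie algebra iff it has a functional satisfying the following predicate.
  The Kirillov form is alternating, so a one-sided nondegeneracy condition suffices.
\<close>

definition frobenius_functional ::
    "nat \<Rightarrow> complex mat set \<Rightarrow> (complex mat \<Rightarrow> complex) \<Rightarrow> bool" where
  "frobenius_functional n L F \<longleftrightarrow>
     linear_functional_on L F \<and>
     (\<forall>x\<in>L. (\<forall>y\<in>L. kirillov_form F x y = 0) \<longrightarrow> x = 0\<^sub>m n n)"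

definition principal_element :: "complex mat set \<Rightarrow> (complex mat \<Rightarrow> complex) \<Rightarrow> complex mat" where
  "principal_element L F = (THE H. H \<in> L \<and> (\<forall>x\<in>L. F (lie_bracket H x) = F x))"

definition ad_eigenspace :: "complex mat set \<Rightarrow> complex mat \<Rightarrow> int \<Rightarrow> complex mat set" where
  "ad_eigenspace L H j = {x \<in> L. lie_bracket H x = of_int j \<cdot>\<^sub>m x}"

definition principal_mult ::
    "nat \<Rightarrow> complex mat set \<Rightarrow> (complex mat \<Rightarrow> complex) \<Rightarrow> int \<Rightarrow> nat" where
  "principal_mult n L F j =
     vectorspace.dim class_ring
       (module_mat TYPE(complex) n n\<lparr>carrier := ad_eigenspace L (principal_element L F) j\<rparr>)"

section \<open>Seaweed algebras\<close>

text \<open>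
  Compositions of \<open>n\<close> are lists of positive naturals with sum \<open>n\<close>. As matrix indices start at 0,
  the \<open>k\<close>-th block of \<open>A\<close> (also counted from 0) consists of the \<open>i\<close> with
  \<open>A\<^sub>0 + \<dots> + A\<^sub>k\<^sub>-\<^sub>1 \<le> i < A\<^sub>0 + \<dots> + A\<^sub>k\<close>.
\<close>

definition block_of :: "nat list \<Rightarrow> nat \<Rightarrow> nat" where
  "block_of A i = (LEAST k. i < sum_list (take (Suc k) A))"

definition sl_mat :: "nat \<Rightarrow> complex mat set" where
  "sl_mat n = {x \<in> carrier_mat n n. (\<Sum>i<n. x $$ (i, i)) = 0}"

text \<open>
  The direct sum of the trace-zero diagonal matrices and of the lines spanned by the admissible
  matrix units is written as the set of trace-zero matrices supported on the diagonal and the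
  admissible positions. It is meant for compositions \<open>A\<close> and \<open>B\<close> of the same number.
\<close>

definition seaweed :: "nat list \<Rightarrow> nat list \<Rightarrow> complex mat set" where
  "seaweed A B = {x \<in> sl_mat (sum_list A).
     \<forall>i < sum_list A. \<forall>j < sum_list A. x $$ (i, j) \<noteq> 0 \<longrightarrow>
       i = j \<or>
       (i > j \<and> block_of A i = block_of A j) \<or>
       (i < j \<and> block_of B i = block_of B j)}"

definition p_size :: "nat \<Rightarrow> nat \<Rightarrow> nat" where
  "p_size t r = 2 * t\<^sup>2 + 4 * r"

definition p_ttr :: "nat \<Rightarrow> nat \<Rightarrow> complex mat set" where
  "p_ttr t r = seaweed [p_size t r]
     ([t * (t - 1), t - 1] @ replicate r 2 @ [1] @ replicate r 2 @ [t\<^sup>2])"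

end

theory Submission
  imports Defs "HOL-Computational_Algebra.Polynomial_FPS" "HOL-Computational_Algebra.Formal_Laurent_Series"
begin

text \<open>
  For a Frobenius functional \<open>F\<close> write \<open>H\<close> for its principal element. The proof has three parts.

  The multiplicities do not depend on \<open>F\<close>. Join two Frobenius functionals by a line
  \<open>F\<^sub>s = F\<^sub>0 + s (F\<^sub>1 - F\<^sub>0)\<close>. As the Kirillov form of \<open>F\<^sub>0\<close> is nondegenerate, the principal element
  \<open>H\<^sub>s\<close> and the solution \<open>\<eta>\<^sub>s\<close> of \<open>F\<^sub>s([\<eta>\<^sub>s, x]) = (F\<^sub>1 - F\<^sub>0)(x)\<close> are power series in \<open>s\<close>. Every direction
  in the dual space is a coadjoint direction, so the motion of \<open>H\<^sub>s\<close> is infinitesimally a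
  conjugation: \<open>H' = [H, \<eta>]\<close>. Every product \<open>X\<close> of factors \<open>ad H - r\<close> then satisfies
  \<open>X' = [X, ad \<eta>]\<close>. So \<open>X\<close> vanishes if it vanishes at \<open>s = 0\<close>, and its trace is constant. Up to a
  power of a determinant \<open>X\<close> is a polynomial in \<open>s\<close>, which carries both statements over to
  \<open>s = 1\<close> (\<open>principal_spectrum_invariance\<close>). If \<open>ad H\<^sub>0\<close> is diagonal, then \<open>ad H\<^sub>1\<close> is diagonalisable
  with the same eigenvalues and multiplicities; the multiplicity is the trace of a spectral projection
  (\<open>principal_mult_eq_card\<close>).

  One Frobenius functional is explicit. Let \<open>\<sigma>\<close> and \<open>\<tau>\<close> reverse the blocks of \<open>A\<close> and of \<open>B\<close>. The meander
  functional adds up the entries at \<open>(i, \<sigma> i)\<close> with \<open>\<sigma> i < i\<close> and at \<open>(i, \<tau> i)\<close> with \<open>i < \<tau> i\<close>. Its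
  kernel is trivial if the only admissible matrices that commute with it modulo the annihilator
  of the algebra are scalar; such a pair of compositions is called rigid. A reduction
  replaces \<open>(a, A | b, B)\<close> by \<open>(A | b - 2a, a, B)\<close>. If the reduced pair is rigid, so is the original one
  (\<open>rigid_left\<close>), and repeated reductions at both ends shrink the compositions of the theorem to \<open>(1 | 1)\<close> (\<open>rigid_pttr\<close>). The
  principal element is diagonal, and its entries are, up to a common constant, an explicit height
  function that changes by one along every pair joined by \<open>\<sigma>\<close> or \<open>\<tau>\<close>. So the multiplicity of \<open>j \<noteq> 0\<close> is the number of
  admissible positions \<open>(i, k)\<close> whose heights differ by \<open>j\<close> (\<open>principal_mult_seaweed\<close>).

  The positions are counted with generating functions. The number \<open>N j\<close> of pairs with
  one fixed order of \<open>i\<close> and \<open>k\<close> inside the blocks satisfies \<open>N j + N (j + 1) = P j\<close> for \<open>j \<ge> 1\<close>, where \<open>P j\<close> counts pairs in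
  either order (\<open>card_ascending_pairs_recurrence\<close>), and the generating function of \<open>P\<close> depends only on
  the multiset of heights in each block. With \<open>S = \<Sum>a<t. z\<^sup>-\<^sup>a\<close> the four large multisets have
  generating functions \<open>S\<^sup>2 - S\<close>, \<open>S - 1\<close>, \<open>z S\<^sup>2\<close> and \<open>(1 + z) S\<^sup>2 + r (1 + 1/z) (1 + z)\<close>. Solving the
  recurrence and extracting a coefficient gives the formula (\<open>meander_pair_count_difference\<close>).
\<close>

no_notation fls_nth (infixl "$$" 75)

section \<open>Deforming a functional along a line\<close>

text \<open>
  Square matrices are functions of two indices below \<open>d\<close>, as the same computation is needed over the
  complex numbers, over polynomials and over power series, and only entries are ever differentiated.
\<close>
definition sq_mult :: "nat \<Rightarrow> (nat \<Rightarrow> nat \<Rightarrow> 'a::comm_ring_1) \<Rightarrow> (nat \<Rightarrow> nat \<Rightarrow> 'a) \<Rightarrow> nat \<Rightarrow> nat \<Rightarrow> 'a" where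
  "sq_mult d X Y i k = (\<Sum>l<d. X i l * Y l k)"

definition row_mult :: "nat \<Rightarrow> (nat \<Rightarrow> 'a::comm_ring_1) \<Rightarrow> (nat \<Rightarrow> nat \<Rightarrow> 'a) \<Rightarrow> nat \<Rightarrow> 'a" where
  "row_mult d f X k = (\<Sum>l<d. f l * X l k)"

text \<open>
  The product of the matrices \<open>A - r\<close> over a list of scalars \<open>r\<close>: a polynomial in \<open>A\<close> given by its roots.
\<close>
fun shifted_prod :: "nat \<Rightarrow> (nat \<Rightarrow> nat \<Rightarrow> 'a::comm_ring_1) \<Rightarrow> 'a list \<Rightarrow> nat \<Rightarrow> nat \<Rightarrow> 'a" where
  "shifted_prod d A [] = (\<lambda>i k. if i = k then 1 else 0)"
| "shifted_prod d A (r # rs) = sq_mult d (\<lambda>i k. A i k - (if i = k then r else 0)) (shifted_prod d A rs)"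

text \<open>
  The matrix of \<open>ad u\<close> for the Lie algebra with structure constants \<open>c\<close>. The map \<open>ad\<close> acts on columns, so
  \<open>row_mult d f (ad_mat d c u)\<close> is the functional \<open>v \<mapsto> f([u, v])\<close>.
\<close>
definition ad_mat :: "nat \<Rightarrow> (nat \<Rightarrow> nat \<Rightarrow> nat \<Rightarrow> 'a::comm_ring_1) \<Rightarrow> (nat \<Rightarrow> 'a) \<Rightarrow> nat \<Rightarrow> nat \<Rightarrow> 'a" where
  "ad_mat d c u k b = (\<Sum>a<d. u a * c a b k)"

lemma sq_mult_assoc: "sq_mult d (sq_mult d X Y) Z i k = sq_mult d X (sq_mult d Y Z) i k"
proof -
  have "sq_mult d (sq_mult d X Y) Z i k = (\<Sum>l<d. \<Sum>m<d. X i m * Y m l * Z l k)"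
    by (simp add: sq_mult_def sum_distrib_right)
  also have "\<dots> = (\<Sum>m<d. \<Sum>l<d. X i m * Y m l * Z l k)"
    by (rule sum.swap)
  also have "\<dots> = sq_mult d X (sq_mult d Y Z) i k"
    by (simp add: sq_mult_def sum_distrib_left mult.assoc)
  finally show ?thesis .
qed

lemma row_mult_assoc: "row_mult d (row_mult d f X) Y k = row_mult d f (sq_mult d X Y) k"
  using sq_mult_assoc[of d "\<lambda>_. f" X Y 0 k] by (simp add: sq_mult_def row_mult_def)

lemma row_mult_cong: "(\<And>l. l < d \<Longrightarrow> f l = g l) \<Longrightarrow> (\<And>l. l < d \<Longrightarrow> X l k = Y l k) \<Longrightarrow>
    row_mult d f X k = row_mult d g Y k"
  by (simp add: row_mult_def)

lemma sq_mult_cong: "(\<And>l. l < d \<Longrightarrow> X i l = X' i l) \<Longrightarrow> (\<And>l. l < d \<Longrightarrow> Y l k = Y' l k) \<Longrightarrow>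
    sq_mult d X Y i k = sq_mult d X' Y' i k"
  by (simp add: sq_mult_def)

lemma sq_mult_diff_right:
  "sq_mult d X (\<lambda>i k. Y i k - Z i k) i k = sq_mult d X Y i k - sq_mult d X Z i k"
  by (simp add: sq_mult_def algebra_simps sum_subtractf)

lemma sq_mult_diff_left:
  "sq_mult d (\<lambda>i k. Y i k - Z i k) X i k = sq_mult d Y X i k - sq_mult d Z X i k"
  by (simp add: sq_mult_def algebra_simps sum_subtractf)

lemma sq_mult_scalar_left:
  "i < d \<Longrightarrow> sq_mult d (\<lambda>i k. if i = k then r else 0) X i k = r * X i k"
  by (simp add: sq_mult_def if_distrib[of "\<lambda>z. z * _"] cong: if_cong)

lemma sq_mult_scalar_right:
  "k < d \<Longrightarrow> sq_mult d X (\<lambda>i k. if i = k then r else 0) i k = X i k * r"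
  by (simp add: sq_mult_def if_distrib[of "\<lambda>z. _ * z"] cong: if_cong)

lemma sum_sq_mult_commute: "(\<Sum>i<d. sq_mult d X Y i i) = (\<Sum>i<d. sq_mult d Y X i i)"
  unfolding sq_mult_def by (subst sum.swap) (simp add: mult.commute)

lemma (in comm_ring_hom) hom_shifted_prod:
  "hom (shifted_prod d A rs i k) = shifted_prod d (\<lambda>i k. hom (A i k)) (map hom rs) i k"
proof (induction rs arbitrary: i k)
  case (Cons r rs)
  have "hom (shifted_prod d A (r # rs) i k) =
      (\<Sum>l<d. hom (A i l - (if i = l then r else 0)) * hom (shifted_prod d A rs l k))"
    by (simp add: sq_mult_def hom_sum hom_mult)
  also have "\<dots> = (\<Sum>l<d. (hom (A i l) - (if i = l then hom r else 0)) *
      shifted_prod d (\<lambda>i k. hom (A i k)) (map hom rs) l k)"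
    by (intro sum.cong refl) (simp add: Cons.IH hom_minus)
  finally show ?case by (simp add: sq_mult_def)
qed auto

lemma shifted_prod_scale:
  "shifted_prod d (\<lambda>i k. w * A i k) (map (\<lambda>r. w * r) rs) i k
     = w ^ length rs * shifted_prod d A rs i k"
proof (induction rs arbitrary: i k)
  case (Cons r rs)
  have "shifted_prod d (\<lambda>i k. w * A i k) (map (\<lambda>r. w * r) (r # rs)) i k =
      (\<Sum>l<d. (w * A i l - (if i = l then w * r else 0)) * (w ^ length rs * shifted_prod d A rs l k))"
    by (simp add: sq_mult_def Cons.IH)
  also have "\<dots> = (\<Sum>l<d. w ^ length (r # rs) *
      ((A i l - (if i = l then r else 0)) * shifted_prod d A rs l k))"
    by (intro sum.cong refl) (auto simp: algebra_simps)
  finally show ?case by (simp add: sq_mult_def sum_distrib_left)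
qed auto

text \<open>
  The adjugate solves linear systems over any commutative ring up to the determinant. It is applied
  over polynomials in the deformation parameter, where no division is possible.
\<close>
lemma cramer:
  fixes B :: "nat \<Rightarrow> nat \<Rightarrow> 'a::comm_ring_1"
  obtains adj where
    "\<And>i k. i < d \<Longrightarrow> k < d \<Longrightarrow> (\<Sum>l<d. adj i l * B l k) = (if i = k then det (mat d d (\<lambda>(i,k). B i k)) else 0)"
    "\<And>i k. i < d \<Longrightarrow> k < d \<Longrightarrow> (\<Sum>l<d. B i l * adj l k) = (if i = k then det (mat d d (\<lambda>(i,k). B i k)) else 0)"
proof -
  define M where "M = mat d d (\<lambda>(i,k). B i k)"
  have M: "M \<in> carrier_mat d d" by (simp add: M_def)
  note adj = adj_mat[OF M]
  have "(\<Sum>l<d. adj_mat M $$ (i, l) * B l k) = (if i = k then det M else 0)"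
    if "i < d" "k < d" for i k
  proof -
    have "(adj_mat M * M) $$ (i, k) = (\<Sum>l<d. adj_mat M $$ (i, l) * B l k)"
      using that adj(1) by (simp add: times_mat_def scalar_prod_def M_def atLeast0LessThan)
    then show ?thesis using adj(3) that by (cases "i = k") simp_all
  qed
  moreover have "(\<Sum>l<d. B i l * adj_mat M $$ (l, k)) = (if i = k then det M else 0)"
    if "i < d" "k < d" for i k
  proof -
    have "(M * adj_mat M) $$ (i, k) = (\<Sum>l<d. B i l * adj_mat M $$ (l, k))"
      using that adj(1) by (simp add: times_mat_def scalar_prod_def M_def atLeast0LessThan)
    then show ?thesis using adj(2) that by (cases "i = k") simp_all
  qed
  ultimately show ?thesis using that[of "\<lambda>i k. adj_mat M $$ (i,k)"] unfolding M_def by simp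
qed

lemma det_nonzero_if_rows_independent:
  fixes B :: "nat \<Rightarrow> nat \<Rightarrow> 'a::field"
  assumes "\<forall>v. (\<forall>k<d. (\<Sum>l<d. v l * B l k) = 0) \<longrightarrow> (\<forall>l<d. v l = 0)"
  shows "det (mat d d (\<lambda>(i,k). B i k)) \<noteq> 0"
proof
  define M where "M = mat d d (\<lambda>(i,k). B k i)"
  have M: "M \<in> carrier_mat d d" by (simp add: M_def)
  have tr: "transpose_mat M = mat d d (\<lambda>(i,k). B i k)" by (auto simp: M_def)
  assume "det (mat d d (\<lambda>(i,k). B i k)) = 0"
  then have "det M = 0" using det_transpose[OF M] tr by simp
  then obtain v where v: "v \<in> carrier_vec d" "v \<noteq> 0\<^sub>v d" "M *\<^sub>v v = 0\<^sub>v d"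
    using det_0_iff_vec_prod_zero[OF M] by auto
  have "(\<Sum>l<d. v $ l * B l k) = 0" if "k < d" for k
  proof -
    have "(M *\<^sub>v v) $ k = (\<Sum>l<d. v $ l * B l k)"
      using that v(1) by (simp add: M_def scalar_prod_def atLeast0LessThan mult.commute)
    then show ?thesis using v(3) that by simp
  qed
  then have "v $ l = 0" if "l < d" for l using assms[rule_format, of "\<lambda>l. v $ l" l] that by blast
  then show False using v(1,2) by auto
qed

lemma (in comm_ring_hom) hom_ad_mat:
  "hom (ad_mat d c u k b) = ad_mat d (\<lambda>a b k. hom (c a b k)) (\<lambda>a. hom (u a)) k b"
  by (simp add: ad_mat_def hom_sum hom_mult)

lemma ad_mat_scale: "ad_mat d c (\<lambda>a. w * u a) k b = w * ad_mat d c u k b"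
  by (simp add: ad_mat_def sum_distrib_left mult.assoc)

text \<open>
  The Jacobi identity, in the form that \<open>ad e\<^sub>a\<close> is a derivation of the bracket.
\<close>
definition leibniz_constants :: "nat \<Rightarrow> (nat \<Rightarrow> nat \<Rightarrow> nat \<Rightarrow> 'a::comm_ring_1) \<Rightarrow> bool" where
  "leibniz_constants d c \<longleftrightarrow> (\<forall>a<d. \<forall>b<d. \<forall>e<d. \<forall>k<d.
     (\<Sum>l<d. c b e l * c a l k) = (\<Sum>l<d. c a b l * c l e k) + (\<Sum>l<d. c a e l * c b l k))"

lemma ad_mat_bracket:
  assumes "leibniz_constants d c" "k < d" "e < d"
  shows "ad_mat d c (\<lambda>a. \<Sum>b<d. ad_mat d c u a b * v b) k e =
    sq_mult d (ad_mat d c u) (ad_mat d c v) k e - sq_mult d (ad_mat d c v) (ad_mat d c u) k e"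
proof -
  have rot: "(\<Sum>b<d. \<Sum>a<d. \<Sum>l<d. f a b l) = (\<Sum>l<d. \<Sum>b<d. \<Sum>a<d. f a b l)"
    for f :: "nat \<Rightarrow> nat \<Rightarrow> nat \<Rightarrow> 'a"
    by (rule trans[OF sum.cong[OF refl sum.swap] sum.swap])
  have leib: "(\<Sum>l<d. c a b l * c l e k) = (\<Sum>l<d. c b e l * c a l k) - (\<Sum>l<d. c a e l * c b l k)"
    if "a < d" "b < d" for a b
  proof -
    have "(\<Sum>l<d. c b e l * c a l k) = (\<Sum>l<d. c a b l * c l e k) + (\<Sum>l<d. c a e l * c b l k)"
      using assms that unfolding leibniz_constants_def by blast
    then show ?thesis by (rule eq_diff_eq[THEN iffD2, OF sym])
  qed
  have "ad_mat d c (\<lambda>a. \<Sum>b<d. ad_mat d c u a b * v b) k e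
      = (\<Sum>l<d. \<Sum>b<d. \<Sum>a<d. u a * v b * (c a b l * c l e k))"
    unfolding ad_mat_def sum_distrib_right by (intro sum.cong refl) (simp add: mult_ac)
  also have "\<dots> = (\<Sum>b<d. \<Sum>a<d. \<Sum>l<d. u a * v b * (c a b l * c l e k))"
    by (rule rot[symmetric])
  also have "\<dots> = (\<Sum>b<d. \<Sum>a<d. u a * v b * (\<Sum>l<d. c a b l * c l e k))"
    by (simp add: sum_distrib_left)
  also have "\<dots> = (\<Sum>b<d. \<Sum>a<d. u a * v b * ((\<Sum>l<d. c b e l * c a l k) - (\<Sum>l<d. c a e l * c b l k)))"
    by (intro sum.cong refl) (simp only: leib lessThan_iff)
  also have "\<dots> = (\<Sum>b<d. \<Sum>a<d. \<Sum>l<d. u a * v b * (c b e l * c a l k))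
     - (\<Sum>b<d. \<Sum>a<d. \<Sum>l<d. u a * v b * (c a e l * c b l k))"
    by (simp only: sum_distrib_left sum_subtractf right_diff_distrib)
  also have "(\<Sum>b<d. \<Sum>a<d. \<Sum>l<d. u a * v b * (c b e l * c a l k)) =
      sq_mult d (ad_mat d c u) (ad_mat d c v) k e"
    unfolding sq_mult_def ad_mat_def sum_product
    by (rule trans[OF rot sum.cong[OF refl trans[OF sum.swap]]])
      (auto intro!: sum.cong simp: mult_ac)
  also have "(\<Sum>b<d. \<Sum>a<d. \<Sum>l<d. u a * v b * (c a e l * c b l k)) =
      sq_mult d (ad_mat d c v) (ad_mat d c u) k e"
    unfolding sq_mult_def ad_mat_def sum_product
    by (rule trans[OF rot sum.cong[OF refl]]) (auto intro!: sum.cong simp: mult_ac)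
  finally show ?thesis .
qed

lemma sum_delta_idem_ring: "k < (d::nat) \<Longrightarrow> (\<Sum>l<d. v l * (if l = k then w else 0)) = v k * (w::'a::comm_ring_1)"
proof -
  assume "k < d"
  moreover have "(\<Sum>l<d. v l * (if l = k then w else 0)) = (\<Sum>l<d. if l = k then v l * w else 0)"
    by (rule sum.cong) auto
  ultimately show ?thesis by (simp add: sum.delta)
qed

text \<open>
  The infinitesimal form of conjugacy. Differentiating \<open>F([H, x]) = F(x)\<close> gives
  \<open>F'([H, x]) + F([H', x]) = F'(x)\<close>. Substituting \<open>F' = F \<circ> ad \<eta>\<close> and using the Jacobi identity turns this into
  \<open>F([H' - [H, \<eta>], x]) = 0\<close>, and nondegeneracy yields \<open>H' = [H, \<eta>]\<close>. The local abbreviation \<open>br\<close> is \<open>[H, \<eta>]\<close>.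
\<close>
lemma fps_ad_deriv:
  fixes c :: "nat \<Rightarrow> nat \<Rightarrow> nat \<Rightarrow> complex" and F H \<eta> :: "nat \<Rightarrow> complex fps"
  defines "C \<equiv> \<lambda>a b k. fps_const (c a b k)"
  assumes leib: "leibniz_constants d C"
    and princ: "\<And>b. b < d \<Longrightarrow> row_mult d F (ad_mat d C H) b = F b"
    and eta: "\<And>b. b < d \<Longrightarrow> row_mult d F (ad_mat d C \<eta>) b = fps_deriv (F b)"
    and nondeg: "\<And>v. (\<And>b. b < d \<Longrightarrow> row_mult d F (ad_mat d C v) b = 0) \<Longrightarrow> (\<And>a. a < d \<Longrightarrow> v a = 0)"
    and k: "k < d" and e: "e < d"
  shows "fps_deriv (ad_mat d C H k e) =
    sq_mult d (ad_mat d C H) (ad_mat d C \<eta>) k e - sq_mult d (ad_mat d C \<eta>) (ad_mat d C H) k e"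
proof -
  let ?A = "ad_mat d C H" and ?E = "ad_mat d C \<eta>"
  define br where "br a = (\<Sum>b<d. ?A a b * \<eta> b)" for a
  have ad_deriv: "ad_mat d C (\<lambda>a. fps_deriv (H a)) k e = fps_deriv (?A k e)" for k e
    by (simp add: ad_mat_def fps_deriv_sum C_def)
  have ad_br: "ad_mat d C br k e = sq_mult d ?A ?E k e - sq_mult d ?E ?A k e" if "k < d" "e < d" for k e
    using ad_mat_bracket[OF leib that, of H \<eta>] unfolding br_def by simp
  have ad_diff: "ad_mat d C (\<lambda>a. fps_deriv (H a) - br a) k e = fps_deriv (?A k e) - ad_mat d C br k e" for k e
    unfolding ad_deriv[symmetric] by (simp add: ad_mat_def left_diff_distrib sum_subtractf)
  have "fps_deriv (H a) - br a = 0" if "a < d" for a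
  proof (rule nondeg[OF _ that])
    fix b assume b: "b < d"
    have "fps_deriv (row_mult d F ?A b) =
        (\<Sum>l<d. fps_deriv (F l) * ?A l b) + (\<Sum>l<d. F l * fps_deriv (?A l b))"
      by (simp add: row_mult_def fps_deriv_sum sum.distrib)
    also have "(\<Sum>l<d. fps_deriv (F l) * ?A l b) = row_mult d (row_mult d F ?E) ?A b"
      by (simp add: row_mult_def[of d "row_mult d F ?E"] eta)
    finally have 1: "fps_deriv (F b) = row_mult d F (sq_mult d ?E ?A) b + (\<Sum>l<d. F l * fps_deriv (?A l b))"
      using princ[OF b] by (simp add: row_mult_assoc)
    have "row_mult d F (sq_mult d ?A ?E) b = row_mult d (row_mult d F ?A) ?E b"
      by (simp add: row_mult_assoc)
    also have "\<dots> = row_mult d F ?E b" by (rule row_mult_cong) (simp_all add: princ)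
    also have "\<dots> = fps_deriv (F b)" by (rule eta[OF b])
    finally have 2: "row_mult d F (sq_mult d ?A ?E) b = fps_deriv (F b)" .
    have "row_mult d F (ad_mat d C (\<lambda>a. fps_deriv (H a) - br a)) b
        = (\<Sum>l<d. F l * fps_deriv (?A l b)) - row_mult d F (\<lambda>k e. sq_mult d ?A ?E k e - sq_mult d ?E ?A k e) b"
      using b by (simp add: row_mult_def ad_diff ad_br right_diff_distrib sum_subtractf)
    also have "row_mult d F (\<lambda>k e. sq_mult d ?A ?E k e - sq_mult d ?E ?A k e) b
        = row_mult d F (sq_mult d ?A ?E) b - row_mult d F (sq_mult d ?E ?A) b"
      by (simp add: row_mult_def right_diff_distrib sum_subtractf)
    finally show "row_mult d F (ad_mat d C (\<lambda>a. fps_deriv (H a) - br a)) b = 0"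
      using 1 2 by simp
  qed
  then have "ad_mat d C (\<lambda>a. fps_deriv (H a) - br a) k e = 0"
    by (simp add: ad_mat_def)
  then show ?thesis using ad_diff[of k e] ad_br[OF k e] by simp
qed

text \<open>
  Both the derivative and the commutator with \<open>E\<close> obey the product rule and kill scalars, so an
  equation \<open>A' = [A, E]\<close> passes to every polynomial in \<open>A\<close>.
\<close>
lemma shifted_prod_deriv:
  fixes A E :: "nat \<Rightarrow> nat \<Rightarrow> complex fps"
  assumes deriv: "\<And>k e. k < d \<Longrightarrow> e < d \<Longrightarrow> fps_deriv (A k e) = sq_mult d A E k e - sq_mult d E A k e"
    and "i < d" "k < d"
  shows "fps_deriv (shifted_prod d A (map fps_const rs) i k) =
      sq_mult d (shifted_prod d A (map fps_const rs)) E i k - sq_mult d E (shifted_prod d A (map fps_const rs)) i k"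
  using assms(2,3)
proof (induction rs arbitrary: i k)
  case Nil
  then show ?case by (simp add: sq_mult_scalar_left sq_mult_scalar_right)
next
  case (Cons r rs)
  let ?P = "shifted_prod d A (map fps_const rs)"
  let ?B = "\<lambda>i k. A i k - (if i = k then fps_const r else 0)"
  have dB: "fps_deriv (?B i k) = sq_mult d ?B E i k - sq_mult d E ?B i k" if "i < d" "k < d" for i k
    using that deriv[OF that]
    by (simp add: sq_mult_diff_left sq_mult_diff_right sq_mult_scalar_left sq_mult_scalar_right)
  have "fps_deriv (sq_mult d ?B ?P i k) =
      (\<Sum>l<d. fps_deriv (?B i l) * ?P l k) + (\<Sum>l<d. ?B i l * fps_deriv (?P l k))"
    by (simp add: sq_mult_def fps_deriv_sum sum.distrib del: fps_deriv_sub)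
  also have "(\<Sum>l<d. fps_deriv (?B i l) * ?P l k) =
      sq_mult d (\<lambda>i k. sq_mult d ?B E i k - sq_mult d E ?B i k) ?P i k"
    unfolding sq_mult_def[of d _ ?P] using Cons.prems by (intro sum.cong refl) (simp only: dB lessThan_iff)
  also have "\<dots> = sq_mult d ?B (sq_mult d E ?P) i k - sq_mult d E (sq_mult d ?B ?P) i k"
    by (simp only: sq_mult_diff_left[of d "sq_mult d _ _" "sq_mult d _ _"] sq_mult_assoc)
  also have "(\<Sum>l<d. ?B i l * fps_deriv (?P l k)) =
      sq_mult d ?B (\<lambda>i k. sq_mult d ?P E i k - sq_mult d E ?P i k) i k"
    unfolding sq_mult_def[of d ?B] using Cons.prems by (intro sum.cong refl) (simp only: Cons.IH lessThan_iff)
  also have "\<dots> = sq_mult d (sq_mult d ?B ?P) E i k - sq_mult d ?B (sq_mult d E ?P) i k"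
    by (simp only: sq_mult_diff_right[of d _ "sq_mult d _ _" "sq_mult d _ _"] sq_mult_assoc)
  finally show ?case by simp
qed

text \<open>
  In \<open>X' = [X, E]\<close> the coefficient of index \<open>m + 1\<close> on the left is determined by the coefficients of \<open>X\<close> up to
  index \<open>m\<close>, so a solution that starts at zero is zero.
\<close>
lemma fps_commutator_ode_unique:
  fixes X E :: "nat \<Rightarrow> nat \<Rightarrow> complex fps"
  assumes deriv: "\<And>i k. i < d \<Longrightarrow> k < d \<Longrightarrow> fps_deriv (X i k) = sq_mult d X E i k - sq_mult d E X i k"
    and init: "\<And>i k. i < d \<Longrightarrow> k < d \<Longrightarrow> fps_nth (X i k) 0 = 0"
    and "i < d" "k < d"
  shows "X i k = 0"
proof -
  have "\<forall>i<d. \<forall>k<d. fps_nth (X i k) m = 0" for m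
  proof (induction m rule: less_induct)
    case (less m)
    show ?case
    proof (cases m)
      case (Suc m')
      show ?thesis
      proof (intro allI impI)
        fix i k assume ik: "i < d" "k < d"
        have "fps_nth (fps_deriv (X i k)) m' = 0"
          unfolding deriv[OF ik] sq_mult_def fps_sub_nth fps_sum_nth fps_mult_nth
          using less.IH ik by (simp add: Suc)
        then show "fps_nth (X i k) m = 0" by (simp add: Suc del: of_nat_Suc)
      qed
    qed (use init in simp)
  qed
  then show ?thesis using assms(3,4) by (auto intro: fps_ext)
qed

lemma fps_trace_const:
  fixes X E :: "nat \<Rightarrow> nat \<Rightarrow> complex fps"
  assumes deriv: "\<And>i k. i < d \<Longrightarrow> k < d \<Longrightarrow> fps_deriv (X i k) = sq_mult d X E i k - sq_mult d E X i k"
  shows "(\<Sum>i<d. X i i) = fps_const (fps_nth (\<Sum>i<d. X i i) 0)"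
proof -
  have "fps_deriv (\<Sum>i<d. X i i) = 0"
    by (simp add: fps_deriv_sum deriv sum_subtractf sum_sq_mult_commute[of d X E])
  then show ?thesis by (simp only: fps_deriv_eq_0_iff)
qed

text \<open>
  The functional with coordinate row \<open>f\<close> is Frobenius, respectively has principal element \<open>H\<close>, in
  coordinates.
\<close>
definition nondegenerate_row :: "nat \<Rightarrow> (nat \<Rightarrow> nat \<Rightarrow> nat \<Rightarrow> complex) \<Rightarrow> (nat \<Rightarrow> complex) \<Rightarrow> bool" where
  "nondegenerate_row d c f \<longleftrightarrow>
     (\<forall>v. (\<forall>b<d. row_mult d f (ad_mat d c v) b = 0) \<longrightarrow> (\<forall>a<d. v a = 0))"

definition principal_coords :: "nat \<Rightarrow> (nat \<Rightarrow> nat \<Rightarrow> nat \<Rightarrow> complex) \<Rightarrow> (nat \<Rightarrow> complex) \<Rightarrow> (nat \<Rightarrow> complex) \<Rightarrow> bool" where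
  "principal_coords d c f H \<longleftrightarrow> (\<forall>b<d. row_mult d f (ad_mat d c H) b = f b)"

lemma row_mult_ad_mat:
  "row_mult d f (ad_mat d c v) b = (\<Sum>a<d. v a * (\<Sum>k<d. f k * c a b k))"
proof -
  have "(\<Sum>a<d. v a * (\<Sum>k<d. f k * c a b k)) = (\<Sum>a<d. \<Sum>k<d. f k * (v a * c a b k))"
    unfolding sum_distrib_left by (intro sum.cong refl) (rule mult.left_commute)
  also have "\<dots> = row_mult d f (ad_mat d c v) b"
    unfolding row_mult_def ad_mat_def sum_distrib_left by (rule sum.swap)
  finally show ?thesis by (rule sym)
qed

lemma principal_coords_exists:
  assumes "nondegenerate_row d c f"
  obtains H where "principal_coords d c f H"
proof -
  define B where "B a b = (\<Sum>k<d. f k * c a b k)" for a b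
  define D where "D = det (mat d d (\<lambda>(i,k). B i k))"
  obtain adj where adj: "\<And>i k. i < d \<Longrightarrow> k < d \<Longrightarrow> (\<Sum>l<d. adj i l * B l k) = (if i = k then D else 0)"
    unfolding D_def using cramer[of d B] by metis
  have D: "D \<noteq> 0"
    using assms unfolding D_def nondegenerate_row_def row_mult_ad_mat B_def
    by (rule det_nonzero_if_rows_independent)
  have "(\<Sum>a<d. ((\<Sum>b<d. f b * adj b a) / D) * B a k) = f k" if "k < d" for k
  proof -
    have "(\<Sum>a<d. ((\<Sum>b<d. f b * adj b a) / D) * B a k) = (\<Sum>a<d. \<Sum>b<d. f b / D * (adj b a * B a k))"
      by (simp add: sum_distrib_right sum_divide_distrib mult.assoc)
    also have "\<dots> = (\<Sum>b<d. f b / D * (\<Sum>a<d. adj b a * B a k))"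
      by (subst sum.swap) (simp add: sum_distrib_left)
    also have "\<dots> = (\<Sum>b<d. f b / D * (if b = k then D else 0))" using that adj by simp
    also have "\<dots> = f k" using that D
      by (subst sum_delta_idem_ring) simp_all
    finally show ?thesis .
  qed
  then have "principal_coords d c f (\<lambda>a. (\<Sum>b<d. f b * adj b a) / D)"
    by (simp add: principal_coords_def row_mult_ad_mat B_def)
  then show ?thesis by (rule that)
qed

lemma principal_coords_unique:
  assumes "nondegenerate_row d c f" "principal_coords d c f H" "principal_coords d c f K" "a < d"
  shows "H a = K a"
proof -
  have "row_mult d f (ad_mat d c (\<lambda>a. H a - K a)) b = 0" if "b < d" for b
    using assms(2,3) that by (simp add: principal_coords_def row_mult_ad_mat left_diff_distrib sum_subtractf)
  then have "H a - K a = 0"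
    using assms(1)[unfolded nondegenerate_row_def, rule_format, of "\<lambda>a. H a - K a" a] assms(4) by blast
  then show ?thesis by simp
qed

lemma fps_of_poly_hom: "comm_ring_hom (fps_of_poly :: complex poly \<Rightarrow> complex fps)"
  by unfold_locales (simp_all add: fps_of_poly_add fps_of_poly_mult)

lemma poly_eval_hom: "comm_ring_hom (\<lambda>p. poly p (z::complex))"
  by unfold_locales simp_all

lemma fps_nth_0_hom: "comm_ring_hom (\<lambda>p. fps_nth p 0 :: complex)"
  by unfold_locales simp_all

lemma fps_const_hom: "comm_ring_hom (fps_const :: complex \<Rightarrow> complex fps)"
  by unfold_locales (simp_all flip: fps_const_add fps_const_mult)

lemma poly_const_hom: "comm_ring_hom (\<lambda>a::complex. [:a:])"
  by unfold_locales simp_all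

lemma leibniz_constants_hom:
  assumes "comm_ring_hom h" "leibniz_constants d c"
  shows "leibniz_constants d (\<lambda>a b k. h (c a b k))"
proof -
  interpret comm_ring_hom h by fact
  show ?thesis
    unfolding leibniz_constants_def
  proof (intro allI impI)
    fix a b e k assume "a < d" "b < d" "e < d" "k < d"
    then have "h (\<Sum>l<d. c b e l * c a l k) = h ((\<Sum>l<d. c a b l * c l e k) + (\<Sum>l<d. c a e l * c b l k))"
      using assms(2) unfolding leibniz_constants_def by (intro arg_cong[of _ _ h]) blast
    then show "(\<Sum>l<d. h (c b e l) * h (c a l k)) =
        (\<Sum>l<d. h (c a b l) * h (c l e k)) + (\<Sum>l<d. h (c a e l) * h (c b l k))"
      by (simp add: hom_sum hom_mult hom_add)
  qed
qed

text \<open>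
  The line from \<open>f0\<close> to \<open>f1\<close> is treated over the polynomial ring, where Cramer's rule gives the
  principal element as \<open>Hp / D\<close> with the determinant \<open>D\<close> of the Kirillov form as common denominator. As
  \<open>D\<close> does not vanish at \<open>0\<close>, the quotient makes sense as a power series and the differential equation
  applies. The resulting identities are identities of polynomials after multiplication by a power of \<open>D\<close>,
  so they can be evaluated at \<open>1\<close>, where \<open>D\<close> does not vanish either.
\<close>
theorem principal_spectrum_invariance:
  fixes c :: "nat \<Rightarrow> nat \<Rightarrow> nat \<Rightarrow> complex"
  assumes leib: "leibniz_constants d c"
    and nd0: "nondegenerate_row d c f0" and nd1: "nondegenerate_row d c f1"
    and pr0: "principal_coords d c f0 H0" and pr1: "principal_coords d c f1 H1"
  shows "(\<And>i k. i < d \<Longrightarrow> k < d \<Longrightarrow> shifted_prod d (ad_mat d c H0) rs i k = 0) \<Longrightarrow>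
       i < d \<Longrightarrow> k < d \<Longrightarrow> shifted_prod d (ad_mat d c H1) rs i k = 0"
    and "(\<Sum>i<d. shifted_prod d (ad_mat d c H1) rs i i) = (\<Sum>i<d. shifted_prod d (ad_mat d c H0) rs i i)"
proof -
  interpret P: comm_ring_hom "fps_of_poly :: complex poly \<Rightarrow> complex fps" by (rule fps_of_poly_hom)
  interpret E0: comm_ring_hom "\<lambda>p. fps_nth p 0 :: complex" by (rule fps_nth_0_hom)
  interpret K: comm_ring_hom "\<lambda>a::complex. [:a:]" by (rule poly_const_hom)
  define Cp where "Cp a b k = [:c a b k:]" for a b k
  define C where "C a b k = fps_const (c a b k)" for a b k
  define Fp where "Fp k = [:f0 k, f1 k - f0 k:]" for k
  define B where "B a b = (\<Sum>k<d. Fp k * Cp a b k)" for a b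
  define D where "D = det (mat d d (\<lambda>(i,k). B i k))"
  obtain adj where
    adj1: "\<And>i k. i < d \<Longrightarrow> k < d \<Longrightarrow> (\<Sum>l<d. adj i l * B l k) = (if i = k then D else 0)" and
    adj2: "\<And>i k. i < d \<Longrightarrow> k < d \<Longrightarrow> (\<Sum>l<d. B i l * adj l k) = (if i = k then D else 0)"
    by (rule cramer[of d B, folded D_def]) (rule that)
  define solve where "solve g a = (\<Sum>b<d. g b * adj b a)" for g :: "nat \<Rightarrow> complex poly" and a
  have solve: "row_mult d Fp (ad_mat d Cp (solve g)) k = g k * D" if "k < d" for g k
  proof -
    have "row_mult d Fp (ad_mat d Cp (solve g)) k = (\<Sum>a<d. solve g a * B a k)"
      by (simp add: row_mult_ad_mat B_def)
    also have "\<dots> = (\<Sum>a<d. \<Sum>b<d. g b * (adj b a * B a k))"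
      by (simp add: solve_def sum_distrib_right mult.assoc)
    also have "\<dots> = (\<Sum>b<d. g b * (\<Sum>a<d. adj b a * B a k))"
      by (subst sum.swap) (simp add: sum_distrib_left)
    also have "\<dots> = (\<Sum>b<d. g b * (if b = k then D else 0))" using that adj1 by simp
    also have "\<dots> = g k * D" using that by (simp add: sum_delta_idem_ring)
    finally show ?thesis .
  qed
  have Dz: "poly D z \<noteq> 0" if "nondegenerate_row d c (\<lambda>k. poly (Fp k) z)" for z
  proof -
    interpret comm_ring_hom "\<lambda>p. poly p z" by (rule poly_eval_hom)
    have "poly D z = det (mat d d (\<lambda>(i,k). poly (B i k) z))"
      unfolding D_def hom_det[symmetric] by (intro arg_cong[of _ _ det]) (auto simp: mat_eq_iff)
    moreover have "poly (B i k) z = (\<Sum>l<d. poly (Fp l) z * c i k l)" for i k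
      by (simp add: B_def Cp_def poly_sum mult.commute)
    moreover have "det (mat d d (\<lambda>(i,k). \<Sum>l<d. poly (Fp l) z * c i k l)) \<noteq> 0"
      using that unfolding nondegenerate_row_def row_mult_ad_mat
      by (rule det_nonzero_if_rows_independent)
    ultimately show ?thesis by simp
  qed
  have F_eval: "poly (Fp k) 0 = f0 k" "poly (Fp k) 1 = f1 k" for k by (simp_all add: Fp_def)
  have D0: "poly D 0 \<noteq> 0" and D1: "poly D 1 \<noteq> 0" using nd0 nd1 by (intro Dz; simp add: F_eval)+

  define Hp where "Hp = solve Fp"
  define Ap where "Ap = ad_mat d Cp Hp"
  define Xp where "Xp rs = shifted_prod d Ap (map (\<lambda>r. D * [:r:]) rs)" for rs

  have eval: "poly (Xp rs i k) z = poly D z ^ length rs * shifted_prod d (ad_mat d c H) rs i k"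
    if "i < d" and nd: "nondegenerate_row d c f" and pr: "principal_coords d c f H"
      and f: "\<And>k. poly (Fp k) z = f k" for z f H rs i k
  proof -
    interpret E: comm_ring_hom "\<lambda>p. poly p z" by (rule poly_eval_hom)
    have "poly D z \<noteq> 0" using nd by (intro Dz) (simp add: f)
    have "row_mult d f (ad_mat d c (\<lambda>a. poly (Hp a) z / poly D z)) b = f b" if "b < d" for b
    proof -
      have "row_mult d f (ad_mat d c (\<lambda>a. poly (Hp a) z / poly D z)) b =
          poly (row_mult d Fp (ad_mat d Cp Hp) b) z / poly D z"
        by (simp add: row_mult_ad_mat poly_sum Cp_def f sum_divide_distrib mult.commute[of "c _ _ _"])
      also have "\<dots> = f b"
        using that \<open>poly D z \<noteq> 0\<close> by (simp add: Hp_def solve f)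
      finally show ?thesis .
    qed
    then have "principal_coords d c f (\<lambda>a. poly (Hp a) z / poly D z)"
      by (simp add: principal_coords_def)
    then have "poly (Hp a) z / poly D z = H a" if "a < d" for a
      by (rule principal_coords_unique[OF nd _ pr that])
    then have H: "poly (Hp a) z = poly D z * H a" if "a < d" for a
      using that \<open>poly D z \<noteq> 0\<close> by (simp add: divide_eq_eq mult.commute)
    have A: "poly (Ap i k) z = poly D z * ad_mat d c H i k" for i k
      unfolding Ap_def
      by (simp add: ad_mat_def poly_sum Cp_def H sum_distrib_left mult.assoc mult.commute[of "c _ _ _"])
    show ?thesis
      unfolding Xp_def E.hom_shifted_prod
      by (simp add: A o_def mult.commute[of _ "poly D z"] shifted_prod_scale)
  qed

  define Di where "Di = inverse (fps_of_poly D)"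
  have D0': "fps_nth (fps_of_poly D) 0 \<noteq> 0" using D0 by (simp add: poly_0_coeff_0)
  have Di: "fps_of_poly D * Di = 1"
    unfolding Di_def by (subst mult.commute) (rule inverse_mult_eq_1[OF D0'])
  define F where "F k = fps_of_poly (Fp k)" for k
  define H where "H a = Di * fps_of_poly (Hp a)" for a
  define \<eta> where "\<eta> a = Di * fps_of_poly (solve (\<lambda>b. pderiv (Fp b)) a)" for a
  define A where "A = ad_mat d C H"
  have C: "C a b k = fps_of_poly (Cp a b k)" for a b k by (simp add: C_def Cp_def fps_of_poly_const)
  have row: "row_mult d F (ad_mat d C (\<lambda>a. Di * fps_of_poly (v a))) b =
      Di * fps_of_poly (row_mult d Fp (ad_mat d Cp v) b)" for v b
    by (simp add: row_mult_ad_mat F_def C fps_of_poly_sum fps_of_poly_mult sum_distrib_left mult.assoc)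
  have princ: "row_mult d F A b = F b" if "b < d" for b
    using that Di unfolding A_def H_def
    by (simp add: row Hp_def solve fps_of_poly_mult F_def mult.left_commute)
       (simp add: mult.commute mult.left_commute)
  have eta: "row_mult d F (ad_mat d C \<eta>) b = fps_deriv (F b)" if "b < d" for b
    using that Di unfolding \<eta>_def
    by (simp add: row solve fps_of_poly_mult F_def fps_of_poly_pderiv mult.left_commute)
       (simp add: mult.commute mult.left_commute)
  have leib': "leibniz_constants d C"
    unfolding C_def by (rule leibniz_constants_hom[OF fps_const_hom leib])
  have nondeg: "v a = 0" if v: "\<And>b. b < d \<Longrightarrow> row_mult d F (ad_mat d C v) b = 0" and a: "a < d" for v a
  proof -
    have v': "(\<Sum>l<d. v l * fps_of_poly (B l b)) = 0" if "b < d" for b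
      using v[OF that] by (simp add: row_mult_ad_mat B_def F_def C fps_of_poly_sum fps_of_poly_mult)
    have "v a * fps_of_poly D = (\<Sum>l<d. v l * (if l = a then fps_of_poly D else 0))"
      using a by (simp add: sum_delta_idem_ring)
    also have "\<dots> = (\<Sum>l<d. v l * fps_of_poly (\<Sum>b<d. B l b * adj b a))"
      using a by (intro sum.cong refl) (auto simp: adj2)
    also have "\<dots> = (\<Sum>l<d. \<Sum>b<d. v l * fps_of_poly (B l b) * fps_of_poly (adj b a))"
      by (simp add: fps_of_poly_sum fps_of_poly_mult sum_distrib_left mult.assoc)
    also have "\<dots> = (\<Sum>b<d. (\<Sum>l<d. v l * fps_of_poly (B l b)) * fps_of_poly (adj b a))"
      by (subst sum.swap) (simp add: sum_distrib_right)
    also have "\<dots> = 0" using v' by simp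
    finally have "v a * fps_of_poly D * Di = 0" by simp
    then show ?thesis using Di by (simp add: mult.assoc)
  qed
  have A': "fps_deriv (A k e) = sq_mult d A (ad_mat d C \<eta>) k e - sq_mult d (ad_mat d C \<eta>) A k e"
    if "k < d" "e < d" for k e
  proof -
    have Ceq: "(\<lambda>a b k. fps_const (c a b k)) = C" by (simp add: C_def fun_eq_iff)
    show ?thesis
      unfolding A_def
    proof (rule fps_ad_deriv[of d c F H \<eta>, unfolded Ceq, OF leib' princ[unfolded A_def] eta _ that])
      show "v a = 0" if "\<And>b. b < d \<Longrightarrow> row_mult d F (ad_mat d C v) b = 0" "a < d" for v a
        using that by (rule nondeg)
    qed
  qed

  define X where "X rs = shifted_prod d A (map fps_const rs)" for rs
  have X': "fps_deriv (X rs i k) = sq_mult d (X rs) (ad_mat d C \<eta>) i k - sq_mult d (ad_mat d C \<eta>) (X rs) i k"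
    if "i < d" "k < d" for i k rs
    unfolding X_def by (rule shifted_prod_deriv[OF A']) (use that in auto)
  have ApA: "fps_of_poly (Ap i k) = fps_of_poly D * A i k" for i k
  proof -
    have "fps_of_poly D * A i k = fps_of_poly D * Di * fps_of_poly (Ap i k)"
      unfolding A_def H_def ad_mat_scale Ap_def P.hom_ad_mat C[symmetric] by (simp add: mult.assoc)
    then show ?thesis using Di by simp
  qed
  have XpX: "fps_of_poly (Xp rs i k) = fps_of_poly D ^ length rs * X rs i k" for rs i k
  proof -
    have "map fps_of_poly (map (\<lambda>r. D * [:r:]) rs) = map (\<lambda>r. fps_of_poly D * r) (map fps_const rs)"
      by (simp add: fps_of_poly_smult mult.commute)
    then show ?thesis
      unfolding Xp_def P.hom_shifted_prod X_def by (simp only: ApA shifted_prod_scale length_map)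
  qed
  have X0: "fps_nth (X rs i k) 0 = shifted_prod d (ad_mat d c H0) rs i k" if "i < d" for rs i k
  proof -
    have "fps_nth (fps_of_poly D) 0 ^ length rs * fps_nth (X rs i k) 0 = poly (Xp rs i k) 0"
      using arg_cong[OF XpX, of "\<lambda>p. fps_nth p 0" rs i k]
      by (simp add: poly_0_coeff_0 fps_power_zeroth)
    also have "\<dots> = poly D 0 ^ length rs * shifted_prod d (ad_mat d c H0) rs i k"
      by (rule eval[OF that nd0 pr0]) (simp add: F_eval)
    finally show ?thesis using D0 by (simp add: poly_0_coeff_0)
  qed
  have X1: "poly (Xp rs i k) 1 = poly D 1 ^ length rs * shifted_prod d (ad_mat d c H1) rs i k" if "i < d" for rs i k
    by (rule eval[OF that nd1 pr1]) (simp add: F_eval)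

  show "shifted_prod d (ad_mat d c H1) rs i k = 0"
    if "\<And>i k. i < d \<Longrightarrow> k < d \<Longrightarrow> shifted_prod d (ad_mat d c H0) rs i k = 0" "i < d" "k < d"
  proof -
    have "X rs i k = 0"
      by (rule fps_commutator_ode_unique[OF X']) (use that in \<open>auto simp: X0\<close>)
    then have "fps_of_poly (Xp rs i k) = 0" by (simp add: XpX)
    then have "Xp rs i k = 0" by simp
    then show ?thesis using X1[OF that(2), of rs k] D1 by simp
  qed
  show "(\<Sum>i<d. shifted_prod d (ad_mat d c H1) rs i i) = (\<Sum>i<d. shifted_prod d (ad_mat d c H0) rs i i)"
  proof -
    define \<tau> where "\<tau> = (\<Sum>i<d. shifted_prod d (ad_mat d c H0) rs i i)"
    have "(\<Sum>i<d. X rs i i) = fps_const \<tau>"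
      by (subst fps_trace_const[OF X']) (auto simp: fps_sum_nth X0 \<tau>_def)
    then have "fps_of_poly (\<Sum>i<d. Xp rs i i) = fps_of_poly (D ^ length rs * [:\<tau>:])"
      by (simp add: fps_of_poly_sum XpX fps_of_poly_mult fps_of_poly_power fps_of_poly_const
          flip: sum_distrib_left)
    then have "(\<Sum>i<d. Xp rs i i) = D ^ length rs * [:\<tau>:]" by (simp add: fps_of_poly_eq_iff)
    from arg_cong[OF this, of "\<lambda>p. poly p 1"]
    have "poly D 1 ^ length rs * (\<Sum>i<d. shifted_prod d (ad_mat d c H1) rs i i) = poly D 1 ^ length rs * \<tau>"
      by (simp add: poly_sum X1 sum_distrib_left)
    then show ?thesis using D1 by (simp add: \<tau>_def)
  qed
qed

text \<open>
  The abstract dimension made concrete: entrywise coordinates with respect to a basis with as many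
  elements as the dimension.
\<close>
lemma mat_subspace_basis:
  fixes g :: "nat \<Rightarrow> complex mat"
  assumes W: "W \<subseteq> carrier_mat n n" "0\<^sub>m n n \<in> W" "\<And>x y. x \<in> W \<Longrightarrow> y \<in> W \<Longrightarrow> x + y \<in> W"
      "\<And>c x. x \<in> W \<Longrightarrow> c \<cdot>\<^sub>m x \<in> W"
    and g: "\<And>a. a < d \<Longrightarrow> g a \<in> W"
    and gen: "\<And>w. w \<in> W \<Longrightarrow> \<exists>c. \<forall>i<n. \<forall>k<n. w $$ (i,k) = (\<Sum>a<d. c a * g a $$ (i,k))"
    and m: "m = vectorspace.dim class_ring (module_mat TYPE(complex) n n\<lparr>carrier := W\<rparr>)"
  obtains b where "\<And>l. l < m \<Longrightarrow> b l \<in> W"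
    "\<And>w. w \<in> W \<Longrightarrow> \<exists>c. \<forall>i<n. \<forall>k<n. w $$ (i,k) = (\<Sum>l<m. c l * b l $$ (i,k))"
    "\<And>c l. (\<And>i k. i < n \<Longrightarrow> k < n \<Longrightarrow> (\<Sum>l<m. c l * b l $$ (i,k)) = 0) \<Longrightarrow> l < m \<Longrightarrow> c l = 0"
proof -
  let ?V = "module_mat TYPE(complex) n n" and ?K = "class_ring :: complex ring"
  interpret V: vectorspace ?K ?V by (rule matrix_vs)
  have sub: "submodule ?K W ?V"
    using W by unfold_locales (auto simp: matrix_vs_simps)
  interpret W: vectorspace ?K "?V\<lparr>carrier := W\<rparr>"
    by (rule V.subspace_is_vs) (simp add: VectorSpace.subspace_def sub V.vectorspace_axioms)
  have lincomb: "W.lincomb a A \<in> W \<and> (\<forall>i<n. \<forall>k<n. W.lincomb a A $$ (i,k) = (\<Sum>v\<in>A. a v * v $$ (i,k)))"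
    if "finite A" "A \<subseteq> W" for a A
    using that
  proof (induction A rule: finite_induct)
    case empty
    then show ?case using W(2) by (simp add: W.lincomb_def module_mat_simps)
  next
    case (insert v A)
    have "W.lincomb a (insert v A) = a v \<cdot>\<^sub>m v + W.lincomb a A"
      unfolding W.lincomb_def using insert.hyps insert.prems W
      by (subst W.finsum_insert) (auto simp: module_mat_simps)
    moreover have "v \<in> carrier_mat n n" "W.lincomb a A \<in> carrier_mat n n"
      using insert W(1) by auto
    ultimately show ?case using insert W by (auto simp: index_add_mat index_smult_mat)
  qed
  \<comment> \<open>partial sums, since the \<open>g a\<close> need not be distinct and spans are formed over sets\<close>
  define part where "part c e = mat n n (\<lambda>(i,k). \<Sum>a<e. c a * g a $$ (i,k))" for c :: "nat \<Rightarrow> complex" and e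
  let ?G = "g ` {..<d}"
  have G: "?G \<subseteq> W" using g by auto
  have spanG: "submodule ?K (W.span ?G) (?V\<lparr>carrier := W\<rparr>)"
    by (rule W.span_is_submodule) (use G in auto)
  have part_span: "part c e \<in> W.span ?G" if "e \<le> d" for c e
    using that
  proof (induction e)
    case 0
    have "0\<^sub>m n n \<in> W.span ?G"
      using submodule.zero_closed[OF spanG] by (simp add: module_mat_simps)
    moreover have "part c 0 = 0\<^sub>m n n" by (rule eq_matI) (auto simp: part_def)
    ultimately show ?case by simp
  next
    case (Suc e)
    have "g e \<in> W.span ?G"
      using W.in_own_span[of ?G] G Suc.prems by auto
    then have "c e \<cdot>\<^sub>m g e \<in> W.span ?G"
      using submodule.smult_closed[OF spanG, of "c e" "g e"] by (simp add: matrix_vs_simps)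
    then have "part c e + c e \<cdot>\<^sub>m g e \<in> W.span ?G"
      using submodule.m_closed[OF spanG, of "part c e" "c e \<cdot>\<^sub>m g e"] Suc by (simp add: matrix_vs_simps)
    moreover have "part c (Suc e) = part c e + c e \<cdot>\<^sub>m g e"
      using g[of e] W(1) Suc.prems by (intro eq_matI) (auto simp: part_def subset_iff)
    ultimately show ?case by simp
  qed
  have "W \<subseteq> W.span ?G"
  proof
    fix w assume w: "w \<in> W"
    from gen[OF w] obtain c where c: "\<forall>i<n. \<forall>k<n. w $$ (i,k) = (\<Sum>a<d. c a * g a $$ (i,k))" ..
    have "w = part c d" using w W(1) c by (intro eq_matI) (auto simp: part_def)
    then show "w \<in> W.span ?G" using part_span[of d c] by simp
  qed
  then have "W.span ?G = W" using W.span_is_subset2[of ?G] G by auto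
  then have "W.fin_dim" unfolding W.fin_dim_def using G by (intro exI[of _ ?G]) auto
  then obtain B where B: "finite B" "W.basis B" using W.finite_basis_exists by auto
  have m': "m = card B" unfolding m by (rule W.dim_basis[OF B])
  from B have BW: "B \<subseteq> W" and Bsp: "W.span B = W" and Bli: "\<not> W.lin_dep B"
    unfolding W.basis_def by auto
  obtain b where b: "bij_betw b {..<m} B"
    using ex_bij_betw_nat_finite[OF B(1)] m' atLeast0LessThan by auto
  have sum_b: "(\<Sum>l<m. a (b l) * b l $$ x) = (\<Sum>v\<in>B. a v * v $$ x)" for a :: "complex mat \<Rightarrow> complex" and x
    by (rule sum.reindex_bij_betw[OF b])
  show ?thesis
  proof (rule that[of b])
    show "b l \<in> W" if "l < m" for l using b BW that by (auto simp: bij_betw_def)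
    show "\<exists>c. \<forall>i<n. \<forall>k<n. w $$ (i,k) = (\<Sum>l<m. c l * b l $$ (i,k))" if "w \<in> W" for w
    proof -
      have "\<exists>a. a \<in> B \<rightarrow> carrier ?K \<and> w = W.lincomb a B"
        using W.finite_in_span[OF B(1)] BW Bsp that by auto
      then obtain a where "w = W.lincomb a B" by auto
      then show ?thesis using lincomb[OF B(1) BW] by (intro exI[of _ "\<lambda>l. a (b l)"]) (simp add: sum_b)
    qed
    show "c l = 0" if c: "\<And>i k. i < n \<Longrightarrow> k < n \<Longrightarrow> (\<Sum>l<m. c l * b l $$ (i,k)) = 0" and l: "l < m" for c l
    proof -
      define a where "a v = c (the_inv_into {..<m} b v)" for v
      have inj: "inj_on b {..<m}" using b by (simp add: bij_betw_def)
      have a: "a (b l) = c l" if "l < m" for l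
        using the_inv_into_f_f[OF inj] that by (simp add: a_def)
      have "W.lincomb a B = 0\<^sub>m n n"
      proof (rule eq_matI)
        fix i k assume "i < dim_row (0\<^sub>m n n :: complex mat)" "k < dim_col (0\<^sub>m n n :: complex mat)"
        then have ik: "i < n" "k < n" by auto
        have "W.lincomb a B $$ (i,k) = (\<Sum>l<m. a (b l) * b l $$ (i,k))"
          using lincomb[OF B(1) BW] ik by (simp add: sum_b)
        also have "\<dots> = (\<Sum>l<m. c l * b l $$ (i,k))" by (rule sum.cong) (auto simp: a)
        finally show "W.lincomb a B $$ (i,k) = 0\<^sub>m n n $$ (i,k)" using c[OF ik] ik by simp
      qed (use lincomb[OF B(1) BW, of a] W(1) in auto)
      then have "a \<in> B \<rightarrow> {0}"
        using W.not_lindepD[OF Bli B(1) subset_refl, of a] by (simp add: matrix_vs_simps)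
      then have "a (b l) = 0" using b l by (auto simp: bij_betw_def)
      then show ?thesis using a[OF l] by simp
    qed
  qed
qed

definition mat_comb :: "nat \<Rightarrow> nat \<Rightarrow> (nat \<Rightarrow> complex mat) \<Rightarrow> (nat \<Rightarrow> complex) \<Rightarrow> complex mat" where
  "mat_comb n d e u = mat n n (\<lambda>(i,k). \<Sum>a<d. u a * e a $$ (i,k))"

lemma mat_comb_carrier [simp]: "mat_comb n d e u \<in> carrier_mat n n"
  by (simp add: mat_comb_def)

lemma mat_comb_index [simp]: "i < n \<Longrightarrow> k < n \<Longrightarrow> mat_comb n d e u $$ (i,k) = (\<Sum>a<d. u a * e a $$ (i,k))"
  by (simp add: mat_comb_def)

lemma mat_comb_dim [simp]: "dim_row (mat_comb n d e u) = n" "dim_col (mat_comb n d e u) = n"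
  by (simp_all add: mat_comb_def)

lemma carrier_mat_eqI:
  "x \<in> carrier_mat n n \<Longrightarrow> y \<in> carrier_mat n n \<Longrightarrow>
    (\<And>i k. i < n \<Longrightarrow> k < n \<Longrightarrow> x $$ (i,k) = y $$ (i,k)) \<Longrightarrow> x = y"
  by (intro eq_matI) auto

lemma lie_bracket_carrier [simp]:
  "x \<in> carrier_mat n n \<Longrightarrow> y \<in> carrier_mat n n \<Longrightarrow> lie_bracket x y \<in> carrier_mat n n"
  unfolding lie_bracket_def by (intro minus_carrier_mat mult_carrier_mat)

lemma lie_bracket_index:
  assumes "x \<in> carrier_mat n n" "y \<in> carrier_mat n n" "i < n" "k < n"
  shows "lie_bracket x y $$ (i,k) = (\<Sum>l<n. x $$ (i,l) * y $$ (l,k)) - (\<Sum>l<n. y $$ (i,l) * x $$ (l,k))"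
  using assms by (simp add: lie_bracket_def scalar_prod_def atLeast0LessThan)

lemma lie_bracket_jacobi:
  assumes x: "x \<in> carrier_mat n n" and y: "y \<in> carrier_mat n n" and z: "z \<in> carrier_mat n n"
  shows "lie_bracket x (lie_bracket y z) = lie_bracket (lie_bracket x y) z + lie_bracket y (lie_bracket x z)"
proof -
  define T where "T a b c = a * (b * c)" for a b c :: "complex mat"
  have T: "T a b c \<in> carrier_mat n n"
    if "a \<in> carrier_mat n n" "b \<in> carrier_mat n n" "c \<in> carrier_mat n n" for a b c
    using that by (simp add: T_def)
  have left: "lie_bracket a (lie_bracket b c) = (T a b c - T a c b) - (T b c a - T c b a)"
    and right: "lie_bracket (lie_bracket a b) c = (T a b c - T b a c) - (T c a b - T c b a)"
    if "a \<in> carrier_mat n n" "b \<in> carrier_mat n n" "c \<in> carrier_mat n n" for a b c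
    using that
    by (simp_all add: T_def lie_bracket_def mult_minus_distrib_mat[of _ n n _ n]
        minus_mult_distrib_mat[of _ n n _ _ n] assoc_mult_mat[of _ n n _ n _ n])
  show ?thesis
    unfolding left[OF x y z] right[OF x y z] left[OF y x z]
    using T[OF x y z] T[OF x z y] T[OF y x z] T[OF y z x] T[OF z x y] T[OF z y x]
    by (intro carrier_mat_eqI[of _ n] minus_carrier_mat add_carrier_mat) simp_all
qed

section \<open>Matrix Lie algebras in coordinates\<close>

locale lie_algebra_with_basis =
  fixes n d :: nat and L :: "complex mat set" and e :: "nat \<Rightarrow> complex mat"
    and coord :: "complex mat \<Rightarrow> nat \<Rightarrow> complex"
  assumes L_carrier: "L \<subseteq> carrier_mat n n"
    and bracket_closed: "x \<in> L \<Longrightarrow> y \<in> L \<Longrightarrow> lie_bracket x y \<in> L"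
    and basis_in: "a < d \<Longrightarrow> e a \<in> L"
    and comb_in: "mat_comb n d e u \<in> L"
    and coord_comb: "a < d \<Longrightarrow> coord (mat_comb n d e u) a = u a"
    and comb_coord: "x \<in> L \<Longrightarrow> mat_comb n d e (coord x) = x"
begin

definition sc :: "nat \<Rightarrow> nat \<Rightarrow> nat \<Rightarrow> complex" where
  "sc a b k = coord (lie_bracket (e a) (e b)) k"

lemma carrier: "x \<in> L \<Longrightarrow> x \<in> carrier_mat n n"
  using L_carrier by auto

lemma index_coord: "x \<in> L \<Longrightarrow> i < n \<Longrightarrow> k < n \<Longrightarrow> x $$ (i,k) = (\<Sum>a<d. coord x a * e a $$ (i,k))"
  using mat_comb_index[of i n k d e "coord x"] comb_coord by simp

lemma coord_eqI:
  assumes "x \<in> L" "\<And>i k. i < n \<Longrightarrow> k < n \<Longrightarrow> x $$ (i,k) = (\<Sum>a<d. u a * e a $$ (i,k))" "a < d"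
  shows "coord x a = u a"
proof -
  have "x = mat_comb n d e u" using assms(1,2) carrier[of x] by (intro carrier_mat_eqI[of _ n]) auto
  then show ?thesis using assms(3) coord_comb by simp
qed

lemma L_eqI: "x \<in> L \<Longrightarrow> y \<in> L \<Longrightarrow> (\<And>a. a < d \<Longrightarrow> coord x a = coord y a) \<Longrightarrow> x = y"
  by (intro carrier_mat_eqI[of _ n] carrier) (simp_all add: index_coord)

lemma L_add: "x \<in> L \<Longrightarrow> y \<in> L \<Longrightarrow> x + y \<in> L"
  and coord_add: "x \<in> L \<Longrightarrow> y \<in> L \<Longrightarrow> a < d \<Longrightarrow> coord (x + y) a = coord x a + coord y a"
proof -
  assume xy: "x \<in> L" "y \<in> L"
  have *: "x + y = mat_comb n d e (\<lambda>a. coord x a + coord y a)"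
    using carrier[OF xy(1)] carrier[OF xy(2)] xy
    by (intro carrier_mat_eqI[of _ n]) (simp_all add: index_coord distrib_right sum.distrib)
  show "x + y \<in> L" unfolding * by (rule comb_in)
  show "coord (x + y) a = coord x a + coord y a" if "a < d" unfolding * using that by (rule coord_comb)
qed

lemma L_smult: "x \<in> L \<Longrightarrow> c \<cdot>\<^sub>m x \<in> L"
  and coord_smult: "x \<in> L \<Longrightarrow> a < d \<Longrightarrow> coord (c \<cdot>\<^sub>m x) a = c * coord x a"
proof -
  assume x: "x \<in> L"
  have *: "c \<cdot>\<^sub>m x = mat_comb n d e (\<lambda>a. c * coord x a)"
    using carrier[OF x] x
    by (intro carrier_mat_eqI[of _ n]) (simp_all add: index_coord sum_distrib_left mult.assoc)
  show "c \<cdot>\<^sub>m x \<in> L" unfolding * by (rule comb_in)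
  show "coord (c \<cdot>\<^sub>m x) a = c * coord x a" if "a < d" unfolding * using that by (rule coord_comb)
qed

lemma L_zero: "0\<^sub>m n n \<in> L" and coord_zero: "a < d \<Longrightarrow> coord (0\<^sub>m n n) a = 0"
proof -
  have *: "0\<^sub>m n n = mat_comb n d e (\<lambda>_. 0)" by (intro carrier_mat_eqI[of _ n]) simp_all
  show "0\<^sub>m n n \<in> L" unfolding * by (rule comb_in)
  show "coord (0\<^sub>m n n) a = 0" if "a < d" unfolding * using that by (rule coord_comb)
qed

lemma coord_basis: "b < d \<Longrightarrow> a < d \<Longrightarrow> coord (e b) a = (if a = b then 1 else 0)"
  by (rule coord_eqI) (auto simp: basis_in if_distrib[of "\<lambda>z. z * _"] cong: if_cong)

lemma coord_bracket:
  assumes x: "x \<in> L" and y: "y \<in> L" and k: "k < d"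
  shows "coord (lie_bracket x y) k = (\<Sum>b<d. ad_mat d sc (coord x) k b * coord y b)"
proof (rule coord_eqI[OF bracket_closed[OF x y] _ k])
  fix i j assume ij: "i < n" "j < n"
  have prod: "(\<Sum>l<n. x $$ (i,l) * y $$ (l,j)) =
      (\<Sum>a<d. \<Sum>b<d. coord x a * coord y b * (\<Sum>l<n. e a $$ (i,l) * e b $$ (l,j)))"
    if "x \<in> L" "y \<in> L" for x y
  proof -
    have "(\<Sum>l<n. x $$ (i,l) * y $$ (l,j)) =
        (\<Sum>l<n. \<Sum>a<d. \<Sum>b<d. coord x a * coord y b * (e a $$ (i,l) * e b $$ (l,j)))"
      using that ij by (simp add: index_coord sum_product mult_ac)
    also have "\<dots> = (\<Sum>a<d. \<Sum>l<n. \<Sum>b<d. coord x a * coord y b * (e a $$ (i,l) * e b $$ (l,j)))"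
      by (rule sum.swap)
    also have "\<dots> = (\<Sum>a<d. \<Sum>b<d. \<Sum>l<n. coord x a * coord y b * (e a $$ (i,l) * e b $$ (l,j)))"
      by (intro sum.cong refl sum.swap)
    finally show ?thesis by (simp add: sum_distrib_left)
  qed
  have "lie_bracket x y $$ (i,j) =
      (\<Sum>a<d. \<Sum>b<d. coord x a * coord y b * (\<Sum>l<n. e a $$ (i,l) * e b $$ (l,j)))
    - (\<Sum>b<d. \<Sum>a<d. coord y b * coord x a * (\<Sum>l<n. e b $$ (i,l) * e a $$ (l,j)))"
    using x y ij carrier by (simp add: lie_bracket_index[of _ n] prod)
  also have "(\<Sum>b<d. \<Sum>a<d. coord y b * coord x a * (\<Sum>l<n. e b $$ (i,l) * e a $$ (l,j)))
      = (\<Sum>a<d. \<Sum>b<d. coord x a * coord y b * (\<Sum>l<n. e b $$ (i,l) * e a $$ (l,j)))"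
    by (subst sum.swap) (simp only: mult.commute[of "coord y _"])
  also have "(\<Sum>a<d. \<Sum>b<d. coord x a * coord y b * (\<Sum>l<n. e a $$ (i,l) * e b $$ (l,j))) - \<dots>
      = (\<Sum>a<d. \<Sum>b<d. coord x a * coord y b * lie_bracket (e a) (e b) $$ (i,j))"
    using ij carrier basis_in
    by (simp add: lie_bracket_index[of _ n] right_diff_distrib sum_subtractf)
  also have "\<dots> = (\<Sum>a<d. \<Sum>b<d. \<Sum>k<d. coord x a * coord y b * (sc a b k * e k $$ (i,j)))"
  proof (intro sum.cong refl)
    fix a b assume "a \<in> {..<d}" "b \<in> {..<d}"
    then have "lie_bracket (e a) (e b) $$ (i,j) = (\<Sum>k<d. sc a b k * e k $$ (i,j))"
      unfolding sc_def using ij basis_in by (intro index_coord bracket_closed) auto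
    then show "coord x a * coord y b * lie_bracket (e a) (e b) $$ (i,j) =
        (\<Sum>k<d. coord x a * coord y b * (sc a b k * e k $$ (i,j)))"
      by (simp add: sum_distrib_left)
  qed
  also have "\<dots> = (\<Sum>a<d. \<Sum>k<d. \<Sum>b<d. coord x a * coord y b * (sc a b k * e k $$ (i,j)))"
    by (intro sum.cong refl sum.swap)
  also have "\<dots> = (\<Sum>k<d. \<Sum>a<d. \<Sum>b<d. coord x a * coord y b * (sc a b k * e k $$ (i,j)))"
    by (rule sum.swap)
  also have "\<dots> = (\<Sum>k<d. \<Sum>b<d. \<Sum>a<d. coord x a * coord y b * (sc a b k * e k $$ (i,j)))"
    by (intro sum.cong refl sum.swap)
  also have "\<dots> = (\<Sum>k<d. (\<Sum>b<d. ad_mat d sc (coord x) k b * coord y b) * e k $$ (i,j))"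
    unfolding ad_mat_def sum_distrib_right by (intro sum.cong refl) (simp add: mult_ac)
  finally show "lie_bracket x y $$ (i,j) = (\<Sum>k<d. (\<Sum>b<d. ad_mat d sc (coord x) k b * coord y b) * e k $$ (i,j))" .
qed

lemma coord_bracket_basis_right:
  assumes "x \<in> L" "b < d" "k < d"
  shows "coord (lie_bracket x (e b)) k = ad_mat d sc (coord x) k b"
  using assms by (simp add: coord_bracket basis_in coord_basis if_distrib[of "\<lambda>z. _ * z"] cong: if_cong)

lemma ad_mat_basis:
  assumes "a < d"
  shows "ad_mat d sc (coord (e a)) k b = sc a b k"
  using assms by (simp add: ad_mat_def coord_basis if_distrib[of "\<lambda>z. z * _"] cong: if_cong)

lemma leibniz_sc: "leibniz_constants d sc"
  unfolding leibniz_constants_def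
proof (intro allI impI)
  fix a b f k assume ab: "a < d" "b < d" "f < d" "k < d"
  note in_L = basis_in[OF ab(1)] basis_in[OF ab(2)] basis_in[OF ab(3)]
  have "coord (lie_bracket (e a) (lie_bracket (e b) (e f))) k =
      coord (lie_bracket (lie_bracket (e a) (e b)) (e f)) k + coord (lie_bracket (e b) (lie_bracket (e a) (e f))) k"
    unfolding lie_bracket_jacobi[OF carrier[OF in_L(1)] carrier[OF in_L(2)] carrier[OF in_L(3)]]
    using in_L ab(4) by (intro coord_add bracket_closed)
  moreover have "coord (lie_bracket (e a) (lie_bracket (e b) (e f))) k = (\<Sum>l<d. sc b f l * sc a l k)"
    if "a < d" "b < d" for a b
    using that ab basis_in bracket_closed
    by (simp add: coord_bracket[of "e a"] ad_mat_basis sc_def[symmetric] mult.commute)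
  moreover have "coord (lie_bracket (lie_bracket (e a) (e b)) (e f)) k = (\<Sum>l<d. sc a b l * sc l f k)"
    using ab in_L bracket_closed by (simp add: coord_bracket_basis_right ad_mat_def sc_def[symmetric])
  ultimately show "(\<Sum>l<d. sc b f l * sc a l k) = (\<Sum>l<d. sc a b l * sc l f k) + (\<Sum>l<d. sc a f l * sc b l k)"
    using ab by simp
qed

lemma functional_coord:
  assumes F: "linear_functional_on L F" and x: "x \<in> L"
  shows "F x = (\<Sum>a<d. F (e a) * coord x a)"
proof -
  define p where "p m = mat_comb n d e (\<lambda>a. if a < m then coord x a else 0)" for m
  have "F (p m) = (\<Sum>a<m. F (e a) * coord x a)" if "m \<le> d" for m
    using that
  proof (induction m)
    case 0
    have "0 \<cdot>\<^sub>m p 0 = p 0" by (rule eq_matI) (auto simp: p_def)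
    moreover have "F (0 \<cdot>\<^sub>m p 0) = 0 * F (p 0)"
      using F comb_in unfolding linear_functional_on_def p_def by blast
    ultimately show ?case by simp
  next
    case (Suc m)
    then have m: "m < d" by simp
    have "p (Suc m) = p m + coord x m \<cdot>\<^sub>m e m"
    proof (rule L_eqI)
      show "p (Suc m) \<in> L" "p m + coord x m \<cdot>\<^sub>m e m \<in> L"
        using m by (auto simp: p_def comb_in L_add L_smult basis_in)
      show "coord (p (Suc m)) a = coord (p m + coord x m \<cdot>\<^sub>m e m) a" if "a < d" for a
        using m that by (auto simp: p_def comb_in coord_add coord_comb L_smult coord_smult basis_in coord_basis
              less_Suc_eq)
    qed
    moreover have "F (p m + coord x m \<cdot>\<^sub>m e m) = F (p m) + coord x m * F (e m)"
      using F comb_in L_smult[OF basis_in[OF m]] basis_in[OF m]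
      unfolding linear_functional_on_def p_def by simp
    ultimately show ?case using Suc by (simp add: mult.commute)
  qed
  moreover have "p d = x"
    using x by (intro L_eqI) (auto simp: p_def comb_in coord_comb)
  ultimately show ?thesis by auto
qed

lemma functional_bracket:
  assumes F: "linear_functional_on L F" and x: "x \<in> L" and y: "y \<in> L"
  shows "F (lie_bracket x y) = (\<Sum>b<d. row_mult d (\<lambda>a. F (e a)) (ad_mat d sc (coord x)) b * coord y b)"
proof -
  have "F (lie_bracket x y) = (\<Sum>k<d. \<Sum>b<d. F (e k) * (ad_mat d sc (coord x) k b * coord y b))"
    using x y by (simp add: functional_coord[OF F] bracket_closed coord_bracket sum_distrib_left)
  also have "\<dots> = (\<Sum>b<d. \<Sum>k<d. F (e k) * (ad_mat d sc (coord x) k b * coord y b))"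
    by (rule sum.swap)
  finally show ?thesis by (simp add: row_mult_def sum_distrib_right mult.assoc)
qed

lemma ad_mat_cong: "(\<And>a. a < d \<Longrightarrow> u a = v a) \<Longrightarrow> ad_mat d sc u k b = ad_mat d sc v k b"
  by (simp add: ad_mat_def)

lemma frobenius_nondegenerate:
  assumes F: "frobenius_functional n L F"
  shows "nondegenerate_row d sc (\<lambda>a. F (e a))"
  unfolding nondegenerate_row_def
proof (intro allI impI)
  fix v a assume v: "\<forall>b<d. row_mult d (\<lambda>a. F (e a)) (ad_mat d sc v) b = 0" and a: "a < d"
  define x where "x = mat_comb n d e v"
  have x: "x \<in> L" by (simp add: x_def comb_in)
  have lin: "linear_functional_on L F" using F by (simp add: frobenius_functional_def)
  have adx: "ad_mat d sc (coord x) = ad_mat d sc v"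
    by (intro ext ad_mat_cong) (simp add: x_def coord_comb)
  have "kirillov_form F x y = 0" if "y \<in> L" for y
    using v by (simp add: kirillov_form_def functional_bracket[OF lin x that] adx)
  then have "x = 0\<^sub>m n n" using F x by (auto simp: frobenius_functional_def)
  then have "coord x a = 0" using coord_zero[OF a] by simp
  then show "v a = 0" using a by (simp add: x_def coord_comb)
qed

lemma principal_coords_iff:
  assumes F: "linear_functional_on L F" and H: "H \<in> L"
  shows "principal_coords d sc (\<lambda>a. F (e a)) (coord H) \<longleftrightarrow> (\<forall>x\<in>L. F (lie_bracket H x) = F x)"
proof
  assume "principal_coords d sc (\<lambda>a. F (e a)) (coord H)"
  then show "\<forall>x\<in>L. F (lie_bracket H x) = F x"
    using H by (auto simp: functional_bracket[OF F] functional_coord[OF F, symmetric] principal_coords_def)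
next
  assume *: "\<forall>x\<in>L. F (lie_bracket H x) = F x"
  show "principal_coords d sc (\<lambda>a. F (e a)) (coord H)"
    unfolding principal_coords_def
  proof (intro allI impI)
    fix b assume b: "b < d"
    have "F (lie_bracket H (e b)) = row_mult d (\<lambda>a. F (e a)) (ad_mat d sc (coord H)) b"
      using b by (simp add: functional_bracket[OF F H] basis_in coord_basis if_distrib[of "\<lambda>z. _ * z"] cong: if_cong)
    then show "row_mult d (\<lambda>a. F (e a)) (ad_mat d sc (coord H)) b = F (e b)"
      using * b basis_in by simp
  qed
qed

lemma principal_element_coords:
  assumes F: "frobenius_functional n L F"
  shows "principal_element L F \<in> L"
    and "principal_coords d sc (\<lambda>a. F (e a)) (coord (principal_element L F))"
proof -
  have lin: "linear_functional_on L F" using F by (simp add: frobenius_functional_def)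
  have nd: "nondegenerate_row d sc (\<lambda>a. F (e a))" by (rule frobenius_nondegenerate[OF F])
  obtain h where h: "principal_coords d sc (\<lambda>a. F (e a)) h"
    using principal_coords_exists[OF nd] by auto
  have adh: "ad_mat d sc (coord (mat_comb n d e h)) = ad_mat d sc h"
    by (intro ext ad_mat_cong) (simp add: coord_comb)
  have ex: "\<exists>!H. H \<in> L \<and> (\<forall>x\<in>L. F (lie_bracket H x) = F x)"
  proof (rule ex1I[of _ "mat_comb n d e h"])
    have "principal_coords d sc (\<lambda>a. F (e a)) (coord (mat_comb n d e h))"
      using h by (simp add: principal_coords_def adh)
    then show "mat_comb n d e h \<in> L \<and> (\<forall>x\<in>L. F (lie_bracket (mat_comb n d e h) x) = F x)"
      using principal_coords_iff[OF lin comb_in] comb_in by auto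
    fix H assume H: "H \<in> L \<and> (\<forall>x\<in>L. F (lie_bracket H x) = F x)"
    then have "principal_coords d sc (\<lambda>a. F (e a)) (coord H)" using principal_coords_iff[OF lin] by auto
    then have "coord H a = h a" if "a < d" for a
      using principal_coords_unique[OF nd _ h that] by auto
    then show "H = mat_comb n d e h"
      using H by (intro L_eqI) (auto simp: comb_in coord_comb)
  qed
  from theI'[OF ex] show "principal_element L F \<in> L"
    "principal_coords d sc (\<lambda>a. F (e a)) (coord (principal_element L F))"
    using principal_coords_iff[OF lin] unfolding principal_element_def by auto
qed

end

lemma shifted_prod_diagonal:
  assumes "\<And>i k. i < d \<Longrightarrow> k < d \<Longrightarrow> A i k = (if i = k then w k else 0)" "i < d" "k < d"
  shows "shifted_prod d A rs i k = (if i = k then (\<Prod>r\<leftarrow>rs. w k - r) else 0)"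
  using assms(2,3)
proof (induction rs arbitrary: i k)
  case (Cons r rs)
  have "shifted_prod d A (r # rs) i k =
      sq_mult d (\<lambda>i k. if i = k then w i - r else 0) (shifted_prod d A rs) i k"
    using Cons.prems by (auto simp: assms(1) intro!: sq_mult_cong)
  also have "\<dots> = (w i - r) * shifted_prod d A rs i k"
    using Cons.prems by (simp add: sq_mult_def if_distrib[of "\<lambda>z. z * _"] cong: if_cong)
  finally show ?case using Cons by simp
qed simp

lemma shifted_prod_eigenvector:
  assumes "\<And>i. i < d \<Longrightarrow> (\<Sum>k<d. A i k * v k) = \<mu> * v i" "i < d"
  shows "(\<Sum>k<d. shifted_prod d A rs i k * v k) = (\<Prod>r\<leftarrow>rs. \<mu> - r) * v i"
  using assms(2)
proof (induction rs arbitrary: i)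
  case Nil
  then show ?case by (simp add: if_distrib[of "\<lambda>z. z * _"] cong: if_cong)
next
  case (Cons r rs)
  let ?B = "\<lambda>i k. A i k - (if i = k then r else 0)"
  have "(\<Sum>k<d. shifted_prod d A (r # rs) i k * v k) = (\<Sum>k<d. \<Sum>l<d. ?B i l * (shifted_prod d A rs l k * v k))"
    by (simp add: sq_mult_def sum_distrib_right mult.assoc)
  also have "\<dots> = (\<Sum>l<d. ?B i l * (\<Sum>k<d. shifted_prod d A rs l k * v k))"
    by (subst sum.swap) (simp add: sum_distrib_left)
  also have "\<dots> = (\<Sum>l<d. (\<Prod>r\<leftarrow>rs. \<mu> - r) * (A i l * v l) - (if i = l then r * ((\<Prod>r\<leftarrow>rs. \<mu> - r) * v l) else 0))"
  proof (intro sum.cong refl)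
    fix l assume "l \<in> {..<d}"
    then have "(\<Sum>k<d. shifted_prod d A rs l k * v k) = (\<Prod>r\<leftarrow>rs. \<mu> - r) * v l"
      by (simp only: Cons.IH lessThan_iff)
    then show "?B i l * (\<Sum>k<d. shifted_prod d A rs l k * v k) =
        (\<Prod>r\<leftarrow>rs. \<mu> - r) * (A i l * v l) - (if i = l then r * ((\<Prod>r\<leftarrow>rs. \<mu> - r) * v l) else 0)"
      by (simp only:) (auto simp: algebra_simps)
  qed
  also have "\<dots> = (\<Prod>r\<leftarrow>rs. \<mu> - r) * (\<Sum>l<d. A i l * v l) - r * ((\<Prod>r\<leftarrow>rs. \<mu> - r) * v i)"
    using Cons.prems by (simp add: sum_subtractf sum_distrib_left)
  also have "\<dots> = (\<Prod>r\<leftarrow>r # rs. \<mu> - r) * v i"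
    unfolding assms(1)[OF Cons.prems] by (simp add: algebra_simps)
  finally show ?case .
qed

context lie_algebra_with_basis
begin

text \<open>
  Let \<open>P\<close> be the product of \<open>ad H - r\<close> over all eigenvalues \<open>r \<noteq> j\<close> of \<open>ad K\<close>. By invariance its columns lie
  in the eigenspace for \<open>j\<close>, its trace equals the trace of the same product formed from \<open>ad K\<close>, and \<open>P\<close> acts on the
  eigenspace as the nonzero scalar \<open>\<pi>\<close>. Writing the columns of \<open>P\<close> in a basis of the eigenspace
  factors \<open>P\<close> through a space whose dimension is the multiplicity, and the trace can be computed there as
  \<open>\<pi>\<close> times this dimension.
\<close>
theorem principal_mult_eq_card:
  assumes F0: "frobenius_functional n L F0" and F1: "frobenius_functional n L F1"
    and K: "K \<in> L" "\<And>x. x \<in> L \<Longrightarrow> F0 (lie_bracket K x) = F0 x"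
    and w: "\<And>a. a < d \<Longrightarrow> lie_bracket K (e a) = of_int (w a) \<cdot>\<^sub>m e a"
  shows "principal_mult n L F1 j = card {a. a < d \<and> w a = j}"
proof -
  define H where "H = principal_element L F1"
  have H: "H \<in> L" and pr1: "principal_coords d sc (\<lambda>a. F1 (e a)) (coord H)"
    unfolding H_def using principal_element_coords[OF F1] by auto
  have pr0: "principal_coords d sc (\<lambda>a. F0 (e a)) (coord K)"
    using F0 K by (subst principal_coords_iff) (auto simp: frobenius_functional_def)
  note inv = principal_spectrum_invariance[OF leibniz_sc frobenius_nondegenerate[OF F0]
      frobenius_nondegenerate[OF F1] pr0 pr1]
  define A0 where "A0 = ad_mat d sc (coord K)"
  define A1 where "A1 = ad_mat d sc (coord H)"
  define wc where "wc a = (of_int (w a) :: complex)" for a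
  have A0: "A0 i k = (if i = k then wc k else 0)" if "i < d" "k < d" for i k
    unfolding A0_def using that
    by (subst coord_bracket_basis_right[symmetric]) (auto simp: K w coord_smult basis_in coord_basis wc_def)
  define \<mu> where "\<mu> = (of_int j :: complex)"
  define S where "S = wc ` {..<d} - {\<mu>}"
  have "finite S" by (simp add: S_def)
  then obtain rs where rs: "set rs = S" using finite_list by auto
  define \<pi> where "\<pi> = (\<Prod>r\<leftarrow>rs. \<mu> - r)"
  have \<pi>: "\<pi> \<noteq> 0" using rs by (auto simp: \<pi>_def S_def prod_list_zero_iff)
  have prod0: "(\<Prod>r\<leftarrow>rs. wc k - r) = (if w k = j then \<pi> else 0)" if "k < d" for k
  proof (cases "w k = j")
    case True then show ?thesis by (simp add: \<pi>_def wc_def \<mu>_def)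
  next
    case False
    then have "wc k \<in> set rs" using that by (auto simp: rs S_def wc_def \<mu>_def)
    then show ?thesis using False by (force simp: prod_list_zero_iff)
  qed
  \<comment> \<open>\<open>\<pi>\<close> times the projection onto the eigenspace for \<open>j\<close>\<close>
  define P where "P = shifted_prod d A1 rs"
  have trP: "(\<Sum>i<d. P i i) = of_nat (card {a. a < d \<and> w a = j}) * \<pi>"
  proof -
    have "(\<Sum>i<d. P i i) = (\<Sum>i<d. shifted_prod d A0 rs i i)"
      unfolding P_def A1_def A0_def by (rule inv(2))
    also have "\<dots> = (\<Sum>i<d. if w i = j then \<pi> else 0)"
      using A0 by (intro sum.cong refl) (simp add: shifted_prod_diagonal[of d A0 wc] prod0)
    also have "\<dots> = of_nat (card ({..<d} \<inter> {a. w a = j})) * \<pi>"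
      by (simp add: sum.If_cases)
    also have "{..<d} \<inter> {a. w a = j} = {a. a < d \<and> w a = j}" by auto
    finally show ?thesis .
  qed
  have kill: "shifted_prod d A1 (\<mu> # rs) i k = 0" if "i < d" "k < d" for i k
    unfolding A1_def
  proof (rule inv(1)[OF _ that], fold A0_def)
    show "shifted_prod d A0 (\<mu> # rs) i k = 0" if "i < d" "k < d" for i k
    proof -
      have "(\<Prod>r\<leftarrow>\<mu> # rs. wc k - r) = (wc k - \<mu>) * (if w k = j then \<pi> else 0)"
        by (simp only: list.map prod_list.Cons prod0[OF that(2)])
      also have "\<dots> = 0" by (simp add: wc_def \<mu>_def)
      finally show ?thesis using that A0 by (subst shifted_prod_diagonal[of d A0 wc]) simp_all
    qed
  qed
  define W where "W = ad_eigenspace L H j"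
  have W_iff: "x \<in> W \<longleftrightarrow> x \<in> L \<and> (\<forall>i<d. (\<Sum>k<d. A1 i k * coord x k) = \<mu> * coord x i)" for x
  proof -
    have "lie_bracket H x = \<mu> \<cdot>\<^sub>m x \<longleftrightarrow> (\<forall>i<d. coord (lie_bracket H x) i = coord (\<mu> \<cdot>\<^sub>m x) i)" if "x \<in> L"
      using that H L_eqI[OF bracket_closed L_smult] by auto
    then show ?thesis
      using H by (auto simp: W_def ad_eigenspace_def \<mu>_def[symmetric] coord_bracket coord_smult A1_def)
  qed
  define g where "g b = mat_comb n d e (\<lambda>i. P i b)" for b
  have AP: "(\<Sum>l<d. A1 i l * P l b) = \<mu> * P i b" if "i < d" "b < d" for i b
  proof -
    have "0 = sq_mult d (\<lambda>i k. A1 i k - (if i = k then \<mu> else 0)) P i b"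
      using kill[OF that] by (simp add: P_def)
    also have "\<dots> = (\<Sum>l<d. A1 i l * P l b) - \<mu> * P i b"
      unfolding sq_mult_diff_left sq_mult_scalar_left[OF that(1)] by (simp add: sq_mult_def)
    finally show ?thesis by simp
  qed
  have g_in: "g b \<in> W" if "b < d" for b
    using that by (auto simp: W_iff g_def comb_in coord_comb AP)
  have P_fix: "(\<Sum>b<d. P i b * coord x b) = \<pi> * coord x i" if "x \<in> W" "i < d" for x i
    unfolding P_def \<pi>_def using that W_iff by (intro shifted_prod_eigenvector) auto
  have gen: "\<exists>c. \<forall>i<n. \<forall>k<n. x $$ (i,k) = (\<Sum>b<d. c b * g b $$ (i,k))" if x: "x \<in> W" for x
  proof (intro exI allI impI)
    fix i k assume ik: "i < n" "k < n"
    have "(\<Sum>b<d. (coord x b / \<pi>) * g b $$ (i,k)) = (\<Sum>b<d. \<Sum>a<d. (P a b * coord x b) * (e a $$ (i,k) / \<pi>))"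
      using ik by (simp add: g_def sum_distrib_left mult_ac)
    also have "\<dots> = (\<Sum>a<d. (\<Sum>b<d. P a b * coord x b) * (e a $$ (i,k) / \<pi>))"
      unfolding sum_distrib_right by (rule sum.swap)
    also have "\<dots> = (\<Sum>a<d. coord x a * e a $$ (i,k))"
      using \<pi> x by (intro sum.cong refl) (simp add: P_fix)
    finally show "x $$ (i,k) = (\<Sum>b<d. (coord x b / \<pi>) * g b $$ (i,k))"
      using x ik by (simp add: W_iff index_coord)
  qed
  define m where "m = principal_mult n L F1 j"
  have W_carrier: "W \<subseteq> carrier_mat n n" using W_iff carrier by auto
  have W_closed: "0\<^sub>m n n \<in> W" "\<And>x y. x \<in> W \<Longrightarrow> y \<in> W \<Longrightarrow> x + y \<in> W" "\<And>c x. x \<in> W \<Longrightarrow> c \<cdot>\<^sub>m x \<in> W"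
    by (auto simp: W_iff L_zero coord_zero L_add coord_add L_smult coord_smult distrib_left sum.distrib
        mult.left_commute simp flip: sum_distrib_left)
  have m_dim: "m = vectorspace.dim class_ring (module_mat TYPE(complex) n n\<lparr>carrier := W\<rparr>)"
    by (simp add: m_def principal_mult_def W_def H_def)
  obtain b where b_in: "\<And>l. l < m \<Longrightarrow> b l \<in> W" and
    b_gen: "\<And>x. x \<in> W \<Longrightarrow> \<exists>c. \<forall>i<n. \<forall>k<n. x $$ (i,k) = (\<Sum>l<m. c l * b l $$ (i,k))" and
    b_indep: "\<And>c l. (\<And>i k. i < n \<Longrightarrow> k < n \<Longrightarrow> (\<Sum>l<m. c l * b l $$ (i,k)) = 0) \<Longrightarrow> l < m \<Longrightarrow> c l = 0"
    by (rule mat_subspace_basis[OF W_carrier W_closed g_in gen m_dim]) blast+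
  have comb_b: "(\<Sum>l<m. c l * b l $$ (i,k)) = (\<Sum>a<d. (\<Sum>l<m. c l * coord (b l) a) * e a $$ (i,k))"
    if "i < n" "k < n" for c i k
  proof -
    have "(\<Sum>l<m. c l * b l $$ (i,k)) = (\<Sum>l<m. \<Sum>a<d. c l * coord (b l) a * e a $$ (i,k))"
      using that b_in by (simp add: W_iff index_coord sum_distrib_left mult.assoc)
    then show ?thesis by (subst (asm) sum.swap) (simp add: sum_distrib_right)
  qed
  have "\<forall>\<beta>. \<exists>c. \<beta> < d \<longrightarrow> (\<forall>i<n. \<forall>k<n. g \<beta> $$ (i,k) = (\<Sum>l<m. c l * b l $$ (i,k)))"
    using b_gen[OF g_in] by blast
  then obtain C where "\<forall>\<beta>. \<beta> < d \<longrightarrow> (\<forall>i<n. \<forall>k<n. g \<beta> $$ (i,k) = (\<Sum>l<m. C \<beta> l * b l $$ (i,k)))"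
    by metis
  then have C: "g \<beta> $$ (i,k) = (\<Sum>l<m. C \<beta> l * b l $$ (i,k))" if "\<beta> < d" "i < n" "k < n" for \<beta> i k
    using that by blast
  have PC: "P a \<beta> = (\<Sum>l<m. C \<beta> l * coord (b l) a)" if "a < d" "\<beta> < d" for a \<beta>
  proof -
    have "coord (g \<beta>) a = (\<Sum>l<m. C \<beta> l * coord (b l) a)"
      using that by (intro coord_eqI) (auto simp: g_def[symmetric] C comb_b, simp add: g_def comb_in)
    then show ?thesis using that by (simp add: g_def coord_comb)
  qed
  have dual: "(\<Sum>\<beta><d. C \<beta> l * coord (b k) \<beta>) = (if l = k then \<pi> else 0)" if lk: "l < m" "k < m" for l k
  proof -
    define c where "c l = (\<Sum>\<beta><d. C \<beta> l * coord (b k) \<beta>) - (if l = k then \<pi> else 0)" for l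
    have "c l = 0"
    proof (rule b_indep[OF _ lk(1)])
      fix i k' assume ik: "i < n" "k' < n"
      have "(\<Sum>l<m. c l * coord (b l) a) = 0" if "a < d" for a
      proof -
        have "(\<Sum>l<m. c l * coord (b l) a) =
            (\<Sum>l<m. \<Sum>\<beta><d. C \<beta> l * coord (b k) \<beta> * coord (b l) a) - (\<Sum>l<m. (if l = k then \<pi> else 0) * coord (b l) a)"
          by (simp add: c_def left_diff_distrib sum_subtractf sum_distrib_right)
        also have "(\<Sum>l<m. (if l = k then \<pi> else 0) * coord (b l) a) = \<pi> * coord (b k) a"
          using lk by (simp add: if_distrib[of "\<lambda>z. z * _"] cong: if_cong)
        also have "(\<Sum>l<m. \<Sum>\<beta><d. C \<beta> l * coord (b k) \<beta> * coord (b l) a) = (\<Sum>\<beta><d. P a \<beta> * coord (b k) \<beta>)"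
          by (subst sum.swap) (simp add: PC that sum_distrib_left sum_distrib_right mult_ac)
        also have "\<dots> = \<pi> * coord (b k) a" using that lk by (simp add: P_fix b_in)
        finally show ?thesis by simp
      qed
      then show "(\<Sum>l<m. c l * b l $$ (i,k')) = 0" using ik by (simp add: comb_b)
    qed
    then show ?thesis by (simp add: c_def)
  qed
  have "(\<Sum>i<d. P i i) = (\<Sum>\<beta><d. \<Sum>l<m. C \<beta> l * coord (b l) \<beta>)" by (simp add: PC)
  also have "\<dots> = (\<Sum>l<m. \<Sum>\<beta><d. C \<beta> l * coord (b l) \<beta>)" by (rule sum.swap)
  also have "\<dots> = of_nat m * \<pi>" by (simp add: dual)
  finally have "(of_nat m :: complex) = of_nat (card {a. a < d \<and> w a = j})"
    using trP \<pi> by simp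
  then show ?thesis unfolding m_def by (simp only: of_nat_eq_iff)
qed

end

section \<open>Rigid pairs of compositions\<close>

fun same_block :: "nat list \<Rightarrow> nat \<Rightarrow> nat \<Rightarrow> bool" where
  "same_block [] i k = False"
| "same_block (a # A) i k = (if i < a \<or> k < a then i < a \<and> k < a else same_block A (i - a) (k - a))"

text \<open>
  The involution that reverses each block. The pairs \<open>{i, block_refl A i}\<close> and \<open>{i, block_refl B i}\<close> are
  the edges of the meander graph of \<open>(A | B)\<close>.
\<close>
fun block_refl :: "nat list \<Rightarrow> nat \<Rightarrow> nat" where
  "block_refl [] i = i"
| "block_refl (a # A) i = (if i < a then a - 1 - i else a + block_refl A (i - a))"

lemma same_block_commute: "same_block A i k \<longleftrightarrow> same_block A k i"
  by (induction A arbitrary: i k) auto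

lemma block_refl_less: "i < sum_list A \<Longrightarrow> block_refl A i < sum_list A"
  by (induction A arbitrary: i) (auto simp: less_diff_conv2)

lemma block_refl_invol: "i < sum_list A \<Longrightarrow> block_refl A (block_refl A i) = i"
  by (induction A arbitrary: i) (auto simp: less_diff_conv2)

lemma same_block_block_refl: "i < sum_list A \<Longrightarrow> same_block A i (block_refl A i)"
  by (induction A arbitrary: i) (auto simp: less_diff_conv2)

lemma block_refl_antimono:
  "same_block A i k \<Longrightarrow> i < sum_list A \<Longrightarrow> k < sum_list A \<Longrightarrow> block_refl A i < block_refl A k \<longleftrightarrow> k < i"
  by (induction A arbitrary: i k) (auto simp: less_diff_conv2 split: if_splits)

lemma same_block_append:
  "same_block (A @ B) i k = (if i < sum_list A \<or> k < sum_list A then i < sum_list A \<and> k < sum_list A \<and> same_block A i k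
     else same_block B (i - sum_list A) (k - sum_list A))"
  by (induction A arbitrary: i k) (auto simp: less_diff_conv2)

lemma block_refl_append:
  "block_refl (A @ B) i = (if i < sum_list A then block_refl A i else sum_list A + block_refl B (i - sum_list A))"
  by (induction A arbitrary: i) (auto simp: less_diff_conv2)

lemma same_block_rev:
  "i < sum_list A \<Longrightarrow> k < sum_list A \<Longrightarrow>
     same_block (rev A) i k = same_block A (sum_list A - 1 - i) (sum_list A - 1 - k)"
proof (induction A arbitrary: i k)
  case (Cons a A)
  show ?case
  proof (cases "i < sum_list A \<and> k < sum_list A")
    case True
    then have *: "a + sum_list A - 1 - i - a = sum_list A - 1 - i" "a + sum_list A - 1 - k - a = sum_list A - 1 - k"
      by auto
    from True have "\<not> a + sum_list A - 1 - i < a" "\<not> a + sum_list A - 1 - k < a" by auto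
    then show ?thesis using Cons.IH[of i k] True by (simp add: same_block_append *)
  next
    case False
    then show ?thesis using Cons.prems by (auto simp: same_block_append)
  qed
qed simp

lemma block_refl_rev:
  "i < sum_list A \<Longrightarrow> block_refl (rev A) i = sum_list A - 1 - block_refl A (sum_list A - 1 - i)"
proof (induction A arbitrary: i)
  case (Cons a A)
  show ?case
  proof (cases "i < sum_list A")
    case True
    then have *: "a + sum_list A - 1 - i - a = sum_list A - 1 - i" "\<not> a + sum_list A - 1 - i < a"
      by auto
    have "block_refl A (sum_list A - 1 - i) < sum_list A" using True by (intro block_refl_less) auto
    then show ?thesis using Cons.IH[of i] True * by (simp add: block_refl_append)
  next
    case False
    then show ?thesis using Cons.prems by (auto simp: block_refl_append)
  qed
qed simp

definition admissible :: "nat list \<Rightarrow> nat list \<Rightarrow> nat \<Rightarrow> nat \<Rightarrow> bool" where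
  "admissible A B i k \<longleftrightarrow> i = k \<or> (k < i \<and> same_block A i k) \<or> (i < k \<and> same_block B i k)"

text \<open>
  If \<open>f\<close> is the matrix with \<open>F(y) = tr (f y)\<close> for the meander functional \<open>F\<close>, then this is the entry
  of \<open>f x - x f\<close> at \<open>(q, p)\<close>, that is, \<open>F([x, E\<^sub>p\<^sub>q])\<close>: a row or column of \<open>f\<close> has at most one entry from each
  composition.
\<close>
definition meander_comm :: "nat list \<Rightarrow> nat list \<Rightarrow> (nat \<Rightarrow> nat \<Rightarrow> complex) \<Rightarrow> nat \<Rightarrow> nat \<Rightarrow> complex" where
  "meander_comm A B x q p =
     (if q < block_refl A q then x (block_refl A q) p else 0) + (if block_refl B q < q then x (block_refl B q) p else 0)
   - (if block_refl A p < p then x q (block_refl A p) else 0) - (if p < block_refl B p then x q (block_refl B p) else 0)"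

definition meander_kernel :: "nat list \<Rightarrow> nat list \<Rightarrow> (nat \<Rightarrow> nat \<Rightarrow> complex) \<Rightarrow> bool" where
  "meander_kernel A B x \<longleftrightarrow>
     (\<forall>i<sum_list A. \<forall>k<sum_list A. x i k \<noteq> 0 \<longrightarrow> admissible A B i k) \<and>
     (\<forall>p<sum_list A. \<forall>q<sum_list A. admissible A B p q \<longrightarrow> meander_comm A B x q p = 0)"

text \<open>
  The diagonal equations are part of the kernel condition, although matrix units on the diagonal have
  trace one: only their differences lie in the algebra, but all the diagonal entries of a
  commutator are zero once they are equal.
\<close>
definition rigid :: "nat list \<Rightarrow> nat list \<Rightarrow> bool" where
  "rigid A B \<longleftrightarrow> sum_list A = sum_list B \<and> (\<forall>x. meander_kernel A B x \<longrightarrow>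
     (\<exists>c. \<forall>i<sum_list A. \<forall>k<sum_list A. x i k = (if i = k then c else 0)))"

text \<open>
  Put \<open>b = c + 2 a\<close> and cut the indices into \<open>[0, a)\<close>, \<open>[a, c + a)\<close>, \<open>[c + a, b)\<close> and the rest, so that \<open>\<tau>\<close>
  exchanges the first and the third interval. The equations at positions between the intervals show
  that a kernel element \<open>x\<close> has no entries from the second to the third interval (\<open>F23\<close>), that its
  first diagonal corner is a copy of the third (\<open>F11\<close>), and that its entries from the first to the third interval are
  the commutator of that corner with \<open>\<sigma>\<close> (\<open>F13\<close>). Substituting this into the equations for the
  third interval turns them into the equations for the reduced pair, in which \<open>[c + a, b)\<close> is a block that is reversed
  by the copy of \<open>\<sigma>\<close>. So the restriction of \<open>x\<close> to \<open>[a, m)\<close> is in the kernel of the reduced pair and is scalar, and then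
  the first rows are determined.
\<close>
lemma rigid_left:
  assumes rig: "rigid A (c # a # B)"
  shows "rigid (a # A) ((c + 2 * a) # B)"
  unfolding rigid_def
proof (intro conjI allI impI)
  have sumA: "sum_list A = c + a + sum_list B" using rig by (simp add: rigid_def)
  then show "sum_list (a # A) = sum_list ((c + 2 * a) # B)" by simp
  fix x assume ker: "meander_kernel (a # A) ((c + 2 * a) # B) x"
  define m where "m = a + sum_list A"
  define b where "b = c + 2 * a"
  define \<sigma> where "\<sigma> = block_refl (a # A)"
  define \<tau> where "\<tau> = block_refl (b # B)"
  note ker' = ker[unfolded meander_kernel_def, folded b_def]
  have supp: "x i k = 0" if "i < m" "k < m" "\<not> admissible (a # A) (b # B) i k" for i k
    using ker' that unfolding m_def sum_list.Cons[symmetric] by blast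
  have eqn: "(if q < \<sigma> q then x (\<sigma> q) p else 0) + (if \<tau> q < q then x (\<tau> q) p else 0)
     - (if \<sigma> p < p then x q (\<sigma> p) else 0) - (if p < \<tau> p then x q (\<tau> p) else 0) = 0"
    if "p < m" "q < m" "admissible (a # A) (b # B) p q" for p q
  proof -
    have "meander_comm (a # A) (b # B) x q p = 0"
      using ker' that unfolding m_def sum_list.Cons[symmetric] by blast
    then show ?thesis unfolding meander_comm_def \<sigma>_def \<tau>_def .
  qed
  have bm: "b \<le> m" using sumA by (simp add: b_def m_def)
  have \<sigma>1: "\<sigma> i = a - 1 - i" if "i < a" for i using that by (simp add: \<sigma>_def)
  have \<sigma>2: "\<sigma> i = a + block_refl A (i - a)" if "a \<le> i" for i using that by (simp add: \<sigma>_def)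
  have \<sigma>m: "\<sigma> i < m" if "i < m" for i
    using block_refl_less[of i "a # A"] that by (simp add: \<sigma>_def m_def)
  have \<tau>1: "\<tau> i = b - 1 - i" if "i < b" for i using that by (simp add: \<tau>_def)
  have \<tau>2: "\<tau> i = b + block_refl B (i - b)" if "b \<le> i" for i using that by (simp add: \<tau>_def)
  have \<tau>m: "\<tau> i < m" if "i < m" for i
    using block_refl_less[of i "b # B"] that sumA by (simp add: \<tau>_def m_def b_def)
  have Z1: "x i k = 0" if "a \<le> i" "i < m" "k < a" for i k
    using that by (intro supp) (auto simp: admissible_def m_def)
  have Z2: "x i k = 0" if "i < b" "b \<le> k" "k < m" for i k
    using that bm by (intro supp) (auto simp: admissible_def m_def)
  have admB: "admissible (a # A) (b # B) p q" if "p < b" "q < b" "p < q" for p q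
    using that by (simp add: admissible_def)
  have F23: "x i k = 0" if "a \<le> i" "i < c + a" "c + a \<le> k" "k < b" for i k
  proof -
    define p where "p = b - 1 - k"
    have p: "p < a" "\<tau> p = k" "p < k" using that by (auto simp: p_def b_def \<tau>1)
    have "\<tau> i = b - 1 - i" using that by (intro \<tau>1) (auto simp: b_def)
    then have ti: "a \<le> \<tau> i" "\<tau> i < m" using that bm by (auto simp: b_def)
    have si: "a \<le> \<sigma> i" "\<sigma> i < m" using that bm \<sigma>m[of i] by (auto simp: \<sigma>2 b_def)
    have sp: "\<sigma> p < a" using p by (simp add: \<sigma>1)
    have i: "i < m" "i < b" using that bm by (auto simp: b_def)
    have "admissible (a # A) (b # B) p i" using p that i by (intro admB) (auto simp: b_def)
    from eqn[OF _ i(1) this] show ?thesis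
      using p that bm Z1[OF si p(1)] Z1[OF ti p(1)] Z1[OF that(1) i(1) sp] by (auto split: if_splits)
  qed
  have F11: "x u v = x (b - 1 - u) (b - 1 - v)" if uv: "u < a" "v < a" for u v
  proof -
    define q where "q = b - 1 - u"
    have q: "a \<le> q" "q < b" "q < m" "\<tau> q = u" "u < q" using uv bm by (auto simp: q_def b_def \<tau>1)
    have sq: "a \<le> \<sigma> q" "\<sigma> q < m" using q \<sigma>m[of q] by (auto simp: \<sigma>2)
    have tv: "\<tau> v = b - 1 - v" "v < \<tau> v" using uv by (auto simp: \<tau>1 b_def)
    have sv: "\<sigma> v < a" using uv by (simp add: \<sigma>1)
    have "admissible (a # A) (b # B) v q" using q uv by (intro admB) auto
    from eqn[OF _ q(3) this] have "x u v = x q (b - 1 - v)"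
      using q uv bm tv Z1[OF sq uv(2)] Z1[OF q(1,3) sv] by (simp split: if_splits)
    then show ?thesis by (simp only: q_def)
  qed
  have F13: "x q (b - 1 - p) = (if q < a - 1 - q then x (a - 1 - q) p else 0) - (if a - 1 - p < p then x q (a - 1 - p) else 0)"
    if "q < a" "p < a" for q p
  proof -
    have "admissible (a # A) (b # B) p q" using that by (auto simp: admissible_def b_def)
    moreover have "\<tau> q = b - 1 - q" "\<not> \<tau> q < q" "\<tau> p = b - 1 - p" "p < \<tau> p"
      using that by (auto simp: \<tau>1 b_def)
    ultimately show ?thesis using eqn[of p q] that bm by (auto simp: \<sigma>1 m_def)
  qed

  define y where "y i k = x (i + a) (k + a)" for i k
  define \<tau>' where "\<tau>' = block_refl (c # a # B)"
  have sg: "\<sigma> (i + a) = block_refl A i + a" for i by (simp add: \<sigma>2)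
  have tau_lo: "\<tau> (i + a) = \<tau>' i + a" if "i < c" for i using that by (auto simp: \<tau>1 \<tau>'_def b_def)
  have tau_hi: "\<tau> (i + a) = \<tau>' i + a" if "c + a \<le> i" for i
  proof -
    have "i + a - b = i - c - a" "\<not> i < c" "\<not> i - c < a" using that by (auto simp: b_def)
    then show ?thesis using that by (simp add: \<tau>2 \<tau>'_def b_def)
  qed
  have tau_mid: "\<tau>' i + a = 2 * c + 3 * a - 1 - (i + a)" "c \<le> \<tau>' i" "\<tau>' i < c + a"
    if "c \<le> i" "i < c + a" for i
    using that by (auto simp: \<tau>'_def)
  have adm_iff: "admissible A (c # a # B) i k \<longleftrightarrow> i = k \<or> (k < i \<and> same_block A i k) \<or>
      (i < k \<and> (k < c \<or> c \<le> i \<and> k < c + a \<or> c + a \<le> i \<and> same_block B (i - c - a) (k - c - a)))"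
    for i k by (auto simp: admissible_def)
  have adm_iff': "admissible (a # A) (b # B) (i + a) (k + a) \<longleftrightarrow> i = k \<or> (k < i \<and> same_block A i k) \<or>
      (i < k \<and> (k < c + a \<or> c + a \<le> i \<and> same_block B (i - c - a) (k - c - a)))" for i k
  proof -
    have "i + a - b = i - c - a" "k + a - b = k - c - a" by (auto simp: b_def)
    then show ?thesis by (auto simp: admissible_def b_def)
  qed
  have mA: "m = sum_list A + a" by (simp add: m_def)
  have kery: "meander_kernel A (c # a # B) y"
    unfolding meander_kernel_def
  proof (intro conjI allI impI)
    fix i k assume ik: "i < sum_list A" "k < sum_list A" and nz: "y i k \<noteq> 0"
    have "admissible (a # A) (b # B) (i + a) (k + a)"
      using supp[of "i + a" "k + a"] ik nz by (auto simp: y_def mA)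
    moreover have "\<not> (i < c \<and> c \<le> k \<and> k < c + a)"
      using F23[of "i + a" "k + a"] nz by (auto simp: y_def b_def)
    ultimately show "admissible A (c # a # B) i k" unfolding adm_iff adm_iff' by auto
  next
    fix p q assume pq: "p < sum_list A" "q < sum_list A" and adm: "admissible A (c # a # B) p q"
    have pqm: "p + a < m" "q + a < m" using pq by (auto simp: mA)
    have adm': "admissible (a # A) (b # B) (p + a) (q + a)" using adm unfolding adm_iff adm_iff' by auto
    have comm: "meander_comm A (c # a # B) y q p =
       (if q < block_refl A q then x (block_refl A q + a) (p + a) else 0) + (if \<tau>' q < q then x (\<tau>' q + a) (p + a) else 0)
     - (if block_refl A p < p then x (q + a) (block_refl A p + a) else 0) - (if p < \<tau>' p then x (q + a) (\<tau>' p + a) else 0)"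
      by (simp add: meander_comm_def y_def \<tau>'_def)
    note E = eqn[OF pqm adm', unfolded sg]
    consider "q \<notin> {c..<c+a}" "p \<notin> {c..<c+a}" | "q \<in> {c..<c+a}" "p \<notin> {c..<c+a}"
      | "q \<notin> {c..<c+a}" "p \<in> {c..<c+a}" | "q \<in> {c..<c+a}" "p \<in> {c..<c+a}" by blast
    then show "meander_comm A (c # a # B) y q p = 0"
    proof cases
      case 1
      then have "\<tau> (q + a) = \<tau>' q + a" "\<tau> (p + a) = \<tau>' p + a"
        using tau_lo tau_hi by (auto simp: not_less)
      then show ?thesis using E by (simp add: comm cong: if_cong)
    next
      case 2
      then have p: "c + a \<le> p" using adm unfolding adm_iff by auto
      have "x (\<tau>' q + a) (p + a) = 0"
        using tau_mid[of q] 2 p pqm by (intro Z2) (auto simp: b_def)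
      moreover have "x (\<tau> (q + a)) (p + a) = 0"
        using 2 p pqm by (intro Z2) (auto simp: b_def \<tau>1)
      ultimately show ?thesis using E tau_hi[OF p] by (simp add: comm cong: if_cong)
    next
      case 3
      then have q: "q < c" using adm unfolding adm_iff by auto
      have "x (q + a) (\<tau>' p + a) = 0"
        using tau_mid[of p] 3 q pqm by (intro F23) (auto simp: b_def)
      moreover have "\<not> p + a < \<tau> (p + a)"
        using 3 by (auto simp: b_def \<tau>1)
      ultimately show ?thesis using E tau_lo[OF q] by (simp add: comm cong: if_cong)
    next
      case 4
      define q1 where "q1 = b - 1 - (q + a)"
      define p1 where "p1 = b - 1 - (p + a)"
      have q1: "q1 < a" "p1 < a" "q + a = b - 1 - q1" "p + a = b - 1 - p1"
        using 4 by (auto simp: q1_def p1_def b_def)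
      have tq: "\<tau> (q + a) = q1" "\<tau> (q + a) < q + a" "\<not> p + a < \<tau> (p + a)"
        using 4 by (auto simp: \<tau>1 b_def q1_def)
      have t': "\<tau>' q + a = b - 1 - (a - 1 - q1)" "\<tau>' p + a = b - 1 - (a - 1 - p1)"
        using tau_mid(1)[of q] tau_mid(1)[of p] 4 by (auto simp: q1_def p1_def b_def)
      have l: "\<tau>' q < q \<longleftrightarrow> q1 < a - 1 - q1" "p < \<tau>' p \<longleftrightarrow> a - 1 - p1 < p1"
        using t' q1 by (auto simp: b_def)
      have "x q1 (p + a) = (if q1 < a - 1 - q1 then x (\<tau>' q + a) (p + a) else 0) - (if a - 1 - p1 < p1 then x (q + a) (\<tau>' p + a) else 0)"
        unfolding q1(4) F13[OF q1(1,2)] t' using q1 F11[of "a - 1 - q1" p1] F11[of q1 "a - 1 - p1"] by auto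
      moreover have "P + T - Q - S = 0" if "X = T - S" "P + X - Q = 0" for P Q S T X :: complex
        using that by Groebner_Basis.algebra
      ultimately show ?thesis
        using E tq unfolding comm l by (simp split del: if_split cong: if_cong)
    qed
  qed
  then obtain \<kappa> where "\<forall>i<sum_list A. \<forall>k<sum_list A. y i k = (if i = k then \<kappa> else 0)"
    using rig unfolding rigid_def by blast
  then have hi: "x i k = (if i = k then \<kappa> else 0)" if "a \<le> i" "i < m" "a \<le> k" "k < m" for i k
  proof -
    have "i - a < sum_list A" "k - a < sum_list A" using that by (auto simp: mA)
    then have "y (i - a) (k - a) = (if i - a = k - a then \<kappa> else 0)"
      using \<open>\<forall>i<sum_list A. \<forall>k<sum_list A. y i k = (if i = k then \<kappa> else 0)\<close> by blast
    then show ?thesis using that by (simp add: y_def eq_diff_iff)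
  qed
  have lo: "x u v = (if u = v then \<kappa> else 0)" if "u < a" "v < a" for u v
    unfolding F11[OF that] using that bm by (subst hi) (auto simp: b_def)
  show "\<exists>\<kappa>. \<forall>i<sum_list (a # A). \<forall>k<sum_list (a # A). x i k = (if i = k then \<kappa> else 0)"
  proof (intro exI allI impI)
    fix i k assume "i < sum_list (a # A)" "k < sum_list (a # A)"
    then have ik: "i < m" "k < m" by (auto simp: m_def)
    consider "a \<le> i" "a \<le> k" | "i < a" "k < a" | "a \<le> i" "k < a" | "i < a" "a \<le> k" "k < c + a"
      | "i < a" "c + a \<le> k" "k < b" | "i < a" "b \<le> k" by linarith
    then show "x i k = (if i = k then \<kappa> else 0)"
    proof cases
      case 4
      define q where "q = b - 1 - i"
      have q: "a \<le> q" "k < q" "q < b" "q < m" "\<tau> q = i" "i < q" using 4 bm by (auto simp: q_def b_def \<tau>1)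
      have sq: "a \<le> \<sigma> q" "\<sigma> q < m" using q \<sigma>m[of q] by (auto simp: \<sigma>2)
      have sk: "a \<le> \<sigma> k" "\<sigma> k < m" using 4 ik \<sigma>m[of k] by (auto simp: \<sigma>2)
      have tk: "a \<le> \<tau> k" "\<tau> k < c + a" "\<tau> k < q" using 4 by (auto simp: \<tau>1 b_def q_def)
      have "admissible (a # A) (b # B) k q" using 4 q by (intro admB) (auto simp: b_def)
      from eqn[OF ik(2) q(4) this]
      have "x i k = 0"
        using q 4 ik sq sk tk bm by (auto simp: hi split: if_splits)
      then show ?thesis using 4 by simp
    next
      case 5
      define p where "p = b - 1 - k"
      have p: "p < a" "k = b - 1 - p" using 5 by (auto simp: p_def b_def)
      have "x i k = 0"
        unfolding p(2) F13[OF 5(1) p(1)] using 5 p by (auto simp: lo)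
      then show ?thesis using 5 by simp
    qed (use ik hi lo Z1 Z2[of i k] in \<open>auto simp: b_def\<close>)
  qed
qed


lemma admissible_commute: "admissible B A k i \<longleftrightarrow> admissible A B i k"
  by (auto simp: admissible_def same_block_commute)

text \<open>
  Transposition exchanges the two compositions and changes the sign of the commutator.
\<close>
lemma rigid_commute:
  assumes "rigid A B"
  shows "rigid B A"
  unfolding rigid_def
proof (intro conjI allI impI)
  show S: "sum_list B = sum_list A" using assms by (simp add: rigid_def)
  fix x assume ker: "meander_kernel B A x"
  have "meander_comm A B (\<lambda>i k. x k i) q p = - meander_comm B A x p q" for p q
    by (simp add: meander_comm_def)
  then have "meander_kernel A B (\<lambda>i k. x k i)"
    using ker unfolding meander_kernel_def S admissible_commute[of B A] by auto
  then obtain c where "\<forall>i<sum_list A. \<forall>k<sum_list A. x k i = (if i = k then c else 0)"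
    using assms unfolding rigid_def by blast
  then show "\<exists>c. \<forall>i<sum_list B. \<forall>k<sum_list B. x i k = (if i = k then c else 0)"
    unfolding S by (intro exI[of _ c]) auto
qed

text \<open>
  Reflection at the antidiagonal keeps lower positions lower and reverses both compositions.
\<close>
lemma rigid_rev:
  assumes "rigid A B"
  shows "rigid (rev A) (rev B)"
  unfolding rigid_def
proof (intro conjI allI impI)
  define m where "m = sum_list A"
  have B: "sum_list B = m" using assms by (simp add: rigid_def m_def)
  have rA: "sum_list (rev A) = m" by (simp add: m_def sum_list_rev)
  show "sum_list (rev A) = sum_list (rev B)" using B by (simp add: m_def sum_list_rev)
  fix x assume ker: "meander_kernel (rev A) (rev B) x"
  define \<rho> where "\<rho> i = m - 1 - i" for i
  have \<rho>: "\<rho> i < m" "\<rho> (\<rho> i) = i" if "i < m" for i using that by (auto simp: \<rho>_def)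
  have \<rho>_less: "\<rho> i < \<rho> k \<longleftrightarrow> k < i" if "i < m" "k < m" for i k using that by (auto simp: \<rho>_def)
  define y where "y i k = x (\<rho> k) (\<rho> i)" for i k
  have adm: "admissible (rev A) (rev B) (\<rho> k) (\<rho> i) \<longleftrightarrow> admissible A B i k" if "i < m" "k < m" for i k
  proof -
    have "\<rho> i = \<rho> k \<longleftrightarrow> i = k" using \<rho>(2) that by metis
    moreover have "same_block (rev A) (\<rho> k) (\<rho> i) = same_block A k i"
      "same_block (rev B) (\<rho> k) (\<rho> i) = same_block B k i"
      using that \<rho> same_block_rev[of "\<rho> k" A "\<rho> i"] same_block_rev[of "\<rho> k" B "\<rho> i"]
      by (simp_all only: m_def[symmetric] B \<rho>_def[symmetric])
    ultimately show ?thesis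
      using that by (auto simp: admissible_def \<rho>_less same_block_commute)
  qed
  have refl: "block_refl (rev A) (\<rho> i) = \<rho> (block_refl A i)" "block_refl (rev B) (\<rho> i) = \<rho> (block_refl B i)"
    "block_refl A i < m" "block_refl B i < m" if "i < m" for i
    using that \<rho>[OF that] block_refl_rev[of "\<rho> i" A] block_refl_rev[of "\<rho> i" B]
      block_refl_less[of i A] block_refl_less[of i B]
    by (simp_all only: m_def[symmetric] B \<rho>_def[symmetric])
  have comm: "meander_comm A B y q p = - meander_comm (rev A) (rev B) x (\<rho> p) (\<rho> q)" if "p < m" "q < m" for p q
    using that refl[OF that(1)] refl[OF that(2)] by (simp add: meander_comm_def y_def \<rho>_less)
  have "meander_kernel A B y"
    unfolding meander_kernel_def m_def[symmetric]
  proof (intro conjI allI impI)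
    fix i k assume ik: "i < m" "k < m" and "y i k \<noteq> 0"
    then have "x (\<rho> k) (\<rho> i) \<noteq> 0" by (simp add: y_def)
    then have "admissible (rev A) (rev B) (\<rho> k) (\<rho> i)"
      using ker \<rho>(1)[OF ik(1)] \<rho>(1)[OF ik(2)] unfolding meander_kernel_def rA by blast
    then show "admissible A B i k" using adm ik by simp
  next
    fix p q assume pq: "p < m" "q < m" and "admissible A B p q"
    then have "admissible (rev A) (rev B) (\<rho> q) (\<rho> p)" using adm by simp
    then have "meander_comm (rev A) (rev B) x (\<rho> p) (\<rho> q) = 0"
      using ker \<rho>(1)[OF pq(1)] \<rho>(1)[OF pq(2)] unfolding meander_kernel_def rA by blast
    then show "meander_comm A B y q p = 0" using comm pq by simp
  qed
  then obtain c where c: "\<forall>i<m. \<forall>k<m. y i k = (if i = k then c else 0)"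
    using assms unfolding rigid_def m_def by blast
  have "x i k = (if i = k then c else 0)" if "i < m" "k < m" for i k
  proof -
    have "x i k = y (\<rho> k) (\<rho> i)" using that \<rho> by (simp add: y_def)
    also have "\<dots> = (if \<rho> k = \<rho> i then c else 0)" using c \<rho>(1)[OF that(1)] \<rho>(1)[OF that(2)] by blast
    also have "\<rho> k = \<rho> i \<longleftrightarrow> i = k" using \<rho>(2) that by metis
    finally show ?thesis .
  qed
  then show "\<exists>c. \<forall>i<sum_list (rev A). \<forall>k<sum_list (rev A). x i k = (if i = k then c else 0)"
    unfolding rA by blast
qed

lemma rigid_right:
  assumes "rigid A (B @ [a, c])"
  shows "rigid (A @ [a]) (B @ [c + 2 * a])"
  using rigid_rev[OF rigid_left[of "rev A" c a "rev B"]] rigid_rev[OF assms] by simp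

lemma rigid_right':
  assumes "rigid (A @ [a, c]) B"
  shows "rigid (A @ [c + 2 * a]) (B @ [a])"
  using rigid_commute[OF rigid_right[OF rigid_commute[OF assms]]] .

lemma rigid_cong:
  assumes "sum_list A' = sum_list A" "same_block A' = same_block A" "block_refl A' = block_refl A" "rigid A B"
  shows "rigid A' B"
  using assms(4) unfolding rigid_def meander_kernel_def meander_comm_def admissible_def assms(1-3) .

lemma rigid_drop_zero:
  assumes "rigid (A @ C) B"
  shows "rigid (A @ 0 # C) B"
  by (rule rigid_cong[OF _ _ _ assms]) (simp_all add: fun_eq_iff same_block_append block_refl_append)

lemma rigid_one: "rigid [1] [1]"
  by (auto simp: rigid_def)

text \<open>
  Two reductions take \<open>(k | k - 1, 1)\<close> to \<open>(k - 2 | k - 3, 1)\<close>.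
\<close>
lemma rigid_staircase: "k > 0 \<Longrightarrow> rigid [k] [k - 1, 1]"
proof (induction k rule: less_induct)
  case (less k)
  consider "k = 1" | "k = 2" | "k \<ge> 3" using less.prems by linarith
  then show ?case
  proof cases
    case 1
    then show ?thesis using rigid_commute[OF rigid_drop_zero[of "[]" "[1]" "[1]"]] rigid_one by simp
  next
    case 2
    have "rigid [1, 0] [1]" using rigid_drop_zero[of "[1]" "[]" "[1]"] rigid_one by simp
    then show ?thesis using rigid_right'[of "[]" 1 0 "[1]"] 2 by (simp add: numeral_2_eq_2)
  next
    case 3
    define l where "l = k - 3"
    have k: "k = l + 3" using 3 by (simp add: l_def)
    have "rigid [l + 1] [l, 1]" using less.IH[of "l + 1"] k by simp
    then have "rigid [1, l + 1] [l + 2 * 1]" by (rule rigid_left)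
    then have "rigid ([] @ [(l + 1) + 2 * 1]) ([l + 2] @ [1])" by - (rule rigid_right', simp)
    then show ?thesis by (simp add: k numeral_3_eq_3)
  qed
qed

text \<open>
  Four reductions, two at the right end and then two at the left end, take \<open>(m | m - t, t - 1, 1)\<close> to
  \<open>(m - 2 t | m - 3 t, t - 1, 1)\<close>. The parity of \<open>m / t\<close> is kept, whence the two chains, which end in the
  staircase \<open>(t | t - 1, 1)\<close> and in \<open>(2 t | t, t - 1, 1)\<close>.
\<close>
lemma rigid_core:
  assumes "t > 0"
  shows "rigid [t + 2 * t * k] [2 * t * k, t - 1, 1]" and "rigid [2 * t * Suc k] [t + 2 * t * k, t - 1, 1]"
proof -
  obtain s where t: "t = Suc s" using assms by (cases t) auto
  have step: "rigid [u + 2 * t] [v + 2 * t, t - 1, 1]" if "rigid [u] [v, t - 1, 1]" for u v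
  proof -
    have "rigid ([t - 1] @ [u]) ([(v + 2 * (t - 1))] @ [1])"
      using rigid_left[OF that] by simp
    then have "rigid (1 # [t - 1, u]) [(v + 2 * (t - 1)) + 2 * 1]"
      by - (rule rigid_left, simp)
    then have "rigid ([1] @ [u + 2 * (t - 1)]) ([v + 2 * t] @ [t - 1])"
      using rigid_right'[of "[1]" "t - 1" u "[v + 2 * t]"] t by (simp add: algebra_simps)
    then have "rigid ([] @ [(u + 2 * (t - 1)) + 2 * 1]) ([v + 2 * t, t - 1] @ [1])"
      by - (rule rigid_right', simp)
    then show ?thesis using t by (simp add: algebra_simps)
  qed
  have base: "rigid [t] [0, t - 1, 1]"
    using rigid_commute[OF rigid_drop_zero[of "[]" "[t - 1, 1]" "[t]"]] rigid_commute[OF rigid_staircase[OF assms]]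
    by simp
  have base': "rigid [2 * t] [t, t - 1, 1]"
  proof (cases "s = 0")
    case True
    have "rigid [1, 0] [1]" using rigid_drop_zero[of "[1]" "[]" "[1]"] rigid_one by simp
    then have "rigid [2] [1, 1]" using rigid_right'[of "[]" 1 0 "[1]"] by (simp add: numeral_2_eq_2)
    then show ?thesis
      using rigid_commute[OF rigid_drop_zero[of "[1]" "[1]" "[2]"]] rigid_commute[of "[2]" "[1,1]"] True
      by (simp add: t)
  next
    case False
    then obtain s' where s: "s = Suc s'" by (cases s) auto
    have "rigid [s] [s', 1]" using rigid_staircase[of s] s by simp
    then have "rigid [1, s] [s' + 2 * 1]" by (rule rigid_left)
    then have "rigid ([1] @ [s, 0]) [t]"
      using rigid_drop_zero[of "[1, s]" "[]" "[t]"] by (simp add: t s)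
    then have "rigid ([1] @ [0 + 2 * s]) ([t] @ [s])" by (rule rigid_right')
    then have "rigid ([] @ [2 * s + 2 * 1]) ([t, s] @ [1])" by - (rule rigid_right', simp)
    then show ?thesis by (simp add: t)
  qed
  show "rigid [t + 2 * t * k] [2 * t * k, t - 1, 1]"
  proof (induction k)
    case (Suc k)
    have "t + 2 * t * k + 2 * t = t + 2 * t * Suc k" "2 * t * k + 2 * t = 2 * t * Suc k" by auto
    then show ?case using step[OF Suc.IH] by (simp only:)
  qed (use base in simp)
  show "rigid [2 * t * Suc k] [t + 2 * t * k, t - 1, 1]"
  proof (induction k)
    case (Suc k)
    have "2 * t * Suc k + 2 * t = 2 * t * Suc (Suc k)" "t + 2 * t * k + 2 * t = t + 2 * t * Suc k" by auto
    then show ?case using step[OF Suc.IH] by (simp only:)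
  qed (use base' in simp)
qed

lemma rigid_square:
  assumes "t > 0"
  shows "rigid [t\<^sup>2] [t * (t - 1), t - 1, 1]"
proof (cases "even t")
  case True
  then obtain k where "t = 2 * k" by (rule evenE)
  then obtain k' where k: "t = 2 * Suc k'" using assms by (cases k) auto
  have "2 * t * Suc k' = t\<^sup>2" "t + 2 * t * k' = t * (t - 1)" by (auto simp: k power2_eq_square algebra_simps)
  then show ?thesis using rigid_core(2)[OF assms, of k'] by (simp only:)
next
  case False
  then obtain k where k: "t = 2 * k + 1" by (rule oddE)
  have "t + 2 * t * k = t\<^sup>2" "2 * t * k = t * (t - 1)" by (auto simp: k power2_eq_square algebra_simps)
  then show ?thesis using rigid_core(1)[OF assms, of k] by (simp only:)
qed

text \<open>
  The parts equal to 2 unwind from the single part 1: two reductions at the right end remove one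
  such part from each composition.
\<close>
lemma rigid_twos:
  assumes "rigid [u] (B @ [1])"
  shows "rigid ([u] @ replicate k 2) (B @ replicate k 2 @ [1])"
proof (induction k)
  case 0
  then show ?case using assms by simp
next
  case (Suc k)
  have "rigid (([u] @ replicate k 2) @ [1]) ((B @ replicate k 2) @ [0 + 2 * 1])"
    by (rule rigid_right) (use Suc rigid_commute[OF rigid_drop_zero[of "B @ replicate k 2 @ [1]" "[]"]] rigid_commute in simp)
  then have "rigid ((([u] @ replicate k 2) @ [1, 0])) (B @ replicate (Suc k) 2)"
    using rigid_drop_zero[of "[u] @ replicate k 2 @ [1]" "[]"] by (simp add: numeral_2_eq_2 replicate_append_same)
  then have "rigid (([u] @ replicate k 2) @ [0 + 2 * 1]) ((B @ replicate (Suc k) 2) @ [1])" by (rule rigid_right')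
  then show ?case by (simp add: numeral_2_eq_2 replicate_append_same)
qed

text \<open>
  Each reduction at the right end removes one part 2 from below and splits one off the large upper part.
\<close>
lemma rigid_spiral:
  assumes "rigid ([u] @ replicate r 2) (B @ replicate r 2 @ [1])" "k \<le> r"
  shows "rigid ([u] @ replicate (r - k) 2 @ [4 * k]) (B @ replicate r 2 @ [1] @ replicate k 2)"
  using assms(2)
proof (induction k)
  case 0
  then show ?case using assms(1) rigid_drop_zero[of "[u] @ replicate r 2" "[]"] by simp
next
  case (Suc k)
  have "r - k = Suc (r - Suc k)" using Suc.prems by simp
  then have "rigid (([u] @ replicate (r - Suc k) 2) @ [2, 4 * k]) (B @ replicate r 2 @ [1] @ replicate k 2)"
    using Suc by (simp add: replicate_append_same[symmetric])
  then have "rigid (([u] @ replicate (r - Suc k) 2) @ [4 * k + 2 * 2]) ((B @ replicate r 2 @ [1] @ replicate k 2) @ [2])"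
    by (rule rigid_right')
  then show ?case by (simp add: replicate_append_same add.commute)
qed

theorem rigid_pttr:
  assumes "t > 0"
  shows "rigid [2 * t\<^sup>2 + 4 * r] ([t * (t - 1), t - 1] @ replicate r 2 @ [1] @ replicate r 2 @ [t\<^sup>2])"
proof -
  have "rigid ([t\<^sup>2] @ replicate r 2) ([t * (t - 1), t - 1] @ replicate r 2 @ [1])"
    by (rule rigid_twos) (use rigid_square[OF assms] in simp)
  from rigid_spiral[OF this, of r]
  have "rigid ([] @ [t\<^sup>2, 4 * r]) ([t * (t - 1), t - 1] @ replicate r 2 @ [1] @ replicate r 2)" by simp
  from rigid_right'[OF this] show ?thesis by (simp add: algebra_simps)
qed

section \<open>Pairs of positions with a given height difference\<close>

lemma same_block_trans:
  "same_block A i k \<Longrightarrow> same_block A k l \<Longrightarrow> same_block A i l"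
  by (induction A arbitrary: i k l) (auto split: if_splits)

definition ascending_pairs :: "nat list \<Rightarrow> (nat \<Rightarrow> int) \<Rightarrow> int \<Rightarrow> (nat \<times> nat) set" where
  "ascending_pairs A h j = {(i, k). i < k \<and> k < sum_list A \<and> same_block A i k \<and> h i - h k = j}"

definition block_pairs :: "nat list \<Rightarrow> (nat \<Rightarrow> int) \<Rightarrow> int \<Rightarrow> (nat \<times> nat) set" where
  "block_pairs A h j = {(i, k). i < sum_list A \<and> k < sum_list A \<and> same_block A i k \<and> h i - h k = j}"

lemma finite_ascending_pairs: "finite (ascending_pairs A h j)"
  by (rule finite_subset[of _ "{..<sum_list A} \<times> {..<sum_list A}"]) (auto simp: ascending_pairs_def)

text \<open>
  Pairs with \<open>k < i\<close> and difference \<open>j\<close> correspond to pairs with \<open>i < k\<close> and difference \<open>j + 1\<close>: reflect one of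
  the two members, namely the one that is farther from the centre of its block. It is either a
  right member \<open>i\<close>, and reflection increases its height, or a left member \<open>k\<close>, and reflection decreases its height. The
  excluded case \<open>i = \<tau> k\<close> has difference \<open>- 1\<close>.
\<close>
lemma card_ascending_pairs_recurrence:
  assumes edge: "\<And>i. i < sum_list A \<Longrightarrow> i < block_refl A i \<Longrightarrow> h i - h (block_refl A i) = 1"
    and j: "j \<ge> 1"
  shows "card (ascending_pairs A h j) + card (ascending_pairs A h (j + 1)) = card (block_pairs A h j)"
proof -
  define m where "m = sum_list A"
  define \<tau> where "\<tau> = block_refl A"
  define D where "D = {(i, k). k < i \<and> i < m \<and> same_block A i k \<and> h i - h k = j}"
  have \<tau>: "\<tau> i < m" "\<tau> (\<tau> i) = i" "same_block A i (\<tau> i)" "same_block A (\<tau> i) i" if "i < m" for i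
    using that block_refl_less[of i A] block_refl_invol[of i A] same_block_block_refl[of i A]
    by (auto simp: \<tau>_def m_def same_block_commute)
  have anti: "\<tau> i < \<tau> k \<longleftrightarrow> k < i" if "i < m" "k < m" "same_block A i k" for i k
    using that block_refl_antimono[of A i k] by (simp add: \<tau>_def m_def)
  have up: "h i = h (\<tau> i) + 1" if "i < m" "i < \<tau> i" for i
    using edge[of i] that by (simp add: \<tau>_def m_def)
  have down: "h (\<tau> i) = h i + 1" if "i < m" "\<tau> i < i" for i
    using up[of "\<tau> i"] that \<tau>[of i] by simp
  have sb: "same_block A (\<tau> i) k" "same_block A i (\<tau> k)" if "i < m" "k < m" "same_block A i k" for i k
    using that \<tau> same_block_trans by blast+
  have bij: "bij_betw (\<lambda>(i, k). if \<tau> k < i then (\<tau> i, k) else (i, \<tau> k)) D (ascending_pairs A h (j + 1))"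
  proof (rule bij_betw_byWitness[where f' = "\<lambda>(u, v). if v < \<tau> u then (\<tau> u, v) else (u, \<tau> v)"])
    show "\<forall>x\<in>D. (case case x of (i, k) \<Rightarrow> if \<tau> k < i then (\<tau> i, k) else (i, \<tau> k) of
        (u, v) \<Rightarrow> if v < \<tau> u then (\<tau> u, v) else (u, \<tau> v)) = x"
    proof (clarify)
      fix i k assume "(i, k) \<in> D"
      then have D: "k < i" "i < m" "k < m" "same_block A i k" by (auto simp: D_def)
      show "(case if \<tau> k < i then (\<tau> i, k) else (i, \<tau> k) of (u, v) \<Rightarrow> if v < \<tau> u then (\<tau> u, v) else (u, \<tau> v)) = (i, k)"
        using D \<tau> anti[of i k] anti[of "\<tau> k" i] sb[OF D(2-4)] by (auto simp: same_block_commute)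
    qed
    show "\<forall>x\<in>ascending_pairs A h (j + 1). (case case x of (u, v) \<Rightarrow> if v < \<tau> u then (\<tau> u, v) else (u, \<tau> v) of
        (i, k) \<Rightarrow> if \<tau> k < i then (\<tau> i, k) else (i, \<tau> k)) = x"
    proof (clarify)
      fix u v assume "(u, v) \<in> ascending_pairs A h (j + 1)"
      then have D: "u < v" "u < m" "v < m" "same_block A u v" by (auto simp: ascending_pairs_def m_def)
      show "(case if v < \<tau> u then (\<tau> u, v) else (u, \<tau> v) of (i, k) \<Rightarrow> if \<tau> k < i then (\<tau> i, k) else (i, \<tau> k)) = (u, v)"
        using D \<tau> anti[of v u] same_block_commute[of A u v] by auto
    qed
    show "(\<lambda>(i, k). if \<tau> k < i then (\<tau> i, k) else (i, \<tau> k)) ` D \<subseteq> ascending_pairs A h (j + 1)"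
    proof (clarify)
      fix u v i k assume "(i, k) \<in> D" and eq: "(u, v) = (if \<tau> k < i then (\<tau> i, k) else (i, \<tau> k))"
      then have D: "k < i" "i < m" "k < m" "same_block A i k" "h i - h k = j" by (auto simp: D_def)
      show "(u, v) \<in> ascending_pairs A h (j + 1)"
      proof (cases "\<tau> k < i")
        case True
        have "\<tau> i < k" using anti[of i "\<tau> k"] True D \<tau> sb by auto
        then show ?thesis
          using True eq D sb down[of i] by (auto simp: ascending_pairs_def m_def[symmetric])
      next
        case False
        have "h (\<tau> k) = h k - 1" using up[of k] False D by auto
        moreover have "i \<noteq> \<tau> k" using \<open>h (\<tau> k) = h k - 1\<close> D j by auto
        ultimately show ?thesis
          using False eq D sb \<tau> by (auto simp: ascending_pairs_def m_def[symmetric])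
      qed
    qed
    show "(\<lambda>(u, v). if v < \<tau> u then (\<tau> u, v) else (u, \<tau> v)) ` ascending_pairs A h (j + 1) \<subseteq> D"
    proof (clarify)
      fix i k u v assume "(u, v) \<in> ascending_pairs A h (j + 1)" and eq: "(i, k) = (if v < \<tau> u then (\<tau> u, v) else (u, \<tau> v))"
      then have D: "u < v" "u < m" "v < m" "same_block A u v" "h u - h v = j + 1"
        by (auto simp: ascending_pairs_def m_def)
      show "(i, k) \<in> D"
      proof (cases "v < \<tau> u")
        case True
        then have "h u = h (\<tau> u) + 1" using up[of u] D by auto
        then show ?thesis using True eq D sb \<tau> by (auto simp: D_def)
      next
        case False
        have "\<tau> u \<noteq> v" using up[of u] D j by auto
        then have lt: "\<tau> u < v" using False by auto
        then have "\<tau> v < u" using anti[of v "\<tau> u"] D \<tau> sb same_block_commute by metis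
        moreover from this have "h (\<tau> v) = h v + 1" using down[of v] D by auto
        ultimately show ?thesis using False eq D sb by (auto simp: D_def)
      qed
    qed
  qed
  have "block_pairs A h j = ascending_pairs A h j \<union> D"
    using j by (auto simp: block_pairs_def ascending_pairs_def D_def m_def) (metis diff_self linorder_neqE_nat not_one_le_zero)
  moreover have "ascending_pairs A h j \<inter> D = {}" by (auto simp: ascending_pairs_def D_def)
  moreover have "finite D" using bij bij_betw_finite finite_ascending_pairs by blast
  ultimately have "card (block_pairs A h j) = card (ascending_pairs A h j) + card D"
    using finite_ascending_pairs by (simp add: card_Un_disjoint)
  then show ?thesis using bij_betw_same_card[OF bij] by simp
qed

section \<open>Heights on the meander graph\<close>

text \<open>
  The distance from the end \<open>t - 1\<close> in the path \<open>t - 1, 0, t - 2, 1, \<dots>\<close> that runs alternately through the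
  reversal of \<open>t\<close> and that of \<open>t - 1\<close> points.
\<close>
definition zigzag :: "nat \<Rightarrow> nat \<Rightarrow> nat" where
  "zigzag t q = (if 2 * q + 1 < t then 2 * q + 1 else 2 * (t - 1 - q))"

text \<open>
  Writing \<open>i = p t + q\<close> arranges the first \<open>t\<^sup>2\<close> points in \<open>t\<close> rows. The rows are visited in the zigzag order,
  and each row is a zigzag again, read backwards in the rows that come from the left.
\<close>
definition core_height :: "nat \<Rightarrow> nat \<Rightarrow> int" where
  "core_height t i = - int (zigzag t (i div t)) -
     int (if 2 * (i div t) + 1 < t then zigzag t (t - 1 - i mod t) else zigzag t (i mod t))"

text \<open>
  The index \<open>c\<close> is the part 1 of the lower composition, the start of the spiral through the parts 2.
  Along this spiral the height alternates between two neighbouring values on either side of \<open>c\<close>. The last \<open>t\<^sup>2\<close> points are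
  the partners of the first ones. The normalisation is height 0 at \<open>c\<close>.
\<close>
definition height :: "nat \<Rightarrow> nat \<Rightarrow> nat \<Rightarrow> int" where
  "height t r i =
     (let c = t\<^sup>2 - 1 + 2 * r in
      if i < t\<^sup>2 then core_height t i
      else if i \<le> c then - int ((c - i) mod 2)
      else if i < t\<^sup>2 + 4 * r then int ((i - c) mod 2)
      else core_height t (2 * t\<^sup>2 + 4 * r - 1 - i) + 1)"

lemma core_height_pq:
  assumes "q < t"
  shows "core_height t (p * t + q) = - int (zigzag t p) - int (if 2 * p + 1 < t then zigzag t (t - 1 - q) else zigzag t q)"
  using assms by (simp add: core_height_def)

lemma pq_cases:
  assumes "i < s * t"
  obtains p q where "i = p * t + q" "p < s" "q < (t::nat)"
proof (rule that)
  show "i = (i div t) * t + i mod t" by simp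
  show "i div t < s" using assms by (simp add: less_mult_imp_div_less)
  show "i mod t < t" using assms by (cases "t = 0") auto
qed

lemma zigzag_step: "2 * q + 1 < t \<Longrightarrow> int (zigzag t q) - int (zigzag t (t - 1 - q)) = 1"
  by (auto simp: zigzag_def)

lemma zigzag_step': "2 * q + 2 < t \<Longrightarrow> int (zigzag t (t - 2 - q)) - int (zigzag t q) = 1"
  by (auto simp: zigzag_def)

lemma core_height_edge_square:
  assumes "i < t\<^sup>2" "i < t\<^sup>2 - 1 - i"
  shows "core_height t (t\<^sup>2 - 1 - i) - core_height t i = 1"
proof -
  obtain p q where pq: "i = p * t + q" "p < t" "q < t"
    using pq_cases[of i t t] assms by (auto simp: power2_eq_square)
  obtain p' where p': "t = p + 1 + p'" using pq(2) by (metis add.commute less_iff_Suc_add add_Suc_right plus_1_eq_Suc)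
  have refl: "t\<^sup>2 - 1 - i = p' * t + (t - 1 - q)"
  proof -
    have "t\<^sup>2 = p * t + t + p' * t" using p' by (simp add: power2_eq_square algebra_simps)
    then show ?thesis using pq by simp
  qed
  have le: "p < p' \<or> (p = p' \<and> q < t - 1 - q)"
  proof (rule ccontr)
    assume "\<not> ?thesis"
    then consider "p' < p" | "p = p'" "t - 1 - q \<le> q" by linarith
    then show False
    proof cases
      case 1
      then have "(p' + 1) * t \<le> p * t" by (intro mult_right_mono) auto
      then show False using assms(2) refl pq by (simp add: algebra_simps)
    next
      case 2
      then show False using assms(2) refl pq by simp
    qed
  qed
  show ?thesis
  proof (cases "p < p'")
    case True
    then have lo: "2 * p + 1 < t" and hi: "\<not> 2 * p' + 1 < t" "t - 1 - p' = p" and q': "t - 1 - q < t"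
      using p' pq(3) by auto
    have "t - 1 - (t - 1 - q) = q" using pq(3) by auto
    then show ?thesis
      using lo hi unfolding refl unfolding pq(1) core_height_pq[OF pq(3)] core_height_pq[OF q']
      by (simp add: zigzag_def[of t p] zigzag_def[of t p'])
  next
    case False
    then have "p = p'" "q < t - 1 - q" using le by auto
    then have lo: "2 * q + 1 < t" "\<not> 2 * p + 1 < t" and q': "t - 1 - q < t" using p' by auto
    have "t - 1 - (t - 1 - q) = q" using pq(3) by auto
    then show ?thesis
      using lo zigzag_step[of q t] unfolding refl \<open>p = p'\<close>[symmetric] unfolding pq(1)
      by (simp only: core_height_pq[OF pq(3)] core_height_pq[OF q'] if_True if_False) simp
  qed
qed

lemma core_height_edge_first:
  assumes "i < t * (t - 1)" "i < t * (t - 1) - 1 - i"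
  shows "core_height t i - core_height t (t * (t - 1) - 1 - i) = 1"
proof -
  obtain p q where pq: "i = p * t + q" "p < t - 1" "q < t"
    using pq_cases[of i "t - 1" t] assms by (auto simp: mult.commute)
  obtain p' where p': "t = p + 2 + p'" using pq(2) by (metis add.commute less_diff_conv less_iff_Suc_add add_Suc_right add_2_eq_Suc add_2_eq_Suc' plus_1_eq_Suc)
  have refl: "t * (t - 1) - 1 - i = p' * t + (t - 1 - q)"
  proof -
    have "t * (t - 1) = p * t + t + p' * t" using p' by (simp add: algebra_simps)
    then show ?thesis using pq by simp
  qed
  have le: "p < p' \<or> (p = p' \<and> q < t - 1 - q)"
  proof (rule ccontr)
    assume "\<not> ?thesis"
    then consider "p' < p" | "p = p'" "t - 1 - q \<le> q" by linarith
    then show False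
    proof cases
      case 1
      then have "(p' + 1) * t \<le> p * t" by (intro mult_right_mono) auto
      then show False using assms(2) refl pq by (simp add: algebra_simps)
    next
      case 2
      then show False using assms(2) refl pq by simp
    qed
  qed
  show ?thesis
  proof (cases "p < p'")
    case True
    then have lo: "2 * p + 1 < t" and hi: "\<not> 2 * p' + 1 < t" "t - 1 - p' = p + 1" and q': "t - 1 - q < t"
      using p' pq(3) by auto
    have "t - 1 - (t - 1 - q) = q" using pq(3) by auto
    then show ?thesis
      using lo hi unfolding refl unfolding pq(1) core_height_pq[OF pq(3)] core_height_pq[OF q']
      by (simp add: zigzag_def[of t p] zigzag_def[of t p'])
  next
    case False
    then have "p = p'" "q < t - 1 - q" using le by auto
    then have lo: "2 * q + 1 < t" "2 * p + 1 < t" and q': "t - 1 - q < t" using p' by auto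
    have "t - 1 - (t - 1 - q) = q" using pq(3) by auto
    then show ?thesis
      using lo zigzag_step[of q t] unfolding refl \<open>p = p'\<close>[symmetric] unfolding pq(1)
      by (simp only: core_height_pq[OF pq(3)] core_height_pq[OF q'] if_True if_False) simp
  qed
qed

lemma core_height_last_row:
  assumes "q < t"
  shows "core_height t (t * (t - 1) + q) = - int (zigzag t q)"
proof -
  have "\<not> 2 * (t - 1) + 1 < t" using assms by arith
  then show ?thesis using core_height_pq[OF assms, of "t - 1"] by (simp add: zigzag_def mult.commute)
qed

lemma core_height_edge_second:
  assumes "q < t - 1" "q < t - 2 - q"
  shows "core_height t (t * (t - 1) + q) - core_height t (t * (t - 1) + (t - 2 - q)) = 1"
proof -
  have "q < t" "t - 2 - q < t" "2 * q + 2 < t" using assms by auto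
  then show ?thesis
    using zigzag_step'[of q t] by (simp only: core_height_last_row) simp
qed


lemma height_core: "i < t\<^sup>2 \<Longrightarrow> height t r i = core_height t i"
  by (simp add: height_def)

lemma core_height_top: "t > 0 \<Longrightarrow> core_height t (t\<^sup>2 - 1) = 0"
proof -
  assume "t > 0"
  moreover from this have "t\<^sup>2 - 1 = t * (t - 1) + (t - 1)"
    by (cases t) (auto simp: power2_eq_square)
  ultimately show ?thesis using core_height_last_row[of "t - 1" t] by (simp add: zigzag_def) arith
qed

lemma height_mid_down: "t > 0 \<Longrightarrow> e \<le> 2 * r \<Longrightarrow> height t r (t\<^sup>2 - 1 + e) = - int (e mod 2)"
proof -
  assume t: "t > 0" and e: "e \<le> 2 * r"
  show ?thesis
  proof (cases "e = 0")
    case True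
    then show ?thesis using t core_height_top[OF t] by (simp add: height_core)
  next
    case False
    have "t\<^sup>2 > 0" using t by simp
    have "(t\<^sup>2 - 1 + 2 * r - (t\<^sup>2 - 1 + e)) = 2 * r - e" by simp
    moreover have "(2 * r - e) mod 2 = e mod 2" using e by (simp add: mod2_eq_if)
    moreover have "\<not> t\<^sup>2 - 1 + e < t\<^sup>2" "t\<^sup>2 - 1 + e \<le> t\<^sup>2 - 1 + 2 * r"
      using False e \<open>t\<^sup>2 > 0\<close> by linarith+
    ultimately show ?thesis by (simp only: height_def Let_def if_True if_False)
  qed
qed

lemma height_mid_up: "t > 0 \<Longrightarrow> e < 2 * r \<Longrightarrow> height t r (t\<^sup>2 + 2 * r + e) = int (Suc e mod 2)"
proof -
  assume t: "t > 0" and e: "e < 2 * r"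
  have "t\<^sup>2 > 0" using t by simp
  moreover from this have "t\<^sup>2 + 2 * r + e - (t\<^sup>2 - 1 + 2 * r) = Suc e" by linarith
  ultimately show ?thesis using e by (simp add: height_def Let_def)
qed

lemma height_last: "e < t\<^sup>2 \<Longrightarrow> height t r (t\<^sup>2 + 4 * r + e) = core_height t (t\<^sup>2 - 1 - e) + 1"
proof -
  assume e: "e < t\<^sup>2"
  have "2 * t\<^sup>2 + 4 * r - 1 - (t\<^sup>2 + 4 * r + e) = t\<^sup>2 - 1 - e" by simp
  moreover have "\<not> t\<^sup>2 + 4 * r + e \<le> t\<^sup>2 - 1 + 2 * r" using e by linarith
  ultimately show ?thesis using e by (simp add: height_def Let_def)
qed

lemma height_edge_top:
  assumes t: "t > 0" and i: "i < 2 * t\<^sup>2 + 4 * r - 1 - i"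
  shows "height t r (2 * t\<^sup>2 + 4 * r - 1 - i) - height t r i = 1"
proof (cases "i < t\<^sup>2")
  case True
  have "2 * t\<^sup>2 + 4 * r - 1 - i = t\<^sup>2 + 4 * r + (t\<^sup>2 - 1 - i)" using True by simp
  moreover have "t\<^sup>2 - 1 - (t\<^sup>2 - 1 - i) = i" "t\<^sup>2 - 1 - i < t\<^sup>2" using True by auto
  ultimately show ?thesis using True height_last[of "t\<^sup>2 - 1 - i" t r] by (simp only: height_core)
next
  case False
  have t2: "t\<^sup>2 > 0" using t by simp
  define e where "e = i - (t\<^sup>2 - 1)"
  have e: "i = t\<^sup>2 - 1 + e" "1 \<le> e" "e \<le> 2 * r" using False i t2 by (auto simp: e_def)
  have i': "2 * t\<^sup>2 + 4 * r - 1 - i = t\<^sup>2 + 2 * r + (2 * r - e)" using e t2 by simp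
  have "Suc (2 * r - e) mod 2 + e mod 2 = 1" using e by (auto simp: mod2_eq_if)
  then have "int (Suc (2 * r - e) mod 2) + int (e mod 2) = 1" by linarith
  moreover have less: "2 * r - e < 2 * r" using e by simp
  ultimately show ?thesis
    unfolding i' height_mid_up[OF t less] unfolding e(1) height_mid_down[OF t e(3)] by simp
qed

definition lower_blocks :: "nat \<Rightarrow> nat \<Rightarrow> nat list" where
  "lower_blocks t r = [t * (t - 1), t - 1] @ replicate r 2 @ [1] @ replicate r 2 @ [t\<^sup>2]"

lemma block_refl_twos: "i < 2 * r \<Longrightarrow> block_refl (replicate r 2) i = (if even i then i + 1 else i - 1)"
proof (induction r arbitrary: i)
  case (Suc r)
  show ?case
  proof (cases "i < 2")
    case True then show ?thesis by (auto simp: less_2_cases_iff)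
  next
    case False
    then show ?thesis using Suc.IH[of "i - 2"] Suc.prems by (auto elim: oddE)
  qed
qed simp

lemma square_split: "t > 0 \<Longrightarrow> t\<^sup>2 = t * (t - 1) + (t - 1) + (1::nat)"
  by (cases t) (auto simp: power2_eq_square)

lemma sum_lower_blocks: "t > 0 \<Longrightarrow> sum_list (lower_blocks t r) = 2 * t\<^sup>2 + 4 * r"
  by (simp add: lower_blocks_def sum_list_replicate square_split)

lemma height_edge_bottom:
  assumes t: "t > 0" and i: "i < sum_list (lower_blocks t r)" "i < block_refl (lower_blocks t r) i"
  shows "height t r i - height t r (block_refl (lower_blocks t r) i) = 1"
proof -
  note sq = square_split[OF t]
  define \<tau> where "\<tau> = block_refl (lower_blocks t r)"
  have s1: "sum_list [t * (t - 1), t - 1] = t\<^sup>2 - 1" using sq by simp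
  have s2: "sum_list (replicate r 2) = 2 * r" for r :: nat by (simp add: sum_list_replicate)
  have i': "i < 2 * t\<^sup>2 + 4 * r" using i sum_lower_blocks[OF t] by simp
  consider "i < t * (t - 1)" | "t * (t - 1) \<le> i" "i < t\<^sup>2 - 1" | "t\<^sup>2 - 1 \<le> i" "i < t\<^sup>2 - 1 + 2 * r"
    | "i = t\<^sup>2 - 1 + 2 * r" | "t\<^sup>2 + 2 * r \<le> i" "i < t\<^sup>2 + 4 * r" | "t\<^sup>2 + 4 * r \<le> i" by linarith
  then show ?thesis
  proof cases
    case 1
    then have \<tau>: "\<tau> i = t * (t - 1) - 1 - i" by (simp add: \<tau>_def lower_blocks_def)
    have "i < t\<^sup>2" "t * (t - 1) - 1 - i < t\<^sup>2" using 1 sq by auto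
    then show ?thesis
      using core_height_edge_first[OF 1] i(2) unfolding \<tau>_def[symmetric] \<tau> by (simp only: height_core)
  next
    case 2
    define q where "q = i - t * (t - 1)"
    have q: "i = t * (t - 1) + q" "q < t - 1" using 2 sq by (auto simp: q_def)
    have \<tau>: "\<tau> i = t * (t - 1) + (t - 2 - q)" using q by (simp add: \<tau>_def lower_blocks_def)
    have "q < t - 2 - q" using i(2) \<tau> q by (simp add: \<tau>_def)
    moreover have "t * (t - 1) + q < t\<^sup>2" "t * (t - 1) + (t - 2 - q) < t\<^sup>2" using q sq by auto
    ultimately show ?thesis
      using core_height_edge_second[OF q(2)] unfolding \<tau>_def[symmetric] \<tau> unfolding q(1)
      by (simp only: height_core)
  next
    case 3
    define e where "e = i - (t\<^sup>2 - 1)"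
    have e: "i = t\<^sup>2 - 1 + e" "e < 2 * r" using 3 by (auto simp: e_def)
    have \<tau>: "\<tau> i = t\<^sup>2 - 1 + (if even e then e + 1 else e - 1)"
      using e by (simp only: \<tau>_def lower_blocks_def block_refl_append s1 s2) (simp add: block_refl_twos)
    have ev: "even e" using i(2) \<tau> e by (auto simp: \<tau>_def split: if_splits)
    have "e + 1 \<le> 2 * r" "e \<le> 2 * r" using e by auto
    moreover have "int (e mod 2) = 0" "int ((e + 1) mod 2) = 1" using ev by auto
    ultimately show ?thesis
      using ev t unfolding \<tau>_def[symmetric] \<tau> unfolding e(1) by (simp only: height_mid_down if_True)
  next
    case 4
    have "\<tau> i = i"
      unfolding 4 by (simp only: \<tau>_def lower_blocks_def block_refl_append s1 s2) simp
    then show ?thesis using i(2) by (simp add: \<tau>_def)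
  next
    case 5
    define e where "e = i - (t\<^sup>2 + 2 * r)"
    have e: "i = t\<^sup>2 + 2 * r + e" "e < 2 * r" using 5 by (auto simp: e_def)
    have L: "lower_blocks t r = ([t * (t - 1), t - 1] @ replicate r 2 @ [1]) @ (replicate r 2 @ [t\<^sup>2])"
      by (simp add: lower_blocks_def)
    have S: "sum_list ([t * (t - 1), t - 1] @ replicate r 2 @ [1]) = t\<^sup>2 + 2 * r"
      using sq by (simp add: sum_list_replicate)
    have "\<tau> i = t\<^sup>2 + 2 * r + block_refl (replicate r 2 @ [t\<^sup>2]) e"
      unfolding \<tau>_def L block_refl_append[of "_ @ _ @ _"] S e(1) by simp
    then have \<tau>: "\<tau> i = t\<^sup>2 + 2 * r + (if even e then e + 1 else e - 1)"
      using e(2) by (simp add: block_refl_append s2 block_refl_twos)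
    have ev: "even e" using i(2) \<tau> e by (auto simp: \<tau>_def split: if_splits)
    have "e + 1 < 2 * r" using e(2) ev by (auto elim!: evenE)
    moreover have "int (Suc e mod 2) = 1" "int (Suc (e + 1) mod 2) = 0" using ev by auto
    ultimately show ?thesis
      using ev e(2) t unfolding \<tau>_def[symmetric] \<tau> unfolding e(1) by (simp only: height_mid_up if_True)
  next
    case 6
    define e where "e = i - (t\<^sup>2 + 4 * r)"
    have e: "i = t\<^sup>2 + 4 * r + e" "e < t\<^sup>2" using 6 i' by (auto simp: e_def)
    have L: "lower_blocks t r = ([t * (t - 1), t - 1] @ replicate r 2 @ [1] @ replicate r 2) @ [t\<^sup>2]"
      by (simp add: lower_blocks_def)
    have S: "sum_list ([t * (t - 1), t - 1] @ replicate r 2 @ [1] @ replicate r 2) = t\<^sup>2 + 4 * r"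
      using sq by (simp add: sum_list_replicate)
    have \<tau>: "\<tau> i = t\<^sup>2 + 4 * r + (t\<^sup>2 - 1 - e)"
      unfolding \<tau>_def L block_refl_append[of "_ @ _ @ _"] S e(1) using e(2) by simp
    have "e < t\<^sup>2 - 1 - e" using i(2) \<tau> e by (auto simp: \<tau>_def)
    then have step: "core_height t (t\<^sup>2 - 1 - e) - core_height t e = 1"
      by (rule core_height_edge_square[OF e(2)])
    have e': "t\<^sup>2 - 1 - e < t\<^sup>2" "t\<^sup>2 - 1 - (t\<^sup>2 - 1 - e) = e" using e by auto
    show ?thesis
      unfolding \<tau>_def[symmetric] \<tau> unfolding e(1) height_last[OF e(2)] height_last[OF e'(1)] e'(2)
      using step by simp
  qed
qed


lemma sum_lessThan_add: "(\<Sum>i<a + b. f i) = (\<Sum>i<a. f i) + (\<Sum>i<(b::nat). f (a + i))"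
  for f :: "nat \<Rightarrow> 'a::comm_monoid_add"
  by (induction b) (simp_all add: add.assoc)

lemma sum_zigzag: "(\<Sum>q<t. \<phi> (zigzag t q)) = (\<Sum>a<t. \<phi> a)" for \<phi> :: "nat \<Rightarrow> 'a::comm_monoid_add"
  by (rule sum.reindex_bij_witness[of _ "\<lambda>a. if odd a then a div 2 else t - 1 - a div 2" "zigzag t"])
    (auto simp: zigzag_def elim!: oddE evenE)

lemma sum_lessThan_reverse: "(\<Sum>q<t. \<phi> (t - 1 - q)) = (\<Sum>q<t. \<phi> q)" for \<phi> :: "nat \<Rightarrow> 'a::comm_monoid_add"
  by (rule sum.reindex_bij_witness[of _ "\<lambda>q. t - 1 - q" "\<lambda>q. t - 1 - q"]) auto

section \<open>Generating functions\<close>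

text \<open>
  The heights enter through \<open>\<Sum>\<^sub>i \<psi> (h i)\<close> for \<open>\<psi> a = z\<^sup>a\<close> and for \<open>\<psi> a = z\<^sup>-\<^sup>a\<close>, whose product counts
  pairs by their difference; both cases are treated at once.
\<close>
locale exponential =
  fixes \<psi> :: "int \<Rightarrow> 'a::comm_ring_1"
  assumes exp_0: "\<psi> 0 = 1" and exp_add: "\<psi> (a + b) = \<psi> a * \<psi> b"
begin

definition geo :: "nat \<Rightarrow> 'a" where "geo t = (\<Sum>a<t. \<psi> (- int a))"

lemma geo_telescope: "geo t * (1 - \<psi> (- 1)) = 1 - \<psi> (- int t)"
proof -
  have "geo t * (1 - \<psi> (- 1)) = (\<Sum>a<t. \<psi> (- int a) - \<psi> (- int (Suc a)))"
    unfolding geo_def sum_distrib_right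
  proof (intro sum.cong refl)
    fix a
    have "- int (Suc a) = - int a + (- 1)" by simp
    then show "\<psi> (- int a) * (1 - \<psi> (- 1)) = \<psi> (- int a) - \<psi> (- int (Suc a))"
      by (simp only: exp_add right_diff_distrib mult_1_right)
  qed
  also have "\<dots> = \<psi> (- int 0) - \<psi> (- int t)" by (rule sum_lessThan_telescope')
  finally show ?thesis by (simp add: exp_0)
qed

text \<open>
  The double zigzag makes the heights in the square the numbers \<open>- (a + b)\<close> with \<open>a, b < t\<close>.
\<close>
lemma sum_core_height:
  assumes "t > 0"
  shows "(\<Sum>i<s * t. \<psi> (core_height t i)) = (\<Sum>p<s. \<psi> (- int (zigzag t p))) * geo t"
proof (induction s)
  case (Suc s)
  have row: "(\<Sum>q<t. \<psi> (core_height t (s * t + q))) = \<psi> (- int (zigzag t s)) * geo t"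
  proof (cases "2 * s + 1 < t")
    case True
    have "(\<Sum>q<t. \<psi> (core_height t (s * t + q))) = \<psi> (- int (zigzag t s)) * (\<Sum>q<t. \<psi> (- int (zigzag t (t - 1 - q))))"
      using True by (simp add: core_height_pq sum_distrib_left flip: exp_add)
    also have "(\<Sum>q<t. \<psi> (- int (zigzag t (t - 1 - q)))) = geo t"
      unfolding geo_def sum_zigzag[of "\<lambda>a. \<psi> (- int a)", symmetric]
      by (rule sum_lessThan_reverse[of "\<lambda>q. \<psi> (- int (zigzag t q))"])
    finally show ?thesis .
  next
    case False
    have "(\<Sum>q<t. \<psi> (core_height t (s * t + q))) = \<psi> (- int (zigzag t s)) * (\<Sum>q<t. \<psi> (- int (zigzag t q)))"
      using False by (simp add: core_height_pq sum_distrib_left flip: exp_add)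
    then show ?thesis
      unfolding geo_def sum_zigzag[of "\<lambda>a. \<psi> (- int a)"] .
  qed
  have eq: "Suc s * t = s * t + t" by simp
  show ?case unfolding eq sum_lessThan_add Suc row by (simp add: distrib_right)
qed simp

lemma sum_height_square:
  assumes "t > 0"
  shows "(\<Sum>i<t\<^sup>2. \<psi> (height t r i)) = (geo t)\<^sup>2"
proof -
  have "(\<Sum>i<t\<^sup>2. \<psi> (height t r i)) = (\<Sum>i<t * t. \<psi> (core_height t i))"
    by (intro sum.cong) (auto simp: height_core power2_eq_square)
  then show ?thesis
    by (simp add: sum_core_height[OF assms] sum_zigzag[of "\<lambda>a. \<psi> (- int a)"] geo_def power2_eq_square)
qed

lemma sum_zigzag_butlast:
  assumes "t > 0"
  shows "(\<Sum>q<t - 1. \<psi> (- int (zigzag t q))) = geo t - 1"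
proof -
  obtain s where t: "t = Suc s" using assms by (cases t) auto
  have "(\<Sum>q<t. \<psi> (- int (zigzag t q))) = geo t"
    by (simp add: sum_zigzag[of "\<lambda>a. \<psi> (- int a)"] geo_def)
  moreover have "zigzag t s = 0" by (simp add: zigzag_def t)
  ultimately show ?thesis using exp_0 by (simp add: t algebra_simps)
qed

lemma sum_height_first:
  assumes "t > 0"
  shows "(\<Sum>i<t * (t - 1). \<psi> (height t r i)) = (geo t)\<^sup>2 - geo t"
proof -
  have "t * (t - 1) \<le> t\<^sup>2" by (simp add: power2_eq_square)
  then have "(\<Sum>i<t * (t - 1). \<psi> (height t r i)) = (\<Sum>i<(t - 1) * t. \<psi> (core_height t i))"
    by (intro sum.cong) (auto simp: height_core mult.commute)
  then show ?thesis
    unfolding sum_core_height[OF assms] sum_zigzag_butlast[OF assms]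
    by (simp add: power2_eq_square left_diff_distrib)
qed

lemma sum_height_second:
  assumes "t > 0"
  shows "(\<Sum>q<t - 1. \<psi> (height t r (t * (t - 1) + q))) = geo t - 1"
proof -
  have "height t r (t * (t - 1) + q) = - int (zigzag t q)" if "q < t - 1" for q
    using that square_split[OF assms] by (simp only: height_core core_height_last_row)
  then show ?thesis using sum_zigzag_butlast[OF assms] by simp
qed

lemma sum_height_last:
  assumes "t > 0"
  shows "(\<Sum>e<t\<^sup>2. \<psi> (height t r (t\<^sup>2 + 4 * r + e))) = \<psi> 1 * (geo t)\<^sup>2"
proof -
  have "(\<Sum>e<t\<^sup>2. \<psi> (height t r (t\<^sup>2 + 4 * r + e))) = (\<Sum>e<t\<^sup>2. \<psi> 1 * \<psi> (height t r (t\<^sup>2 - 1 - e)))"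
  proof (intro sum.cong refl)
    fix e assume "e \<in> {..<t\<^sup>2}"
    then have e: "e < t\<^sup>2" "t\<^sup>2 - 1 - e < t\<^sup>2" by auto
    show "\<psi> (height t r (t\<^sup>2 + 4 * r + e)) = \<psi> 1 * \<psi> (height t r (t\<^sup>2 - 1 - e))"
      unfolding height_last[OF e(1)] height_core[OF e(2)] exp_add by (rule mult.commute)
  qed
  then show ?thesis
    unfolding sum_distrib_left[symmetric] sum_lessThan_reverse[of "\<lambda>q. \<psi> (height t r q)"]
      sum_height_square[OF assms] .
qed

lemma sum_parity: "(\<Sum>e<2 * r. \<phi> (Suc e mod 2)) = of_nat r * (\<phi> 0 + \<phi> 1)" for \<phi> :: "nat \<Rightarrow> 'a"
  by (induction r) (auto simp: algebra_simps mod2_eq_if)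

lemma sum_height_all:
  assumes "t > 0"
  shows "(\<Sum>i<2 * t\<^sup>2 + 4 * r. \<psi> (height t r i)) =
     (1 + \<psi> 1) * (geo t)\<^sup>2 + of_nat r * ((1 + \<psi> (- 1)) * (1 + \<psi> 1))"
proof -
  have eq: "2 * t\<^sup>2 + 4 * r = t\<^sup>2 + (2 * r + (2 * r + t\<^sup>2))" by simp
  have down: "height t r (t\<^sup>2 + e) = - int (Suc e mod 2)" if "e < 2 * r" for e
  proof -
    have "t\<^sup>2 + e = t\<^sup>2 - 1 + Suc e" using assms by simp
    then show ?thesis using height_mid_down[OF assms, of "Suc e" r] that by (simp only:)
  qed
  have up: "height t r (t\<^sup>2 + (2 * r + e)) = int (Suc e mod 2)" if "e < 2 * r" for e
    using height_mid_up[OF assms that] by (simp add: add.assoc)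
  have last: "(\<Sum>e<t\<^sup>2. \<psi> (height t r (t\<^sup>2 + (2 * r + (2 * r + e))))) = \<psi> 1 * (geo t)\<^sup>2"
    using sum_height_last[OF assms, of r] by (simp add: add.assoc[symmetric])
  have mid_down: "(\<Sum>e<2 * r. \<psi> (height t r (t\<^sup>2 + e))) = of_nat r * (1 + \<psi> (- 1))"
    using sum_parity[of "\<lambda>e. \<psi> (- int e)" r] by (simp add: down exp_0)
  have mid_up: "(\<Sum>e<2 * r. \<psi> (height t r (t\<^sup>2 + (2 * r + e)))) = of_nat r * (1 + \<psi> 1)"
    using sum_parity[of "\<lambda>e. \<psi> (int e)" r] by (simp add: up exp_0)
  have "\<psi> (- 1) * \<psi> 1 = 1" using exp_add[of "-1" 1] exp_0 by simp
  then show ?thesis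
    unfolding eq sum_lessThan_add sum_height_square[OF assms] last mid_down mid_up
    by (simp add: algebra_simps)
qed

end

definition zpow :: "int \<Rightarrow> real fls" where "zpow a = fls_X_intpow a"

lemma zpow_add: "zpow (a + b) = zpow a * zpow b"
  by (simp only: zpow_def fls_X_intpow_times_fls_X_intpow)

lemma zpow_0: "zpow 0 = 1"
  by (simp add: zpow_def)

interpretation pos_exp: exponential zpow
  by unfold_locales (simp_all only: zpow_add zpow_0)

interpretation neg_exp: exponential "\<lambda>a. zpow (- a)"
  by unfold_locales (simp_all add: zpow_0 flip: zpow_add)

lemma zpow_nth: "fls_nth (zpow a) j = (if j = a then 1 else 0)"
  by (simp add: zpow_def)

lemma zpow_shift: "fls_nth (zpow a * f) j = fls_nth f (j - a)"
  by (simp add: zpow_def fls_X_intpow_times_conv_shift)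

lemma card_pairs_fls:
  fixes h :: "nat \<Rightarrow> int"
  shows "real (card {(i, k). i < m \<and> k < m \<and> h i - h k = j}) =
     fls_nth ((\<Sum>i<m. zpow (h i)) * (\<Sum>k<m. zpow (- h k))) j"
proof -
  have "(\<Sum>i<m. zpow (h i)) * (\<Sum>k<m. zpow (- h k)) = (\<Sum>(i, k)\<in>{..<m} \<times> {..<m}. zpow (h i - h k))"
    by (simp add: sum_product sum.cartesian_product flip: zpow_add)
  then have "fls_nth ((\<Sum>i<m. zpow (h i)) * (\<Sum>k<m. zpow (- h k))) j =
      (\<Sum>(i, k)\<in>{..<m} \<times> {..<m}. if h i - h k = j then 1 else 0)"
    by (auto simp: fls_nth_sum zpow_nth intro!: sum.cong)
  also have "\<dots> = (\<Sum>x\<in>{..<m} \<times> {..<m}. if x \<in> {(i, k). h i - h k = j} then 1 else 0)"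
    by (rule sum.cong) auto
  also have "\<dots> = (\<Sum>x\<in>({..<m} \<times> {..<m}) \<inter> {(i, k). h i - h k = j}. 1)"
    by (rule sum.inter_restrict[symmetric]) simp
  also have "\<dots> = real (card (({..<m} \<times> {..<m}) \<inter> {(i, k). h i - h k = j}))"
    by simp
  also have "({..<m} \<times> {..<m}) \<inter> {(i, k). h i - h k = j} = {(i, k). i < m \<and> k < m \<and> h i - h k = j}"
    by auto
  finally show ?thesis by simp
qed

lemma finite_block_pairs: "finite (block_pairs A h j)"
  by (rule finite_subset[of _ "{..<sum_list A} \<times> {..<sum_list A}"]) (auto simp: block_pairs_def)

text \<open>
  Pairs inside blocks add up over a concatenation of compositions.
\<close>
lemma card_block_pairs_append:
  "card (block_pairs (A @ B) h j) = card (block_pairs A h j) + card (block_pairs B (\<lambda>i. h (sum_list A + i)) j)"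
proof -
  let ?s = "\<lambda>(i, k). (sum_list A + i, sum_list A + k)"
  let ?B = "block_pairs B (\<lambda>i. h (sum_list A + i)) j"
  have "block_pairs (A @ B) h j = block_pairs A h j \<union> ?s ` ?B"
  proof (intro equalityI subsetI)
    fix x assume "x \<in> block_pairs (A @ B) h j"
    then obtain i k where x: "x = (i, k)" and ik: "i < sum_list A + sum_list B" "k < sum_list A + sum_list B"
      "same_block (A @ B) i k" "h i - h k = j" by (auto simp: block_pairs_def)
    show "x \<in> block_pairs A h j \<union> ?s ` ?B"
    proof (cases "i < sum_list A")
      case True
      then show ?thesis using x ik by (auto simp: block_pairs_def same_block_append split: if_splits)
    next
      case False
      then have "\<not> k < sum_list A" using ik by (auto simp: same_block_append split: if_splits)
      then have "x = ?s (i - sum_list A, k - sum_list A)" "(i - sum_list A, k - sum_list A) \<in> ?B"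
        using False ik x by (auto simp: block_pairs_def same_block_append)
      then show ?thesis by blast
    qed
  qed (auto simp: block_pairs_def same_block_append)
  moreover have "block_pairs A h j \<inter> ?s ` ?B = {}" by (auto simp: block_pairs_def)
  moreover have "inj_on ?s ?B" by (auto simp: inj_on_def)
  ultimately show ?thesis
    by (simp add: card_Un_disjoint finite_block_pairs card_image)
qed

lemma block_pairs_single: "block_pairs [m] h j = {(i, k). i < m \<and> k < m \<and> h i - h k = j}"
  by (auto simp: block_pairs_def)

lemma block_pairs_twos:
  assumes "\<And>e. e < 2 * r \<Longrightarrow> h e \<in> {a, a + 1}" "j \<ge> 2"
  shows "block_pairs (replicate r 2) h j = {}"
proof -
  have "h i - h k \<le> 1" if "i < 2 * r" "k < 2 * r" for i k
    using assms(1)[OF that(1)] assms(1)[OF that(2)] by auto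
  then have "\<not> (i < 2 * r \<and> k < 2 * r \<and> h i - h k = j)" for i k
    using assms(2) by fastforce
  then show ?thesis by (auto simp: block_pairs_def sum_list_replicate mult.commute)
qed

lemma card_block_pairs_lower:
  assumes t: "t > 0" and j: "j \<ge> 2"
  shows "real (card (block_pairs (lower_blocks t r) (height t r) j)) =
    fls_nth (((pos_exp.geo t)\<^sup>2 - pos_exp.geo t) * ((neg_exp.geo t)\<^sup>2 - neg_exp.geo t) + (pos_exp.geo t - 1) * (neg_exp.geo t - 1)
       + (pos_exp.geo t)\<^sup>2 * (neg_exp.geo t)\<^sup>2) j"
proof -
  let ?h = "height t r"
  note sq = square_split[OF t]
  have s1: "t * (t - 1) + (t - 1) = t\<^sup>2 - 1" using sq by simp
  have lb: "lower_blocks t r = [t * (t - 1)] @ [t - 1] @ replicate r 2 @ [1] @ replicate r 2 @ [t\<^sup>2]"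
    by (simp add: lower_blocks_def)
  have sums: "sum_list [a] = a" "sum_list (replicate r 2) = 2 * r" for a :: nat
    by (simp_all add: sum_list_replicate)
  have idx: "t * (t - 1) + (t - 1 + e) = t\<^sup>2 - 1 + e" for e using s1 by simp
  have idx2: "t\<^sup>2 - 1 + (2 * r + (1 + e)) = t\<^sup>2 + 2 * r + e" for e using sq by simp
  have idx3: "t\<^sup>2 + 2 * r + (2 * r + e) = t\<^sup>2 + 4 * r + e" for e by simp
  have down: "block_pairs (replicate r 2) (\<lambda>e. ?h (t\<^sup>2 - 1 + e)) j = {}"
    by (rule block_pairs_twos[of _ _ "-1"]) (use j height_mid_down[OF t, of _ r] in \<open>auto simp: mod2_eq_if\<close>)
  have up: "block_pairs (replicate r 2) (\<lambda>e. ?h (t\<^sup>2 + 2 * r + e)) j = {}"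
    by (rule block_pairs_twos[of _ _ "0"]) (use j height_mid_up[OF t, of _ r] in \<open>auto simp: mod2_eq_if\<close>)
  have one: "block_pairs [1] h j = {}" for h using j by (auto simp: block_pairs_single)
  have "card (block_pairs (lower_blocks t r) ?h j) = card (block_pairs [t * (t - 1)] ?h j)
      + card (block_pairs [t - 1] (\<lambda>e. ?h (t * (t - 1) + e)) j) + card (block_pairs [t\<^sup>2] (\<lambda>e. ?h (t\<^sup>2 + 4 * r + e)) j)"
    unfolding lb card_block_pairs_append sums idx idx2 idx3 down up one by simp
  also have "real \<dots> = fls_nth (((pos_exp.geo t)\<^sup>2 - pos_exp.geo t) * ((neg_exp.geo t)\<^sup>2 - neg_exp.geo t) + (pos_exp.geo t - 1) * (neg_exp.geo t - 1)
       + (zpow 1 * (pos_exp.geo t)\<^sup>2) * (zpow (- 1) * (neg_exp.geo t)\<^sup>2)) j"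
    unfolding block_pairs_single of_nat_add card_pairs_fls pos_exp.sum_height_first[OF t] neg_exp.sum_height_first[OF t]
      pos_exp.sum_height_second[OF t] neg_exp.sum_height_second[OF t] pos_exp.sum_height_last[OF t] neg_exp.sum_height_last[OF t] by simp
  also have "(zpow 1 * (pos_exp.geo t)\<^sup>2) * (zpow (- 1) * (neg_exp.geo t)\<^sup>2) = (zpow 1 * zpow (- 1)) * ((pos_exp.geo t)\<^sup>2 * (neg_exp.geo t)\<^sup>2)"
    by (simp only: mult_ac)
  also have "zpow 1 * zpow (- 1) = 1" by (simp add: zpow_0 flip: zpow_add)
  finally show ?thesis by simp
qed

lemma card_block_pairs_upper:
  assumes t: "t > 0"
  shows "real (card (block_pairs [2 * t\<^sup>2 + 4 * r] (\<lambda>i. - height t r i) j)) =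
    fls_nth (((1 + zpow 1) * (pos_exp.geo t)\<^sup>2 + of_nat r * ((1 + zpow (- 1)) * (1 + zpow 1)))
      * ((1 + zpow (- 1)) * (neg_exp.geo t)\<^sup>2 + of_nat r * ((1 + zpow 1) * (1 + zpow (- 1))))) j"
  unfolding block_pairs_single card_pairs_fls
  using pos_exp.sum_height_all[OF t, of r] neg_exp.sum_height_all[OF t, of r] by (simp add: mult.commute)


text \<open>
  Two solutions of \<open>c j + c (j + 1) = G j\<close> differ by an alternating sequence of constant absolute value, which
  vanishes if both are eventually zero.
\<close>
lemma recurrence_unique:
  fixes c e G :: "int \<Rightarrow> real"
  assumes c: "\<And>j. j \<ge> j0 \<Longrightarrow> c j + c (j + 1) = G j" and e: "\<And>j. j \<ge> j0 \<Longrightarrow> e j + e (j + 1) = G j"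
    and c0: "\<And>j. j > N \<Longrightarrow> c j = 0" and e0: "\<And>j. j > N' \<Longrightarrow> e j = 0" and j: "j \<ge> j0"
  shows "c j = e j"
proof -
  have step: "\<bar>c (j + int n) - e (j + int n)\<bar> = \<bar>c j - e j\<bar>" for n
  proof (induction n)
    case (Suc n)
    have "c (j + int n) + c (j + int n + 1) = e (j + int n) + e (j + int n + 1)"
      using c[of "j + int n"] e[of "j + int n"] j by simp
    then have "c (j + int (Suc n)) - e (j + int (Suc n)) = - (c (j + int n) - e (j + int n))"
      by (simp add: algebra_simps)
    then show ?case using Suc by simp
  qed simp
  define n where "n = nat (\<bar>N\<bar> + \<bar>N'\<bar> + \<bar>j\<bar> + 1)"
  have "j + int n > N" "j + int n > N'" by (auto simp: n_def)
  then show ?thesis using step[of n] c0 e0 by simp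
qed

definition bounded_above :: "real fls \<Rightarrow> bool" where
  "bounded_above p \<longleftrightarrow> (\<exists>N. \<forall>j>N. fls_nth p j = 0)"

lemma bounded_above_add:
  assumes "bounded_above p" "bounded_above q"
  shows "bounded_above (p + q)"
proof -
  obtain N K where "\<forall>j>N. fls_nth p j = 0" "\<forall>j>K. fls_nth q j = 0"
    using assms unfolding bounded_above_def by blast
  then have "\<forall>j>max N K. fls_nth (p + q) j = 0" by simp
  then show ?thesis unfolding bounded_above_def by blast
qed

lemma bounded_above_mult:
  assumes "bounded_above p" "bounded_above q"
  shows "bounded_above (p * q)"
proof -
  obtain N K where p: "\<forall>j>N. fls_nth p j = 0" and q: "\<forall>j>K. fls_nth q j = 0"
    using assms unfolding bounded_above_def by blast
  have "fls_nth (p * q) j = 0" if "j > N + K" for j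
    unfolding fls_times_nth(2)
  proof (intro sum.neutral ballI)
    fix i
    show "fls_nth p i * fls_nth q (j - i) = 0"
      using p q that by (cases "i > N") auto
  qed
  then show ?thesis unfolding bounded_above_def by blast
qed

lemma bounded_above_z: "bounded_above (zpow a)"
  unfolding bounded_above_def by (intro exI[of _ a]) (simp add: zpow_nth)

lemma bounded_above_of_nat: "bounded_above (of_nat r)"
  unfolding bounded_above_def by (intro exI[of _ 0]) (simp add: fls_of_nat_nth)

lemma bounded_above_sum: "(\<And>i. i \<in> A \<Longrightarrow> bounded_above (f i)) \<Longrightarrow> bounded_above (\<Sum>i\<in>A. f i)"
  using bounded_above_of_nat[of 0] by (induction A rule: infinite_finite_induct) (auto intro: bounded_above_add)

lemmas bounded_above_intros = bounded_above_add bounded_above_mult bounded_above_z bounded_above_of_nat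
  bounded_above_sum bounded_above_of_nat[of 1, simplified]

text \<open>
  For \<open>k = 1, 2, 3\<close> this is \<open>(1 - z)\<^sup>-\<^sup>k\<close>, with its coefficients as a definition since these are what is read off.
\<close>
definition inv_power :: "nat \<Rightarrow> real fls" where
  "inv_power k = fps_to_fls (Abs_fps (\<lambda>n. if k = 1 then 1 else if k = 2 then of_nat (n + 1) else of_nat ((n + 1) * (n + 2)) / 2))"

lemma inv_power_nth: "fls_nth (inv_power k) j = (if j < 0 then 0 else if k = 1 then 1
   else if k = 2 then of_int (j + 1) else of_int ((j + 1) * (j + 2)) / 2)"
proof (cases "j < 0")
  case False
  then obtain n where "j = int n" using nonneg_int_cases[of j] by auto
  then show ?thesis by (simp add: inv_power_def algebra_simps)
qed (simp add: inv_power_def)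

lemma one_minus_z_times_nth: "fls_nth ((1 - zpow 1) * f) j = fls_nth f j - fls_nth f (j - 1)"
  by (simp add: left_diff_distrib zpow_shift)

lemma inv_power_1: "(1 - zpow 1) * inv_power 1 = 1"
  by (rule fls_eqI) (auto simp: one_minus_z_times_nth inv_power_nth)

lemma inv_power_2: "(1 - zpow 1) * inv_power 2 = inv_power 1"
  by (rule fls_eqI) (auto simp: one_minus_z_times_nth inv_power_nth)

lemma inv_power_3: "(1 - zpow 1) * inv_power 3 = inv_power 2"
proof (rule fls_eqI)
  fix j :: int
  consider "j < 0" | "j = 0" | "j \<ge> 1" by linarith
  then show "fls_nth ((1 - zpow 1) * inv_power 3) j = fls_nth (inv_power 2) j"
    unfolding one_minus_z_times_nth by cases (simp_all add: inv_power_nth, simp add: field_simps)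
qed

lemma inv_power_eq: "inv_power 2 = (inv_power 1)\<^sup>2" "inv_power 3 = (inv_power 1) ^ 3"
proof -
  have "inv_power 2 = ((1 - zpow 1) * inv_power 1) * inv_power 2" by (simp only: inv_power_1 mult_1_left)
  also have "\<dots> = inv_power 1 * ((1 - zpow 1) * inv_power 2)" by (simp only: mult_ac)
  finally show 2: "inv_power 2 = (inv_power 1)\<^sup>2" by (simp add: inv_power_2 power2_eq_square)
  have "inv_power 3 = ((1 - zpow 1) * inv_power 1) * inv_power 3" by (simp only: inv_power_1 mult_1_left)
  also have "\<dots> = inv_power 1 * ((1 - zpow 1) * inv_power 3)" by (simp only: mult_ac)
  finally show "inv_power 3 = (inv_power 1) ^ 3" by (simp add: inv_power_3 2 power3_eq_cube power2_eq_square)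
qed

text \<open>
  The Laurent polynomial \<open>(S(1/z) - S(z)) / (1 - 1/z)\<close> with \<open>S\<close> the geometric sum, written as a sum so that it is
  visibly finite.
\<close>
definition ramp :: "nat \<Rightarrow> real fls" where
  "ramp t = (\<Sum>a<t. \<Sum>i<2 * a. zpow (int a - int i))"

lemma ramp_telescope: "ramp t * (1 - zpow (- 1)) = neg_exp.geo t - pos_exp.geo t"
proof -
  have "(\<Sum>i<2 * a. zpow (int a - int i)) * (1 - zpow (- 1)) = zpow (int a) - zpow (- int a)" for a
  proof -
    have "(\<Sum>i<2 * a. zpow (int a - int i)) * (1 - zpow (- 1)) = zpow (int a) * (pos_exp.geo (2 * a) * (1 - zpow (- 1)))"
    proof -
      have "(\<Sum>i<2 * a. zpow (int a - int i)) = zpow (int a) * pos_exp.geo (2 * a)"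
        by (simp only: pos_exp.geo_def sum_distrib_left zpow_add diff_conv_add_uminus)
      then show ?thesis by (simp only: mult.assoc)
    qed
    also have "\<dots> = zpow (int a) - zpow (- int a)"
    proof -
      have "zpow (- int a) = zpow (int a) * zpow (- int (2 * a))" by (simp add: zpow_add[symmetric] del: of_nat_mult) simp
      then show ?thesis unfolding pos_exp.geo_telescope by (simp only: right_diff_distrib mult_1_right)
    qed
    finally show ?thesis .
  qed
  then show ?thesis
    by (simp add: ramp_def sum_distrib_right pos_exp.geo_def neg_exp.geo_def sum_subtractf)
qed

text \<open>
  Here \<open>X = z\<close>, \<open>Y = z\<^sup>-\<^sup>t\<close>, \<open>Xi\<close> and \<open>Yi\<close> are their inverses, \<open>U = 1 / (1 - z)\<close>, and \<open>S\<close>, \<open>Sb\<close> are the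
  geometric sums in \<open>1/z\<close> and \<open>z\<close>. The equations express every summand of the difference as a
  combination of monomials times a power of \<open>U\<close>, from which coefficients can be read off.
\<close>
lemma laurent_identities:
  fixes X Xi Y Yi U S Sb Q :: "real fls"
  assumes X: "X * Xi = 1" and Y: "Y * Yi = 1" and U: "(1 - X) * U = 1"
    and S: "S * (1 - Xi) = 1 - Y" and Sb: "Sb * (1 - X) = 1 - Yi" and Q: "Q * (1 - Xi) = Sb - S"
  shows "S = - (1 - Y) * X * U" "Sb = (1 - Yi) * U"
    and "(1 + Xi) * Q = 2 * (S * Sb) - S - Sb"
    and "(X - Xi) * (S\<^sup>2 * Sb\<^sup>2) = - ((X + X\<^sup>2) * (Y\<^sup>2 - 4 * Y + 6 - 4 * Yi + Yi\<^sup>2) * U ^ 3)"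
    and "(X - Xi) * ((1 + X) * S\<^sup>2) = - ((X + 2 * X\<^sup>2 + X ^ 3) * (1 - 2 * Y + Y\<^sup>2) * U)"
    and "(X - Xi) * ((1 + Xi) * Sb\<^sup>2) = - ((1 + 2 * Xi + Xi\<^sup>2) * (1 - 2 * Yi + Yi\<^sup>2) * U)"
    and "(X - Xi) * ((1 + X) * (1 + Xi)) = X\<^sup>2 + 2 * X - 2 * Xi - Xi\<^sup>2"
    and "(Sb - S) * (S * Sb) = X * (Y - 2 + Yi) * (1 + X - Yi - Y * X) * U ^ 3"
    and "Sb - S = (1 - Yi + X - Y * X) * U"
proof -
  have U1: "U = 1 + X * U" using U by Groebner_Basis.algebra
  show S': "S = - (1 - Y) * X * U" using X U S by Groebner_Basis.algebra
  show Sb': "Sb = (1 - Yi) * U" using U Sb by Groebner_Basis.algebra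
  have Q': "Q = - X * U * (Sb - S)" using X U Q by Groebner_Basis.algebra
  have Xi: "X - Xi = - (1 - X) * (1 + X) * Xi" using X by Groebner_Basis.algebra
  have sq: "(1 - Yi) * Y = - (1 - Y)" using Y by Groebner_Basis.algebra
  show d: "Sb - S = (1 - Yi + X - Y * X) * U" unfolding S' Sb' by (simp add: algebra_simps)
  have prod: "S * Sb = X * (Y - 2 + Yi) * U\<^sup>2" unfolding S' Sb' using Y by Groebner_Basis.algebra
  show "(Sb - S) * (S * Sb) = X * (Y - 2 + Yi) * (1 + X - Yi - Y * X) * U ^ 3"
    unfolding d prod by Groebner_Basis.algebra
  show "(X - Xi) * ((1 + X) * (1 + Xi)) = X\<^sup>2 + 2 * X - 2 * Xi - Xi\<^sup>2"
    using X by Groebner_Basis.algebra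
  have fact: "(1 - X) * U\<^sup>2 = U" using U by Groebner_Basis.algebra
  have fact4: "(1 - X) * U ^ 4 = U ^ 3" using U by Groebner_Basis.algebra
  have "(1 + Xi) * Q = - (1 + X) * U * (Sb - S)" unfolding Q' using X by Groebner_Basis.algebra
  also have "\<dots> = - (1 + X) * (1 - Yi + X - Y * X) * U\<^sup>2" unfolding d by Groebner_Basis.algebra
  also have "\<dots> = 2 * (X * (Y - 2 + Yi) * U\<^sup>2) - (- (1 - Y) * X - (Yi - 1)) * ((1 - X) * U\<^sup>2)"
    by Groebner_Basis.algebra
  also have "\<dots> = 2 * (S * Sb) - S - Sb" unfolding fact prod unfolding S' Sb' by Groebner_Basis.algebra
  finally show "(1 + Xi) * Q = 2 * (S * Sb) - S - Sb" .
  show "(X - Xi) * (S\<^sup>2 * Sb\<^sup>2) = - ((X + X\<^sup>2) * (Y\<^sup>2 - 4 * Y + 6 - 4 * Yi + Yi\<^sup>2) * U ^ 3)"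
  proof -
    have "(X - Xi) * (S\<^sup>2 * Sb\<^sup>2) = (X - Xi) * (S * Sb)\<^sup>2" by (simp add: power_mult_distrib)
    also have "\<dots> = - (1 + X) * (Xi * X) * X * (Y - 2 + Yi)\<^sup>2 * ((1 - X) * U ^ 4)"
      unfolding prod Xi by Groebner_Basis.algebra
    also have "(Y - 2 + Yi)\<^sup>2 = Y\<^sup>2 - 4 * Y + 6 - 4 * Yi + Yi\<^sup>2" using Y by Groebner_Basis.algebra
    also have "Xi * X = 1" using X by (simp add: mult.commute)
    finally show ?thesis unfolding fact4 by Groebner_Basis.algebra
  qed
  show "(X - Xi) * ((1 + X) * S\<^sup>2) = - ((X + 2 * X\<^sup>2 + X ^ 3) * (1 - 2 * Y + Y\<^sup>2) * U)"
  proof -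
    have "(X - Xi) * ((1 + X) * S\<^sup>2) = - (1 + X)\<^sup>2 * (Xi * X) * X * (1 - Y)\<^sup>2 * ((1 - X) * U\<^sup>2)"
      unfolding S' Xi by Groebner_Basis.algebra
    also have "Xi * X = 1" using X by (simp add: mult.commute)
    finally show ?thesis unfolding fact by Groebner_Basis.algebra
  qed
  show "(X - Xi) * ((1 + Xi) * Sb\<^sup>2) = - ((1 + 2 * Xi + Xi\<^sup>2) * (1 - 2 * Yi + Yi\<^sup>2) * U)"
  proof -
    have "(X - Xi) * ((1 + Xi) * Sb\<^sup>2) = - ((1 + X) * Xi) * (1 + Xi) * (1 - Yi)\<^sup>2 * ((1 - X) * U\<^sup>2)"
      unfolding Sb' Xi by Groebner_Basis.algebra
    also have "(1 + X) * Xi = 1 + Xi" using X by Groebner_Basis.algebra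
    finally show ?thesis unfolding fact by Groebner_Basis.algebra
  qed
qed

text \<open>
  With \<open>T = S Sb\<close>, the pair counts of all blocks have generating function \<open>G\<close>, and \<open>(1 + 1/z) E = G - 1\<close> for the
  Laurent polynomial \<open>E\<close>; the term \<open>1\<close> only concerns the coefficient of index 0. So \<open>E\<close> solves the recurrence
  of the ordered pairs from index 3 on, and the difference of consecutive counts is a coefficient
  of \<open>(1 - 1/z) E\<close>. For \<open>3 \<le> j \<le> t - 3\<close> most monomials do not contribute.
\<close>
theorem meander_pair_count_difference:
  fixes t r :: nat and j :: int
  defines "c \<equiv> \<lambda>j. real (card (ascending_pairs [2 * t\<^sup>2 + 4 * r] (\<lambda>i. - height t r i) j) +
      card (ascending_pairs (lower_blocks t r) (height t r) j))"
  assumes j: "3 \<le> j" "j \<le> int t - 3"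
  shows "c j - c (j + 1) = 6 * real_of_int j * real t - (9 * (real_of_int j)\<^sup>2 + real_of_int j) / 2 + 1 - 4 * real r"
proof -
  have t: "t > 0" using j by simp
  define n where "n = 2 * t\<^sup>2 + 4 * r"
  let ?h = "height t r"
  define X where "X = zpow 1"
  define Xi where "Xi = zpow (- 1)"
  define Y where "Y = zpow (- int t)"
  define Yi where "Yi = zpow (int t)"
  define U where "U = inv_power 1"
  define S where "S = pos_exp.geo t"
  define Sb where "Sb = neg_exp.geo t"
  define Q where "Q = ramp t"
  define R :: "real fls" where "R = of_nat r"
  have X: "X * Xi = 1" and Y: "Y * Yi = 1"
    by (simp_all add: X_def Xi_def Y_def Yi_def zpow_0 flip: zpow_add)
  have U: "(1 - X) * U = 1" by (simp only: X_def U_def inv_power_1)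
  have S: "S * (1 - Xi) = 1 - Y" unfolding S_def Xi_def Y_def by (rule pos_exp.geo_telescope)
  have Sb: "Sb * (1 - X) = 1 - Yi"
    using neg_exp.geo_telescope[of t] by (simp add: Sb_def X_def Yi_def)
  have Q: "Q * (1 - Xi) = Sb - S" unfolding Q_def Xi_def Sb_def S_def by (rule ramp_telescope)
  note ids = laurent_identities[OF X Y U S Sb Q]

  define G where "G = ((1 + X) * S\<^sup>2 + R * ((1 + Xi) * (1 + X))) * ((1 + Xi) * Sb\<^sup>2 + R * ((1 + X) * (1 + Xi)))
      + ((S\<^sup>2 - S) * (Sb\<^sup>2 - Sb) + (S - 1) * (Sb - 1) + S\<^sup>2 * Sb\<^sup>2)"
  define E where "E = (1 + X) * ((S\<^sup>2 + R * (1 + Xi)) * (Sb\<^sup>2 + R * (1 + X))) + Q * (S * Sb + 1)"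
  have GE: "(1 + Xi) * E = G - 1"
  proof -
    have "(1 + Xi) * E = (1 + Xi) * (1 + X) * ((S\<^sup>2 + R * (1 + Xi)) * (Sb\<^sup>2 + R * (1 + X))) + (1 + Xi) * Q * (S * Sb + 1)"
      unfolding E_def by Groebner_Basis.algebra
    also have "\<dots> = G - 1" unfolding ids(3) G_def by Groebner_Basis.algebra
    finally show ?thesis .
  qed
  have E_rec: "fls_nth E j + fls_nth E (j + 1) = fls_nth G j" if "j \<ge> 3" for j
  proof -
    have "fls_nth ((1 + Xi) * E) j = fls_nth E j + fls_nth E (j + 1)"
      by (simp add: distrib_right Xi_def zpow_shift)
    then show ?thesis using that unfolding GE by simp
  qed
  have c_rec: "c j + c (j + 1) = fls_nth G j" if "j \<ge> 3" for j
  proof -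
    have "card (ascending_pairs [n] (\<lambda>i. - ?h i) j) + card (ascending_pairs [n] (\<lambda>i. - ?h i) (j + 1))
        = card (block_pairs [n] (\<lambda>i. - ?h i) j)"
      by (rule card_ascending_pairs_recurrence) (use that height_edge_top[OF t, of _ r] in \<open>auto simp: n_def\<close>)
    moreover have "card (ascending_pairs (lower_blocks t r) ?h j) + card (ascending_pairs (lower_blocks t r) ?h (j + 1))
        = card (block_pairs (lower_blocks t r) ?h j)"
      by (rule card_ascending_pairs_recurrence) (use that height_edge_bottom[OF t, of _ r] in auto)
    ultimately have "c j + c (j + 1) = real (card (block_pairs [n] (\<lambda>i. - ?h i) j))
        + real (card (block_pairs (lower_blocks t r) ?h j))"
      unfolding c_def n_def by linarith
    also have "\<dots> = fls_nth G j"
      unfolding n_def card_block_pairs_upper[OF t] using that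
      by (subst card_block_pairs_lower[OF t]) (simp_all add: G_def X_def Xi_def S_def Sb_def R_def mult.commute)
    finally show ?thesis .
  qed
  have "bounded_above E"
    unfolding E_def X_def Xi_def S_def Sb_def R_def Q_def pos_exp.geo_def neg_exp.geo_def ramp_def power2_eq_square
    by (intro bounded_above_intros)
  then obtain N' where N': "\<And>j. j > N' \<Longrightarrow> fls_nth E j = 0" unfolding bounded_above_def by blast
  \<comment> \<open>a crude bound for height differences, beyond which all counts vanish\<close>
  define N where "N = 2 * (\<Sum>i<n. \<bar>?h i\<bar>)"
  have c_zero: "c j = 0" if "j > N" for j
  proof -
    have le: "\<bar>?h i\<bar> \<le> (\<Sum>i<n. \<bar>?h i\<bar>)" if "i < n" for i
      by (rule member_le_sum) (use that in auto)
    have bd: "\<bar>?h i - ?h k\<bar> \<le> N" if "i < n" "k < n" for i k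
      using le[OF that(1)] le[OF that(2)] by (simp add: N_def)
    have ne: "?h i - ?h k \<noteq> j" "?h k - ?h i \<noteq> j" if "i < k" "k < n" for i k
      using bd[of i k] that \<open>j > N\<close> by auto
    have "ascending_pairs [n] (\<lambda>i. - ?h i) j = {}"
      using ne(2) by (auto simp: ascending_pairs_def)
    moreover have "ascending_pairs (lower_blocks t r) ?h j = {}"
      using ne(1) by (auto simp: ascending_pairs_def sum_lower_blocks[OF t] n_def)
    ultimately show ?thesis by (simp add: c_def n_def)
  qed
  have cE: "c j = fls_nth E j" if "j \<ge> 3" for j
    by (rule recurrence_unique[of 3 c "fls_nth G" "fls_nth E" N N' j]) (use c_rec E_rec c_zero N' that in auto)
  have "c j - c (j + 1) = fls_nth ((1 - Xi) * E) j"
    using j by (simp add: cE left_diff_distrib Xi_def zpow_shift)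
  also have "(1 - Xi) * E = (X - Xi) * (S\<^sup>2 * Sb\<^sup>2) + R * ((X - Xi) * ((1 + X) * S\<^sup>2)) + R * ((X - Xi) * ((1 + Xi) * Sb\<^sup>2))
      + R * (R * ((X - Xi) * ((1 + X) * (1 + Xi)))) + (Sb - S) * (S * Sb) + (Sb - S)"
  proof -
    have "(1 - Xi) * E = (1 - Xi) * (1 + X) * ((S\<^sup>2 + R * (1 + Xi)) * (Sb\<^sup>2 + R * (1 + X))) + Q * (1 - Xi) * (S * Sb + 1)"
      unfolding E_def by Groebner_Basis.algebra
    also have "(1 - Xi) * (1 + X) = X - Xi" using X by Groebner_Basis.algebra
    finally show ?thesis unfolding Q by Groebner_Basis.algebra
  qed
  finally have main: "c j - c (j + 1) = fls_nth ((X - Xi) * (S\<^sup>2 * Sb\<^sup>2)) j + real r * fls_nth ((X - Xi) * ((1 + X) * S\<^sup>2)) j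
      + real r * fls_nth ((X - Xi) * ((1 + Xi) * Sb\<^sup>2)) j
      + real r * (real r * fls_nth ((X - Xi) * ((1 + X) * (1 + Xi))) j) + fls_nth ((Sb - S) * (S * Sb)) j + fls_nth (Sb - S) j"
    by (simp add: R_def fls_of_nat)
  note expand = X_def Xi_def Y_def Yi_def distrib_right distrib_left left_diff_distrib right_diff_distrib
    mult.assoc zpow_shift power2_eq_square power3_eq_cube[of "zpow _"] inv_power_nth
  have U3: "U ^ 3 = inv_power 3" by (simp only: U_def inv_power_eq)
  have 1: "fls_nth ((X - Xi) * (S\<^sup>2 * Sb\<^sup>2)) j = 4 * real_of_int j * real t - 3 * (real_of_int j)\<^sup>2"
    unfolding ids(4) U3 using j by (simp add: expand) (simp add: field_simps)
  have 2: "fls_nth ((X - Xi) * ((1 + X) * S\<^sup>2)) j = 0"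
    unfolding ids(5) U_def using j by (simp add: expand)
  have 3: "fls_nth ((X - Xi) * ((1 + Xi) * Sb\<^sup>2)) j = - 4"
    unfolding ids(6) U_def using j by (simp add: expand)
  have 4: "fls_nth ((X - Xi) * ((1 + X) * (1 + Xi))) j = 0"
    unfolding ids(7) using j by (simp add: expand zpow_nth)
  have 5: "fls_nth ((Sb - S) * (S * Sb)) j = 2 * real_of_int j * real t - 3 * (real_of_int j)\<^sup>2 / 2 - real_of_int j / 2"
    unfolding ids(8) U3 using j by (simp add: expand) (simp add: field_simps)
  have 6: "fls_nth (Sb - S) j = 1"
    unfolding ids(9) U_def using j by (simp add: expand)
  show ?thesis unfolding main 1 2 3 4 5 6 by (simp add: field_simps)
qed

section \<open>Seaweed algebras and the meander functional\<close>

lemma same_block_convex: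
  "same_block A i k \<Longrightarrow> i \<le> l \<Longrightarrow> l \<le> k \<Longrightarrow> same_block A i l \<and> same_block A l k"
proof (induction A arbitrary: i k l)
  case (Cons a A)
  show ?case
  proof (cases "k < a")
    case False
    then have "\<not> i < a" "\<not> l < a" "same_block A (i - a) (k - a)"
      using Cons.prems by (simp_all split: if_splits)
    moreover have "i - a \<le> l - a" "l - a \<le> k - a" using Cons.prems by (simp_all add: diff_le_mono)
    ultimately show ?thesis using Cons.IH[of "i - a" "k - a" "l - a"] False by simp
  qed (use Cons.prems in simp)
qed simp

text \<open>
  Blocks are intervals, so the admissible positions are closed under composition and the matrices
  supported on them form an associative algebra.
\<close>
lemma admissible_trans:
  assumes il: "admissible A B i l" and lk: "admissible A B l k"
  shows "admissible A B i k"
proof (cases "i = l \<or> l = k \<or> i = k")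
  case True
  then show ?thesis using assms by (auto simp: admissible_def)
next
  case False
  note commute = same_block_commute[of A] same_block_commute[of B]
  consider "l < k" "k < i" | "k < l" "l < i" | "k < i" "i < l" | "l < i" "i < k" | "i < l" "l < k" | "i < k" "k < l"
    using False by linarith
  then show ?thesis
  proof cases
    case 1
    then have "same_block A l i" using il commute(1)[of l i] by (auto simp: admissible_def)
    then show ?thesis using same_block_convex[of A l i k] 1 commute(1)[of k i] by (auto simp: admissible_def)
  next
    case 2
    then have "same_block A i l" "same_block A l k" using assms by (auto simp: admissible_def)
    then have "same_block A i k" by (rule same_block_trans)
    then show ?thesis using 2 by (simp add: admissible_def)
  next
    case 3
    then have "same_block A k l" using lk commute(1)[of k l] by (auto simp: admissible_def)
    then show ?thesis using same_block_convex[of A k l i] 3 commute(1)[of k i] by (auto simp: admissible_def)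
  next
    case 4
    then have "same_block B l k" using lk by (auto simp: admissible_def)
    then show ?thesis using same_block_convex[of B l k i] 4 by (auto simp: admissible_def)
  next
    case 5
    then have "same_block B i l" "same_block B l k" using assms by (auto simp: admissible_def)
    then have "same_block B i k" by (rule same_block_trans)
    then show ?thesis using 5 by (simp add: admissible_def)
  next
    case 6
    then have "same_block B i l" using il by (auto simp: admissible_def)
    then show ?thesis using same_block_convex[of B i l k] 6 by (auto simp: admissible_def)
  qed
qed

lemma block_of_Cons:
  assumes "i < a + sum_list A"
  shows "block_of (a # A) i = (if i < a then 0 else Suc (block_of A (i - a)))"
proof (cases "i < a")
  case True
  then show ?thesis by (auto simp: block_of_def intro: Least_equality)
next
  case False
  have "block_of (a # A) i = (LEAST k. i < a + sum_list (take k A))" by (simp add: block_of_def)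
  also have "\<dots> = Suc (LEAST k. i < a + sum_list (take (Suc k) A))"
  proof (rule Least_Suc)
    show "i < a + sum_list (take (length A) A)" using assms by simp
    show "\<not> i < a + sum_list (take 0 A)" using False by simp
  qed
  also have "(\<lambda>k. i < a + sum_list (take (Suc k) A)) = (\<lambda>k. i - a < sum_list (take (Suc k) A))"
  proof (rule ext)
    show "(i < a + sum_list (take (Suc k) A)) = (i - a < sum_list (take (Suc k) A))" for k
      using False by linarith
  qed
  finally show ?thesis using False by (simp add: block_of_def)
qed

lemma block_of_eq_iff:
  "i < sum_list A \<Longrightarrow> k < sum_list A \<Longrightarrow> block_of A i = block_of A k \<longleftrightarrow> same_block A i k"
proof (induction A arbitrary: i k)
  case (Cons a A)
  have "i < a + sum_list A" "k < a + sum_list A" using Cons.prems by simp_all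
  moreover have "block_of A (i - a) = block_of A (k - a) \<longleftrightarrow> same_block A (i - a) (k - a)" if "\<not> i < a" "\<not> k < a"
    using that Cons.prems by (intro Cons.IH) simp_all
  ultimately show ?case
    by (cases "i < a"; cases "k < a") (simp_all add: block_of_Cons)
qed simp

lemma lie_bracket_diff_right:
  assumes x: "x \<in> carrier_mat n n" and y: "y \<in> carrier_mat n n" and y': "y' \<in> carrier_mat n n"
  shows "lie_bracket x (y - y') = lie_bracket x y - lie_bracket x y'"
proof -
  have swap: "(a - b) - (c - d) = (a - c) - (b - d)"
    if "a \<in> carrier_mat n n" "b \<in> carrier_mat n n" "c \<in> carrier_mat n n" "d \<in> carrier_mat n n"
    for a b c d :: "complex mat"
    using that by (intro carrier_mat_eqI[of _ n] minus_carrier_mat) simp_all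
  have "lie_bracket x (y - y') = (x * y - x * y') - (y * x - y' * x)"
    using x y y' unfolding lie_bracket_def
    by (simp add: mult_minus_distrib_mat[of _ n n _ n] minus_mult_distrib_mat[of _ n n _ _ n])
  also have "\<dots> = (x * y - y * x) - (x * y' - y' * x)"
    using x y y' by (intro swap mult_carrier_mat[of _ n n])
  finally show ?thesis by (simp add: lie_bracket_def)
qed

definition meander_functional :: "nat list \<Rightarrow> nat list \<Rightarrow> complex mat \<Rightarrow> complex" where
  "meander_functional A B y = (\<Sum>i<sum_list A.
     (if block_refl A i < i then y $$ (i, block_refl A i) else 0) +
     (if i < block_refl B i then y $$ (i, block_refl B i) else 0))"

definition mat_unit :: "nat \<Rightarrow> nat \<Rightarrow> nat \<Rightarrow> complex mat" where
  "mat_unit n p q = mat n n (\<lambda>(i,k). if i = p \<and> k = q then 1 else 0)"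

lemma mat_unit_carrier [simp]: "mat_unit n p q \<in> carrier_mat n n"
  by (simp add: mat_unit_def)

lemma mat_unit_dim [simp]: "dim_row (mat_unit n p q) = n" "dim_col (mat_unit n p q) = n"
  by (simp_all add: mat_unit_def)

lemma mat_unit_index [simp]: "i < n \<Longrightarrow> k < n \<Longrightarrow> mat_unit n p q $$ (i,k) = (if i = p \<and> k = q then 1 else 0)"
  by (simp add: mat_unit_def)

lemma sum_single:
  fixes g :: "nat \<Rightarrow> 'a::comm_monoid_add"
  assumes "a < n" "\<And>i. i < n \<Longrightarrow> i \<noteq> a \<Longrightarrow> g i = 0"
  shows "(\<Sum>i<n. g i) = g a"
proof -
  have "(\<Sum>i<n. g i) = (\<Sum>i\<in>{a}. g i)" by (rule sum.mono_neutral_right) (use assms in auto)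
  then show ?thesis by simp
qed

lemma sum_if_single:
  fixes g :: "nat \<Rightarrow> 'a::comm_monoid_add"
  assumes "a < n" "\<And>u. u < n \<Longrightarrow> Q u \<longleftrightarrow> u = a"
  shows "(\<Sum>u<n. if C u then (if Q u then g u else 0) else 0) = (if C a then g a else 0)"
proof -
  have "(\<Sum>u<n. if C u then (if Q u then g u else 0) else 0) = (if C a then (if Q a then g a else 0) else 0)"
    by (rule sum_single) (use assms in auto)
  then show ?thesis using assms by simp
qed

lemma lie_bracket_mat_unit:
  assumes "x \<in> carrier_mat n n" "p < n" "q < n" "u < n" "v < n"
  shows "lie_bracket x (mat_unit n p q) $$ (u,v) = (if v = q then x $$ (u,p) else 0) - (if u = p then x $$ (q,v) else 0)"
proof -
  have "(\<Sum>l<n. x $$ (u,l) * mat_unit n p q $$ (l,v)) = x $$ (u,p) * mat_unit n p q $$ (p,v)"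
    using assms by (intro sum_single) auto
  moreover have "(\<Sum>l<n. mat_unit n p q $$ (u,l) * x $$ (l,v)) = mat_unit n p q $$ (u,q) * x $$ (q,v)"
    using assms by (intro sum_single) auto
  ultimately show ?thesis using assms by (simp add: lie_bracket_index[of _ n])
qed

lemma meander_functional_bracket:
  assumes x: "x \<in> carrier_mat n n" and pq: "p < n" "q < n" and A: "sum_list A = n" and B: "sum_list B = n"
  shows "meander_functional A B (lie_bracket x (mat_unit n p q)) = meander_comm A B (\<lambda>i k. x $$ (i,k)) q p"
proof -
  define \<sigma> where "\<sigma> = block_refl A"
  define \<tau> where "\<tau> = block_refl B"
  have \<sigma>: "\<sigma> i < n" "\<sigma> (\<sigma> i) = i" and \<tau>: "\<tau> i < n" "\<tau> (\<tau> i) = i" if "i < n" for i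
    unfolding \<sigma>_def \<tau>_def
    using that block_refl_less[of i A, unfolded A] block_refl_invol[of i A, unfolded A]
      block_refl_less[of i B, unfolded B] block_refl_invol[of i B, unfolded B] by blast+
  have \<sigma>_eq: "\<sigma> u = q \<longleftrightarrow> u = \<sigma> q" and \<tau>_eq: "\<tau> u = q \<longleftrightarrow> u = \<tau> q" if "u < n" for u
    using \<sigma>(2)[OF that] \<sigma>(2)[OF pq(2)] \<tau>(2)[OF that] \<tau>(2)[OF pq(2)] by metis+
  have s1: "(\<Sum>u<n. if \<sigma> u < u then (if \<sigma> u = q then x $$ (u,p) else 0) else 0) = (if q < \<sigma> q then x $$ (\<sigma> q, p) else 0)"
    using sum_if_single[of "\<sigma> q" n "\<lambda>u. \<sigma> u = q" "\<lambda>u. \<sigma> u < u" "\<lambda>u. x $$ (u,p)", OF \<sigma>(1)[OF pq(2)] \<sigma>_eq]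
    unfolding \<sigma>(2)[OF pq(2)] .
  have s2: "(\<Sum>u<n. if \<sigma> u < u then (if u = p then x $$ (q, \<sigma> u) else 0) else 0) = (if \<sigma> p < p then x $$ (q, \<sigma> p) else 0)"
    by (rule sum_if_single[OF pq(1) refl])
  have t1: "(\<Sum>u<n. if u < \<tau> u then (if \<tau> u = q then x $$ (u,p) else 0) else 0) = (if \<tau> q < q then x $$ (\<tau> q, p) else 0)"
    using sum_if_single[of "\<tau> q" n "\<lambda>u. \<tau> u = q" "\<lambda>u. u < \<tau> u" "\<lambda>u. x $$ (u,p)", OF \<tau>(1)[OF pq(2)] \<tau>_eq]
    unfolding \<tau>(2)[OF pq(2)] .
  have t2: "(\<Sum>u<n. if u < \<tau> u then (if u = p then x $$ (q, \<tau> u) else 0) else 0) = (if p < \<tau> p then x $$ (q, \<tau> p) else 0)"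
    by (rule sum_if_single[OF pq(1) refl])
  have "meander_functional A B (lie_bracket x (mat_unit n p q)) = (\<Sum>u<n.
      ((if \<sigma> u < u then (if \<sigma> u = q then x $$ (u,p) else 0) else 0)
       - (if \<sigma> u < u then (if u = p then x $$ (q, \<sigma> u) else 0) else 0))
    + ((if u < \<tau> u then (if \<tau> u = q then x $$ (u,p) else 0) else 0)
       - (if u < \<tau> u then (if u = p then x $$ (q, \<tau> u) else 0) else 0)))"
    unfolding meander_functional_def A \<sigma>_def[symmetric] \<tau>_def[symmetric]
  proof (intro sum.cong refl)
    fix u assume "u \<in> {..<n}"
    then have u: "u < n" by simp
    show "(if \<sigma> u < u then lie_bracket x (mat_unit n p q) $$ (u, \<sigma> u) else 0)
        + (if u < \<tau> u then lie_bracket x (mat_unit n p q) $$ (u, \<tau> u) else 0) =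
      ((if \<sigma> u < u then (if \<sigma> u = q then x $$ (u,p) else 0) else 0)
       - (if \<sigma> u < u then (if u = p then x $$ (q, \<sigma> u) else 0) else 0))
    + ((if u < \<tau> u then (if \<tau> u = q then x $$ (u,p) else 0) else 0)
       - (if u < \<tau> u then (if u = p then x $$ (q, \<tau> u) else 0) else 0))"
      unfolding lie_bracket_mat_unit[OF x pq u \<sigma>(1)[OF u]] lie_bracket_mat_unit[OF x pq u \<tau>(1)[OF u]]
      by simp
  qed
  also have "\<dots> = meander_comm A B (\<lambda>i k. x $$ (i,k)) q p"
    unfolding sum.distrib sum_subtractf s1 s2 t1 t2 meander_comm_def \<sigma>_def[symmetric] \<tau>_def[symmetric]
    by simp
  finally show ?thesis .
qed

lemma sum_meander_comm_diagonal:
  assumes A: "sum_list A = n" and B: "sum_list B = n"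
  shows "(\<Sum>p<n. meander_comm A B x p p) = 0"
proof -
  have "(\<Sum>p<n. if p < block_refl A p then x (block_refl A p) p else 0)
      = (\<Sum>p<n. if block_refl A p < p then x p (block_refl A p) else 0)"
    by (rule sum.reindex_bij_witness[of _ "block_refl A" "block_refl A"])
      (use A in \<open>auto simp: block_refl_less block_refl_invol\<close>)
  moreover have "(\<Sum>p<n. if block_refl B p < p then x (block_refl B p) p else 0)
      = (\<Sum>p<n. if p < block_refl B p then x p (block_refl B p) else 0)"
    by (rule sum.reindex_bij_witness[of _ "block_refl B" "block_refl B"])
      (use B in \<open>auto simp: block_refl_less block_refl_invol\<close>)
  ultimately show ?thesis
    unfolding meander_comm_def sum.distrib sum_subtractf by simp
qed

text \<open>
  The basis of the seaweed algebra consists of the matrix units at admissible positions, where a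
  diagonal unit is corrected by the last one to have trace zero. The last diagonal position
  itself is left out, and the coordinates are then simply the entries at the other positions.
\<close>
locale seaweed_algebra =
  fixes A B :: "nat list" and n :: nat
  assumes sum_A: "sum_list A = n" and sum_B: "sum_list B = n" and n_pos: "n > 0"
begin

definition positions :: "(nat \<times> nat) set" where
  "positions = {(i, k). i < n \<and> k < n \<and> admissible A B i k} - {(n - 1, n - 1)}"

definition pos :: "nat \<Rightarrow> nat \<times> nat" where
  "pos = (SOME f. bij_betw f {..<card positions} positions)"

definition basis_mat :: "nat \<times> nat \<Rightarrow> complex mat" where
  "basis_mat p = (if fst p = snd p then mat_unit n (fst p) (fst p) - mat_unit n (n - 1) (n - 1)
     else mat_unit n (fst p) (snd p))"

lemma finite_positions: "finite positions"
  by (rule finite_subset[of _ "{..<n} \<times> {..<n}"]) (auto simp: positions_def)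

lemma pos_bij: "bij_betw pos {..<card positions} positions"
proof -
  have "\<exists>f. bij_betw f {..<card positions} positions"
    using ex_bij_betw_nat_finite[OF finite_positions] by (simp add: atLeast0LessThan)
  then show ?thesis unfolding pos_def by (rule someI_ex)
qed

lemma in_seaweed_iff:
  "x \<in> seaweed A B \<longleftrightarrow> x \<in> carrier_mat n n \<and> (\<Sum>i<n. x $$ (i,i)) = 0 \<and>
     (\<forall>i<n. \<forall>k<n. x $$ (i,k) \<noteq> 0 \<longrightarrow> admissible A B i k)"
proof -
  have "(i > k \<and> block_of A i = block_of A k \<or> i < k \<and> block_of B i = block_of B k)
      = (i > k \<and> same_block A i k \<or> i < k \<and> same_block B i k)" if "i < n" "k < n" for i k
    using that block_of_eq_iff[of i A k] block_of_eq_iff[of i B k] sum_A sum_B by simp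
  then show ?thesis
    unfolding seaweed_def sl_mat_def admissible_def sum_A by auto
qed

lemma basis_mat_carrier: "basis_mat p \<in> carrier_mat n n"
  unfolding basis_mat_def by (auto intro: minus_carrier_mat)

lemma basis_mat_index:
  assumes "i < n" "k < n"
  shows "basis_mat p $$ (i,k) = (if (i,k) = p then 1 else 0) - (if fst p = snd p \<and> i = n - 1 \<and> k = n - 1 then 1 else 0)"
  using assms by (cases p) (auto simp: basis_mat_def)

lemma basis_mat_in:
  assumes "p \<in> positions"
  shows "basis_mat p \<in> seaweed A B"
proof -
  obtain u v where p: "p = (u, v)" by (cases p)
  have uv: "u < n" "v < n" "admissible A B u v" using assms by (auto simp: positions_def p)
  have "(\<Sum>i<n. basis_mat p $$ (i,i)) = (\<Sum>i<n. (if i = u then (if u = v then 1 else 0) else 0))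
      - (\<Sum>i<n. (if i = n - 1 then (if u = v then 1 else 0) else (0::complex)))"
    unfolding sum_subtractf[symmetric] by (rule sum.cong) (auto simp: basis_mat_index p)
  also have "\<dots> = 0" using uv n_pos by (simp add: sum.delta)
  finally show ?thesis
    unfolding in_seaweed_iff using uv(3)
    by (auto simp: basis_mat_carrier basis_mat_index p admissible_def split: if_splits)
qed

lemma bracket_in_seaweed:
  assumes x: "x \<in> seaweed A B" and y: "y \<in> seaweed A B"
  shows "lie_bracket x y \<in> seaweed A B"
proof -
  have xc: "x \<in> carrier_mat n n" and yc: "y \<in> carrier_mat n n" using x y in_seaweed_iff by auto
  have supp: "(\<Sum>l<n. x $$ (i,l) * y $$ (l,k)) = 0"
    if "\<not> admissible A B i k" "i < n" "k < n" "x \<in> seaweed A B" "y \<in> seaweed A B" for i k x y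
  proof (rule sum.neutral, rule ballI)
    fix l assume "l \<in> {..<n}"
    then have "x $$ (i,l) = 0 \<or> y $$ (l,k) = 0"
      using that admissible_trans[of A B i l k] unfolding in_seaweed_iff by auto
    then show "x $$ (i,l) * y $$ (l,k) = 0" by auto
  qed
  have "(\<Sum>i<n. lie_bracket x y $$ (i,i)) =
      (\<Sum>i<n. \<Sum>l<n. x $$ (i,l) * y $$ (l,i)) - (\<Sum>i<n. \<Sum>l<n. y $$ (i,l) * x $$ (l,i))"
    by (simp add: lie_bracket_index[OF xc yc] sum_subtractf)
  also have "(\<Sum>i<n. \<Sum>l<n. y $$ (i,l) * x $$ (l,i)) = (\<Sum>i<n. \<Sum>l<n. x $$ (i,l) * y $$ (l,i))"
    by (subst sum.swap) (simp add: mult.commute)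
  finally have tr: "(\<Sum>i<n. lie_bracket x y $$ (i,i)) = 0" by simp
  have "admissible A B i k" if "i < n" "k < n" "lie_bracket x y $$ (i,k) \<noteq> 0" for i k
  proof (rule ccontr)
    assume "\<not> admissible A B i k"
    then show False
      using that supp[OF _ that(1,2) x y] supp[OF _ that(1,2) y x] by (simp add: lie_bracket_index[OF xc yc])
  qed
  then show ?thesis unfolding in_seaweed_iff using tr xc yc by auto
qed

abbreviation dimension :: nat where "dimension \<equiv> card positions"

definition coords :: "complex mat \<Rightarrow> nat \<Rightarrow> complex" where
  "coords x a = x $$ pos a"

lemma pos_in: "a < dimension \<Longrightarrow> pos a \<in> positions"
  using pos_bij by (auto simp: bij_betw_def)

lemma comb_in_seaweed: "mat_comb n dimension (\<lambda>a. basis_mat (pos a)) u \<in> seaweed A B"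
proof -
  let ?e = "\<lambda>a. basis_mat (pos a)"
  have e: "?e a \<in> seaweed A B" if "a < dimension" for a using basis_mat_in pos_in that by blast
  have "(\<Sum>i<n. \<Sum>a<dimension. u a * ?e a $$ (i,i)) = (\<Sum>a<dimension. u a * (\<Sum>i<n. ?e a $$ (i,i)))"
    by (subst sum.swap) (simp add: sum_distrib_left)
  also have "\<dots> = 0" using e by (simp add: in_seaweed_iff)
  finally have tr: "(\<Sum>i<n. mat_comb n dimension ?e u $$ (i,i)) = 0" by simp
  have "admissible A B i k" if "i < n" "k < n" "mat_comb n dimension ?e u $$ (i,k) \<noteq> 0" for i k
  proof -
    have "(\<Sum>a<dimension. u a * ?e a $$ (i,k)) \<noteq> 0" using that by simp
    then obtain a where "a < dimension" "?e a $$ (i,k) \<noteq> 0"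
      by (rule sum.not_neutral_contains_not_neutral) auto
    then show ?thesis using e that unfolding in_seaweed_iff by blast
  qed
  then show ?thesis unfolding in_seaweed_iff using tr by auto
qed

lemma coords_comb:
  assumes "a < dimension"
  shows "coords (mat_comb n dimension (\<lambda>a. basis_mat (pos a)) u) a = u a"
proof -
  obtain i k where ik: "pos a = (i, k)" by (cases "pos a")
  have p: "i < n" "k < n" "(i, k) \<noteq> (n - 1, n - 1)" using pos_in[OF assms] by (auto simp: positions_def ik)
  have inj: "pos b = pos a \<longleftrightarrow> b = a" if "b < dimension" for b
    using pos_bij that assms by (auto simp: bij_betw_def inj_on_def)
  have "basis_mat (pos b) $$ (i, k) = (if b = a then 1 else 0)" if "b < dimension" for b
  proof -
    have "(i, k) = pos b \<longleftrightarrow> b = a" using inj[OF that] ik by auto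
    moreover have "\<not> (i = n - 1 \<and> k = n - 1)" using p(3) by auto
    ultimately show ?thesis unfolding basis_mat_index[OF p(1,2)] by simp
  qed
  then have "(\<Sum>b<dimension. u b * basis_mat (pos b) $$ (i, k)) = (\<Sum>b<dimension. if b = a then u b else 0)"
    by (intro sum.cong) auto
  then show ?thesis using assms p by (simp add: coords_def ik sum.delta)
qed

lemma comb_coords:
  assumes x: "x \<in> seaweed A B"
  shows "mat_comb n dimension (\<lambda>a. basis_mat (pos a)) (coords x) = x" (is "?y = x")
proof -
  have xc: "x \<in> carrier_mat n n" using x in_seaweed_iff by auto
  have y: "?y \<in> seaweed A B" by (rule comb_in_seaweed)
  have eq: "?y $$ (i,k) = x $$ (i,k)" if ik: "i < n" "k < n" "(i,k) \<noteq> (n - 1, n - 1)" for i k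
  proof (cases "admissible A B i k")
    case True
    then have "(i,k) \<in> positions" using ik by (simp add: positions_def)
    then have "(i,k) \<in> pos ` {..<dimension}" using pos_bij by (simp add: bij_betw_def)
    then obtain a where "a < dimension" "pos a = (i,k)" by auto
    then show ?thesis using coords_comb[of a "coords x"] by (simp add: coords_def)
  next
    case False
    then have "?y $$ (i,k) = 0" "x $$ (i,k) = 0" using x y ik unfolding in_seaweed_iff by blast+
    then show ?thesis by simp
  qed
  obtain m where m: "n = Suc m" using n_pos by (cases n) auto
  have "(\<Sum>i<m. ?y $$ (i,i)) = (\<Sum>i<m. x $$ (i,i))" 
  proof (rule sum.cong[OF refl])
    fix i assume "i \<in> {..<m}"
    then have "i < n" "(i, i) \<noteq> (n - 1, n - 1)" using m by auto
    then show "?y $$ (i,i) = x $$ (i,i)" by (intro eq)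
  qed
  moreover have "(\<Sum>i<n. ?y $$ (i,i)) = 0" "(\<Sum>i<n. x $$ (i,i)) = 0" using x y unfolding in_seaweed_iff by blast+
  ultimately have "?y $$ (m,m) = x $$ (m,m)" by (simp only: m sum.lessThan_Suc) (metis add_left_cancel)
  then have "?y $$ (i,k) = x $$ (i,k)" if "i < n" "k < n" for i k
    using eq[OF that] by (cases "(i,k) = (n - 1, n - 1)") (auto simp: m)
  then show ?thesis using xc by (intro carrier_mat_eqI[of _ n]) simp_all
qed

sublocale lie_algebra_with_basis n dimension "seaweed A B" "\<lambda>a. basis_mat (pos a)" coords
proof
  show "seaweed A B \<subseteq> carrier_mat n n" using in_seaweed_iff by auto
qed (auto intro: bracket_in_seaweed basis_mat_in pos_in comb_in_seaweed coords_comb comb_coords)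

lemma meander_functional_linear: "linear_functional_on (seaweed A B) (meander_functional A B)"
proof -
  have lt: "block_refl A i < n" "block_refl B i < n" if "i < n" for i
    using that block_refl_less[of i A] block_refl_less[of i B] sum_A sum_B by auto
  have add: "meander_functional A B (x + y) = meander_functional A B x + meander_functional A B y"
    if "x \<in> carrier_mat n n" "y \<in> carrier_mat n n" for x y
    unfolding meander_functional_def sum.distrib[symmetric] sum_A
    using that lt by (intro sum.cong refl) simp
  have smult: "meander_functional A B (c \<cdot>\<^sub>m x) = c * meander_functional A B x" if "x \<in> carrier_mat n n" for c x
    unfolding meander_functional_def sum_distrib_left sum_A
    using that lt by (intro sum.cong refl) (simp add: distrib_left)
  show ?thesis
    unfolding linear_functional_on_def using add smult carrier by blast
qed

lemma meander_functional_diff: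
  assumes "x \<in> carrier_mat n n" "y \<in> carrier_mat n n"
  shows "meander_functional A B (x - y) = meander_functional A B x - meander_functional A B y"
proof -
  have lt: "block_refl A i < n" "block_refl B i < n" if "i < n" for i
    using that block_refl_less[of i A] block_refl_less[of i B] sum_A sum_B by auto
  show ?thesis
    unfolding meander_functional_def sum_subtractf[symmetric] sum_A
    using assms lt by (intro sum.cong refl) simp
qed

text \<open>
  Pairing \<open>x\<close> with the basis gives the equations of the meander kernel off the diagonal and the equality
  of all diagonal equations. A commutator has trace zero, so the common value is zero, and rigidity leaves only
  scalar matrices, of which only \<open>0\<close> has trace zero.
\<close>
theorem meander_functional_frobenius:
  assumes rigid: "rigid A B"
  shows "frobenius_functional n (seaweed A B) (meander_functional A B)"
  unfolding frobenius_functional_def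
proof (intro conjI ballI impI)
  show "linear_functional_on (seaweed A B) (meander_functional A B)" by (rule meander_functional_linear)
  fix x assume x: "x \<in> seaweed A B" and ker: "\<forall>y\<in>seaweed A B. kirillov_form (meander_functional A B) x y = 0"
  have xc: "x \<in> carrier_mat n n" using carrier x .
  define X where "X i k = x $$ (i,k)" for i k
  have F: "meander_functional A B (lie_bracket x (mat_unit n p q)) = meander_comm A B X q p" if "p < n" "q < n" for p q
    unfolding X_def by (rule meander_functional_bracket[OF xc that sum_A sum_B])
  have off: "meander_comm A B X q p = 0" if "p < n" "q < n" "admissible A B p q" "p \<noteq> q" for p q
  proof -
    have "basis_mat (p, q) \<in> seaweed A B" using that by (intro basis_mat_in) (auto simp: positions_def)
    then show ?thesis using ker F[OF that(1,2)] that(4) by (simp add: basis_mat_def kirillov_form_def)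
  qed
  have diag: "meander_comm A B X p p = meander_comm A B X (n - 1) (n - 1)" if "p < n" for p
  proof (cases "p = n - 1")
    case False
    have "basis_mat (p, p) \<in> seaweed A B" using that False by (intro basis_mat_in) (auto simp: positions_def admissible_def)
    then have "meander_functional A B (lie_bracket x (mat_unit n p p - mat_unit n (n - 1) (n - 1))) = 0"
      using ker by (auto simp: basis_mat_def kirillov_form_def)
    also have "lie_bracket x (mat_unit n p p - mat_unit n (n - 1) (n - 1)) =
        lie_bracket x (mat_unit n p p) - lie_bracket x (mat_unit n (n - 1) (n - 1))"
      by (rule lie_bracket_diff_right[OF xc mat_unit_carrier mat_unit_carrier])
    finally show ?thesis using that n_pos xc by (simp add: meander_functional_diff F)
  qed simp
  have "0 = (\<Sum>p<n. meander_comm A B X p p)" by (rule sum_meander_comm_diagonal[OF sum_A sum_B, symmetric])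
  also have "\<dots> = (\<Sum>p<n. meander_comm A B X (n - 1) (n - 1))" by (intro sum.cong refl diag) simp
  finally have "meander_comm A B X (n - 1) (n - 1) = 0" using n_pos by simp
  then have "meander_comm A B X q p = 0" if "p < n" "q < n" "admissible A B p q" for p q
    using off[OF that] trans[OF diag[OF that(1)]] by (cases "p = q") blast+
  moreover have "\<forall>i<n. \<forall>k<n. X i k \<noteq> 0 \<longrightarrow> admissible A B i k"
    using x unfolding in_seaweed_iff X_def by blast
  ultimately have "meander_kernel A B X" by (simp add: meander_kernel_def sum_A)
  then obtain c where c: "\<forall>i<n. \<forall>k<n. X i k = (if i = k then c else 0)"
    using rigid sum_A unfolding rigid_def by blast
  have "(\<Sum>i<n. X i i) = 0" using x by (simp add: in_seaweed_iff X_def)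
  moreover have "(\<Sum>i<n. X i i) = (\<Sum>i<n. c)" by (rule sum.cong) (use c in auto)
  ultimately have "c = 0" using n_pos by simp
  then show "x = 0\<^sub>m n n" using xc c by (intro carrier_mat_eqI[of _ n]) (auto simp: X_def)
qed

text \<open>
  The principal element of the meander functional is the diagonal matrix of the heights, shifted by
  their average to have trace zero. It acts on the unit at \<open>(i, k)\<close> by \<open>h i - h k\<close>.
\<close>
theorem principal_mult_seaweed:
  assumes rigid: "rigid A B" and F: "frobenius_functional n (seaweed A B) F"
    and edge_A: "\<And>i. i < n \<Longrightarrow> i < block_refl A i \<Longrightarrow> h (block_refl A i) - h i = 1"
    and edge_B: "\<And>i. i < n \<Longrightarrow> i < block_refl B i \<Longrightarrow> h i - h (block_refl B i) = 1"
    and j: "j \<noteq> 0"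
  shows "principal_mult n (seaweed A B) F j =
    card (ascending_pairs A (\<lambda>i. - h i) j) + card (ascending_pairs B h j)"
proof -
  define avg where "avg = (\<Sum>i<n. of_int (h i)) / (of_nat n :: complex)"
  define K where "K = mat n n (\<lambda>(i,k). if i = k then of_int (h i) - avg else (0::complex))"
  have Kc: "K \<in> carrier_mat n n" by (simp add: K_def)
  have "(\<Sum>i<n. K $$ (i,i)) = 0" using n_pos by (simp add: K_def avg_def sum_subtractf)
  then have K: "K \<in> seaweed A B" unfolding in_seaweed_iff using Kc by (auto simp: K_def admissible_def)
  have KB: "lie_bracket K y $$ (i,k) = of_int (h i - h k) * y $$ (i,k)"
    if "y \<in> carrier_mat n n" "i < n" "k < n" for y i k
  proof -
    have l: "(\<Sum>l<n. K $$ (i,l) * y $$ (l,k)) = K $$ (i,i) * y $$ (i,k)"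
      using that by (intro sum_single) (auto simp: K_def)
    have r: "(\<Sum>l<n. y $$ (i,l) * K $$ (l,k)) = y $$ (i,k) * K $$ (k,k)"
      using that by (intro sum_single) (auto simp: K_def)
    show ?thesis
      unfolding lie_bracket_index[OF Kc that] l r using that by (simp add: K_def algebra_simps)
  qed
  have lt: "block_refl A i < n" "block_refl B i < n" and inv: "block_refl A (block_refl A i) = i" if "i < n" for i
    using that block_refl_less[of i A] block_refl_less[of i B] block_refl_invol[of i A] sum_A sum_B by auto
  have princ: "meander_functional A B (lie_bracket K y) = meander_functional A B y" if "y \<in> seaweed A B" for y
    unfolding meander_functional_def sum_A
  proof (intro sum.cong refl)
    fix i assume "i \<in> {..<n}"
    then have i: "i < n" by simp
    have "h i - h (block_refl A i) = 1" if "block_refl A i < i"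
      using edge_A[of "block_refl A i"] lt[OF i] inv[OF i] that by simp
    then show "(if block_refl A i < i then lie_bracket K y $$ (i, block_refl A i) else 0) +
         (if i < block_refl B i then lie_bracket K y $$ (i, block_refl B i) else 0) =
         (if block_refl A i < i then y $$ (i, block_refl A i) else 0) +
         (if i < block_refl B i then y $$ (i, block_refl B i) else 0)"
      using edge_B[OF i] lt[OF i] i carrier[OF that] by (simp add: KB del: of_int_diff)
  qed
  define w where "w a = (case pos a of (i, k) \<Rightarrow> h i - h k)" for a
  have eig: "lie_bracket K (basis_mat (pos a)) = of_int (w a) \<cdot>\<^sub>m basis_mat (pos a)" if "a < dimension" for a
    using Kc basis_mat_carrier[of "pos a"]
  proof (intro carrier_mat_eqI[of _ n] lie_bracket_carrier smult_carrier_mat)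
    fix i k assume ik: "i < n" "k < n"
    have "basis_mat (pos a) $$ (i,k) = 0 \<or> h i - h k = w a"
      using ik by (cases "pos a") (auto simp: basis_mat_index w_def)
    then show "lie_bracket K (basis_mat (pos a)) $$ (i,k) = (of_int (w a) \<cdot>\<^sub>m basis_mat (pos a)) $$ (i,k)"
      using ik basis_mat_carrier[of "pos a"] by (auto simp: KB simp del: of_int_diff)
  qed
  have "principal_mult n (seaweed A B) F j = card {a. a < dimension \<and> w a = j}"
    by (rule principal_mult_eq_card[OF meander_functional_frobenius[OF rigid] F K princ eig])
  also have "\<dots> = card {(i, k). (i, k) \<in> positions \<and> h i - h k = j}"
  proof (rule bij_betw_same_card)
    show "bij_betw pos {a. a < dimension \<and> w a = j} {(i, k). (i, k) \<in> positions \<and> h i - h k = j}"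
      unfolding bij_betw_def
    proof (intro conjI equalityI subsetI)
      show "inj_on pos {a. a < dimension \<and> w a = j}"
        using pos_bij by (auto simp: bij_betw_def intro: inj_on_subset)
      show "x \<in> {(i, k). (i, k) \<in> positions \<and> h i - h k = j}" if "x \<in> pos ` {a. a < dimension \<and> w a = j}" for x
        using that pos_in by (force simp: w_def split: prod.splits)
      show "x \<in> pos ` {a. a < dimension \<and> w a = j}" if x: "x \<in> {(i, k). (i, k) \<in> positions \<and> h i - h k = j}" for x
      proof -
        have "x \<in> pos ` {..<dimension}" using x pos_bij by (auto simp: bij_betw_def)
        then obtain a where "a < dimension" "x = pos a" by auto
        then show ?thesis using x by (auto simp: w_def)
      qed
    qed
  qed
  also have "{(i, k). (i, k) \<in> positions \<and> h i - h k = j} =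
      prod.swap ` ascending_pairs A (\<lambda>i. - h i) j \<union> ascending_pairs B h j"
    using j by (auto simp: positions_def ascending_pairs_def admissible_def sum_A sum_B same_block_commute image_iff)
  also have "card \<dots> = card (prod.swap ` ascending_pairs A (\<lambda>i. - h i) j) + card (ascending_pairs B h j)"
    by (rule card_Un_disjoint) (auto simp: finite_ascending_pairs, auto simp: ascending_pairs_def)
  also have "card (prod.swap ` ascending_pairs A (\<lambda>i. - h i) j) = card (ascending_pairs A (\<lambda>i. - h i) j)"
    by (rule card_image) (auto simp: inj_on_def)
  finally show ?thesis .
qed

end

theorem theorem5p1:
  fixes t r :: nat and j :: int and F :: "complex mat \<Rightarrow> complex"
  assumes "t \<ge> 6"
    and "frobenius_functional (p_size t r) (p_ttr t r) F"
    and "3 \<le> j" and "j \<le> int t - 3"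
  shows "real (principal_mult (p_size t r) (p_ttr t r) F j)
           - real (principal_mult (p_size t r) (p_ttr t r) F (j + 1))
         = 6 * real_of_int j * real t - (9 * (real_of_int j)\<^sup>2 + real_of_int j) / 2 + 1 - 4 * real r"
proof -
  have t: "t > 0" using assms(1) by simp
  define n where "n = 2 * t\<^sup>2 + 4 * r"
  interpret seaweed_algebra "[n]" "lower_blocks t r" n
    by unfold_locales (use t in \<open>auto simp: n_def sum_lower_blocks\<close>)
  have p: "p_size t r = n" "p_ttr t r = seaweed [n] (lower_blocks t r)"
    by (simp_all add: p_size_def p_ttr_def n_def lower_blocks_def)
  have rigid: "rigid [n] (lower_blocks t r)"
    unfolding n_def lower_blocks_def by (rule rigid_pttr[OF t])
  have "principal_mult (p_size t r) (p_ttr t r) F j =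
      card (ascending_pairs [n] (\<lambda>i. - height t r i) j) + card (ascending_pairs (lower_blocks t r) (height t r) j)"
    if "j \<noteq> 0" for j
    unfolding p
  proof (rule principal_mult_seaweed[OF rigid _ _ _ that])
    show "frobenius_functional n (seaweed [n] (lower_blocks t r)) F" using assms(2) unfolding p .
    show "height t r (block_refl [n] i) - height t r i = 1" if "i < n" "i < block_refl [n] i" for i
      using that height_edge_top[OF t, of i r] by (simp add: n_def)
    show "height t r i - height t r (block_refl (lower_blocks t r) i) = 1"
      if "i < n" "i < block_refl (lower_blocks t r) i" for i
      using that by (intro height_edge_bottom[OF t]) (auto simp: n_def sum_lower_blocks[OF t])
  qed
  then show ?thesis
    using meander_pair_count_difference[OF assms(3,4), of r] assms(3) by (simp add: n_def)
qed

end
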